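(* Let $K$ be an algebraically closed field of characteristic $0$, let $V$ be a $K$-vector space of dimension $n+1$, let $k$ be a positive integer with $k\le \lfloor (n+1)/2\rfloor$, and let $s$ be a positive integer. Let $[\nu_k(G_{k,n+1})]^s\subseteq \mathbb{P}(\wedge^k V)$ be the $s$-th secant variety of the Plücker-embedded Grassmannian of $k$-dimensional subspaces of $V$. Then: (i) If $k=2$, then $[\nu_2(G_{2,n+1})]^s$ is defective for $s<E(2,n+1)=\lfloor \frac{n+1}{2}\rfloor$, with defectiveness $2s(s-1)$. (ii) If $k\ge 3$ and $ks\le n+1$, then $[\nu_k(G_{k,n+1})]^s$ has the expected dimension.
   Context: $G_{k,n+1}$ is the Grassmannian of $k$-dimensional linear subspaces of $V\simeq K^{n+1}$, and $\nu_k:G_{k,n+1}\to \mathbb{P}(\wedge^kV)\simeq\mathbb{P}^{N_k}$, with $N_k=\binom{n+1}{k}-1$, is the Plücker embedding $\langle v_1,\dots,v_k\rangle\mapsto [v_1\wedge\cdots\wedge v_k]$; its image has dimension $k(n+1-k)$. For a closed irreducible projective variety $X\subseteq\mathbb{P}^N$, the $s$-th (higher) secant variety $X^s$ is the closure of the union of all linear spaces spanned by $s$ points of $X$. Its expected dimension is $\min\{N,\ s\dim X+s-1\}$; for $X=\nu_k(G_{k,n+1})$ this is $\min\left\{\binom{n+1}{k}-1,\ s\,k(n+1-k)+(s-1)\right\}$. The variety $X^s$ is called defective if $\dim X^s<\min\{N,\ s\dim X+s-1\}$, and its defectiveness is the quantity $\min\{N,\ s\dim X+s-1\}-\dim X^s$.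 The $\wedge$-rank of $T\in\wedge^kV$ is the least $r$ such that $T$ is a sum of $r$ decomposable vectors $v_1\wedge\cdots\wedge v_k$ with $v_i\in V$. The typical rank $E(k,n+1)$ is the least integer for which there is a Zariski-dense subset of $\wedge^kV$ all of whose elements have $\wedge$-rank $\le E(k,n+1)$; equivalently, $E(k,n+1)=\min\{s : [\nu_k(G_{k,n+1})]^s=\mathbb{P}^{N_k}\}$.
   Formalization: In (i) "defective" is claimed for 2 ≤ s < E (it fails at s=1); defectiveness equals 2s(s-1) only if s dim X + s-1 ≤ N (for n+1=6, s=2 it is 1, not 4); for all 1 ≤ s < E it is shown that dim X^s = s dim X + s-1 - 2s(s-1). *)

theory Defs
  imports
    "HOL-Analysis.Abstract_Topology"
    "HOL-Library.Extended_Nat"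
    "HOL-Library.Function_Algebras"
    "HOL-Computational_Algebra.Polynomial"
begin

section \<open>Exterior powers\<close>

definition alternating ::
  "('a::field \<Rightarrow> 'v::ab_group_add \<Rightarrow> 'v) \<Rightarrow> ('a \<Rightarrow> 'u::ab_group_add \<Rightarrow> 'u) \<Rightarrow>
     nat \<Rightarrow> ('v list \<Rightarrow> 'u) \<Rightarrow> bool"
  where "alternating scale scale' k f \<longleftrightarrow>
    (\<forall>xs ys. length xs + length ys + 1 = k \<longrightarrow>
        Vector_Spaces.linear scale scale' (\<lambda>x. f (xs @ x # ys))) \<and>
    (\<forall>vs. length vs = k \<and> \<not> distinct vs \<longrightarrow> f vs = 0)"

text \<open>
  The exterior power \<open>\<Lambda>\<^sup>k V\<close> is realised inside the dual of the space of alternating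
  \<open>k\<close>-forms on \<open>V\<close>: the vector \<open>v\<^sub>1 \<and> \<dots> \<and> v\<^sub>k\<close> is evaluation at \<open>(v\<^sub>1, \<dots>, v\<^sub>k)\<close>.
  That this is the exterior power (for every \<open>V\<close>) is the universal property proved
  below in \<open>alternating_wedge\<close> and \<open>exterior_power_universal\<close>.
  The value 0 off the alternating forms only makes the representation unique.
\<close>

definition fscale :: "'a::field \<Rightarrow> ('c \<Rightarrow> 'a) \<Rightarrow> ('c \<Rightarrow> 'a)"
  where "fscale c T = (\<lambda>\<phi>. c * T \<phi>)"

definition wedge ::
  "('a::field \<Rightarrow> 'v::ab_group_add \<Rightarrow> 'v) \<Rightarrow> nat \<Rightarrow> 'v list \<Rightarrow> (('v list \<Rightarrow> 'a) \<Rightarrow> 'a)"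
  where "wedge scale k vs = (\<lambda>\<phi>. if alternating scale (*) k \<phi> then \<phi> vs else 0)"

definition exterior_power ::
  "('a::field \<Rightarrow> 'v::ab_group_add \<Rightarrow> 'v) \<Rightarrow> nat \<Rightarrow> (('v list \<Rightarrow> 'a) \<Rightarrow> 'a) set"
  where "exterior_power scale k = module.span fscale (wedge scale k ` {vs. length vs = k})"

lemma vector_space_fscale: "vector_space (fscale :: 'a::field \<Rightarrow> ('c \<Rightarrow> 'a) \<Rightarrow> _)"
  by unfold_locales (auto simp: fscale_def fun_eq_iff algebra_simps)

lemma vector_space_mult: "vector_space ((*) :: 'a::field \<Rightarrow> 'a \<Rightarrow> 'a)"
  by unfold_locales (auto simp: algebra_simps)

lemma alternating_wedge:
  fixes scale :: "'a::field \<Rightarrow> 'v::ab_group_add \<Rightarrow> 'v"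
  assumes "vector_space scale"
  shows "alternating scale fscale k (wedge scale k)"
proof -
  interpret V: vector_space scale by fact
  interpret F: vector_space "fscale :: 'a \<Rightarrow> (('v list \<Rightarrow> 'a) \<Rightarrow> 'a) \<Rightarrow> _"
    by (rule vector_space_fscale)
  interpret K: vector_space "(*) :: 'a \<Rightarrow> 'a \<Rightarrow> 'a" by (rule vector_space_mult)
  interpret VK: vector_space_pair scale "(*) :: 'a \<Rightarrow> 'a \<Rightarrow> 'a" ..
  have "Vector_Spaces.linear scale fscale (\<lambda>x. wedge scale k (xs @ x # ys))"
    if len: "length xs + length ys + 1 = k" for xs ys
  proof (unfold_locales, goal_cases)
    case (1 x y)
    have "\<phi> (xs @ (x + y) # ys) = \<phi> (xs @ x # ys) + \<phi> (xs @ y # ys)"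
      if "alternating scale (*) k \<phi>" for \<phi>
    proof -
      have "Vector_Spaces.linear scale (*) (\<lambda>x. \<phi> (xs @ x # ys))"
        using that len unfolding alternating_def by blast
      from VK.linear_add[OF this] show ?thesis .
    qed
    then show ?case by (auto simp: wedge_def fun_eq_iff)
  next
    case (2 c x)
    have "\<phi> (xs @ scale c x # ys) = c * \<phi> (xs @ x # ys)"
      if "alternating scale (*) k \<phi>" for \<phi>
    proof -
      have "Vector_Spaces.linear scale (*) (\<lambda>x. \<phi> (xs @ x # ys))"
        using that len unfolding alternating_def by blast
      from VK.linear_scale[OF this] show ?thesis .
    qed
    then show ?case by (auto simp: wedge_def fscale_def fun_eq_iff)
  qed
  then show ?thesis
    by (auto simp: alternating_def wedge_def fun_eq_iff)
qed

lemma exterior_power_universal: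
  fixes scale :: "'a::field \<Rightarrow> 'v::ab_group_add \<Rightarrow> 'v"
    and scale' :: "'a \<Rightarrow> 'u::ab_group_add \<Rightarrow> 'u"
  assumes "vector_space scale" "vector_space scale'" and f: "alternating scale scale' k f"
  shows "\<exists>g. Vector_Spaces.linear fscale scale' g \<and>
             (\<forall>vs. length vs = k \<longrightarrow> g (wedge scale k vs) = f vs)"
    and "\<And>g h. \<lbrakk>Vector_Spaces.linear fscale scale' g; Vector_Spaces.linear fscale scale' h;
             \<forall>vs. length vs = k \<longrightarrow> g (wedge scale k vs) = f vs;
             \<forall>vs. length vs = k \<longrightarrow> h (wedge scale k vs) = f vs\<rbrakk>
           \<Longrightarrow> \<forall>T\<in>exterior_power scale k. g T = h T"
proof -
  interpret V: vector_space scale by fact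
  interpret U: vector_space scale' by fact
  interpret F: vector_space "fscale :: 'a \<Rightarrow> (('v list \<Rightarrow> 'a) \<Rightarrow> 'a) \<Rightarrow> _"
    by (rule vector_space_fscale)
  interpret K: vector_space "(*) :: 'a \<Rightarrow> 'a \<Rightarrow> 'a" by (rule vector_space_mult)
  interpret FU: vector_space_pair "fscale :: 'a \<Rightarrow> (('v list \<Rightarrow> 'a) \<Rightarrow> 'a) \<Rightarrow> _" scale' ..
  interpret UK: vector_space_pair scale' "(*) :: 'a \<Rightarrow> 'a \<Rightarrow> 'a" ..
  let ?W = "wedge scale k ` {vs. length vs = k}"
  have sep: "x = 0" if all0: "\<And>l. Vector_Spaces.linear scale' (*) l \<Longrightarrow> l x = 0" for x
  proof (rule ccontr)
    assume "x \<noteq> 0"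
    then have "U.independent {x}" by simp
    then obtain l where "Vector_Spaces.linear scale' (*) l" "\<forall>y\<in>{x}. l y = (1::'a)"
      using UK.linear_independent_extend[of "{x}" "\<lambda>_. 1"] by blast
    then show False using all0[of l] by simp
  qed
  show "\<exists>g. Vector_Spaces.linear fscale scale' g \<and>
             (\<forall>vs. length vs = k \<longrightarrow> g (wedge scale k vs) = f vs)"
  proof -
    obtain B where B: "B \<subseteq> ?W" "F.independent B" "?W \<subseteq> F.span B"
      using F.maximal_independent_subset by blast
    define pick where "pick b = (SOME vs. length vs = k \<and> wedge scale k vs = b)" for b
    have pick: "length (pick b) = k \<and> wedge scale k (pick b) = b" if "b \<in> B" for b
    proof -
      have "\<exists>vs. length vs = k \<and> wedge scale k vs = b" using B(1) that by auto
      then show ?thesis unfolding pick_def by (rule someI_ex)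
    qed
    obtain g where g: "Vector_Spaces.linear fscale scale' g" "\<forall>b\<in>B. g b = f (pick b)"
      using FU.linear_independent_extend[OF B(2), of "\<lambda>b. f (pick b)"] by blast
    have "g (wedge scale k vs) = f vs" if vs: "length vs = k" for vs
    proof -
      have "wedge scale k vs \<in> F.span B" using B(3) vs by auto
      then obtain S c where S: "finite S" "S \<subseteq> B" "wedge scale k vs = (\<Sum>b\<in>S. fscale (c b) b)"
        unfolding F.span_explicit by auto
      have "g (wedge scale k vs) = (\<Sum>b\<in>S. scale' (c b) (g b))"
        using S(3) g(1) by (simp add: FU.linear_sum FU.linear_scale)
      also have "\<dots> = (\<Sum>b\<in>S. scale' (c b) (f (pick b)))"
        using S(2) g(2) by (intro sum.cong) auto
      finally have gw: "g (wedge scale k vs) = (\<Sum>b\<in>S. scale' (c b) (f (pick b)))" .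
      have "g (wedge scale k vs) - f vs = 0"
      proof (rule sep)
        fix l assume l: "Vector_Spaces.linear scale' (*) l"
        have alt: "alternating scale (*) k (\<lambda>vs. l (f vs))"
          unfolding alternating_def
        proof (intro conjI allI impI)
          fix xs ys :: "'v list"
          assume "length xs + length ys + 1 = k"
          then have "Vector_Spaces.linear scale scale' (\<lambda>x. f (xs @ x # ys))"
            using f unfolding alternating_def by blast
          from Vector_Spaces.linear_compose[OF this l]
          show "Vector_Spaces.linear scale (*) (\<lambda>x. l (f (xs @ x # ys)))"
            by (simp add: o_def)
        next
          fix vs :: "'v list"
          assume "length vs = k \<and> \<not> distinct vs"
          then have "f vs = 0" using f unfolding alternating_def by blast
          then show "l (f vs) = 0" using UK.linear_0[OF l] by simp
        qed
        have ev: "wedge scale k ws (\<lambda>vs. l (f vs)) = l (f ws)" for ws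
          using alt by (simp add: wedge_def)
        have app: "(\<Sum>b\<in>S. fscale (c b) b) \<phi> = (\<Sum>b\<in>S. c b * b \<phi>)" for \<phi>
          using S(1) by (induction S) (auto simp: fscale_def)
        have "l (f vs) = (\<Sum>b\<in>S. c b * b (\<lambda>vs. l (f vs)))"
          using ev[of vs] app[of "\<lambda>vs. l (f vs)"] S(3) by simp
        also have "\<dots> = (\<Sum>b\<in>S. c b * l (f (pick b)))"
        proof (intro sum.cong refl)
          fix b assume "b \<in> S"
          then show "c b * b (\<lambda>vs. l (f vs)) = c b * l (f (pick b))"
            using ev[of "pick b"] pick[of b] S(2) by auto
        qed
        also have "\<dots> = l (g (wedge scale k vs))"
          unfolding gw by (simp add: UK.linear_sum[OF l] UK.linear_scale[OF l])
        finally show "l (g (wedge scale k vs) - f vs) = 0"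
          by (simp add: UK.linear_diff[OF l])
      qed
      then show ?thesis by simp
    qed
    with g(1) show ?thesis by blast
  qed
  show "\<forall>T\<in>exterior_power scale k. g T = h T"
    if "Vector_Spaces.linear fscale scale' g" "Vector_Spaces.linear fscale scale' h"
       "\<forall>vs. length vs = k \<longrightarrow> g (wedge scale k vs) = f vs"
       "\<forall>vs. length vs = k \<longrightarrow> h (wedge scale k vs) = f vs" for g h
  proof
    fix T assume "T \<in> exterior_power scale k"
    then have T: "T \<in> F.span ?W" by (simp only: exterior_power_def)
    show "g T = h T"
      by (rule FU.linear_eq_on[OF that(1,2) T]) (use that(3,4) in auto)
  qed
qed


section \<open>Zariski topologies\<close>

text \<open>
  Throughout, \<open>W\<close> is a linear subspace of the vector space given by \<open>scale\<close>.  A linear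
  functional on \<open>W\<close> extends to the whole space, so all polynomial functions
  on \<open>W\<close> arise by restriction.
\<close>

inductive poly_fun :: "('a::field \<Rightarrow> 'w::ab_group_add \<Rightarrow> 'w) \<Rightarrow> ('w \<Rightarrow> 'a) \<Rightarrow> bool"
  for scale where
  const: "poly_fun scale (\<lambda>_. c)"
| linear: "Vector_Spaces.linear scale (*) l \<Longrightarrow> poly_fun scale l"
| add: "poly_fun scale p \<Longrightarrow> poly_fun scale q \<Longrightarrow> poly_fun scale (\<lambda>w. p w + q w)"
| mult: "poly_fun scale p \<Longrightarrow> poly_fun scale q \<Longrightarrow> poly_fun scale (\<lambda>w. p w * q w)"

text \<open>Over an infinite field this is homogeneity of degree \<open>d\<close>.\<close>

definition homogeneous ::
  "('a::field \<Rightarrow> 'w::ab_group_add \<Rightarrow> 'w) \<Rightarrow> nat \<Rightarrow> ('w \<Rightarrow> 'a) \<Rightarrow> bool"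
  where "homogeneous scale d p \<longleftrightarrow>
    poly_fun scale p \<and> (\<forall>c w. p (scale c w) = c ^ d * p w)"

definition affine_zariski ::
  "('a::field \<Rightarrow> 'w::ab_group_add \<Rightarrow> 'w) \<Rightarrow> 'w set \<Rightarrow> 'w topology"
  where "affine_zariski scale W = topology (\<lambda>U.
    \<exists>F. (\<forall>p\<in>F. poly_fun scale p) \<and> U = {w \<in> W. \<exists>p\<in>F. p w \<noteq> 0})"

text \<open>A point of \<open>\<P>(W)\<close> is a line through the origin in \<open>W\<close>.\<close>

definition proj_space :: "('a::field \<Rightarrow> 'w::ab_group_add \<Rightarrow> 'w) \<Rightarrow> 'w set \<Rightarrow> 'w set set"
  where "proj_space scale W = {module.span scale {w} | w. w \<in> W \<and> w \<noteq> 0}"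

definition proj_zariski ::
  "('a::field \<Rightarrow> 'w::ab_group_add \<Rightarrow> 'w) \<Rightarrow> 'w set \<Rightarrow> 'w set topology"
  where "proj_zariski scale W = topology (\<lambda>U.
    \<exists>F. (\<forall>p\<in>F. \<exists>d. homogeneous scale d p) \<and>
        U = {L \<in> proj_space scale W. \<exists>p\<in>F. \<exists>w\<in>L. p w \<noteq> 0})"

lemma openin_affine_zariski:
  "openin (affine_zariski scale W) U \<longleftrightarrow>
    (\<exists>F. (\<forall>p\<in>F. poly_fun scale p) \<and> U = {w \<in> W. \<exists>p\<in>F. p w \<noteq> 0})"
proof -
  let ?op = "\<lambda>U. \<exists>F. (\<forall>p\<in>F. poly_fun scale p) \<and> U = {w \<in> W. \<exists>p\<in>F. p w \<noteq> 0}"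
  have "istopology ?op"
    unfolding istopology_def
  proof (intro conjI allI impI)
    fix S T assume "?op S" "?op T"
    then obtain F G where F: "\<forall>p\<in>F. poly_fun scale p" "S = {w \<in> W. \<exists>p\<in>F. p w \<noteq> 0}"
      and G: "\<forall>p\<in>G. poly_fun scale p" "T = {w \<in> W. \<exists>p\<in>G. p w \<noteq> 0}" by blast
    let ?FG = "{\<lambda>w. p w * q w | p q. p \<in> F \<and> q \<in> G}"
    have "\<forall>r\<in>?FG. poly_fun scale r" using F(1) G(1) poly_fun.mult by fast
    moreover have "S \<inter> T = {w \<in> W. \<exists>r\<in>?FG. r w \<noteq> 0}"
    proof (intro equalityI subsetI)
      fix w assume "w \<in> S \<inter> T"
      then obtain p q where "w \<in> W" "p \<in> F" "q \<in> G" "p w * q w \<noteq> 0" using F(2) G(2) by auto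
      then show "w \<in> {w \<in> W. \<exists>r\<in>?FG. r w \<noteq> 0}"
        by (intro CollectI conjI bexI[of _ "\<lambda>w. p w * q w"]) auto
    next
      fix w assume "w \<in> {w \<in> W. \<exists>r\<in>?FG. r w \<noteq> 0}"
      then show "w \<in> S \<inter> T" using F(2) G(2) by auto
    qed
    ultimately show "?op (S \<inter> T)" by (intro exI[of _ ?FG] conjI)
  next
    fix \<K> assume K: "\<forall>S\<in>\<K>. ?op S"
    from bchoice[OF K] obtain F where F: "\<forall>S\<in>\<K>. (\<forall>p\<in>F S. poly_fun scale p) \<and> S = {w \<in> W. \<exists>p\<in>F S. p w \<noteq> 0}"
      by (elim exE)
    have "(\<Union>S\<in>\<K>. S) = (\<Union>S\<in>\<K>. {w \<in> W. \<exists>p\<in>F S. p w \<noteq> 0})"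
      by (rule SUP_cong[OF refl]) (rule F[rule_format, THEN conjunct2])
    also have "\<dots> = {w \<in> W. \<exists>p\<in>\<Union>(F ` \<K>). p w \<noteq> 0}" by blast
    finally have "\<Union>\<K> = \<dots>" by (simp only: image_ident)
    moreover have "\<forall>p\<in>\<Union>(F ` \<K>). poly_fun scale p" using F by blast
    ultimately show "?op (\<Union>\<K>)" by (intro exI[of _ "\<Union>(F ` \<K>)"] conjI)
  qed
  then show ?thesis by (simp add: affine_zariski_def)
qed

lemma openin_proj_zariski:
  assumes "vector_space scale"
  shows "openin (proj_zariski scale W) U \<longleftrightarrow>
    (\<exists>F. (\<forall>p\<in>F. \<exists>d. homogeneous scale d p) \<and>
         U = {L \<in> proj_space scale W. \<exists>p\<in>F. \<exists>w\<in>L. p w \<noteq> 0})"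
proof -
  interpret vector_space scale by fact
  let ?op = "\<lambda>U. \<exists>F. (\<forall>p\<in>F. \<exists>d. homogeneous scale d p) \<and>
        U = {L \<in> proj_space scale W. \<exists>p\<in>F. \<exists>w\<in>L. p w \<noteq> 0}"
  have prod: "homogeneous scale (d + e) (\<lambda>w. p w * q w)"
    if "homogeneous scale d p" "homogeneous scale e q" for d e p q
    using that by (auto simp: homogeneous_def power_add intro: poly_fun.mult)
  have line: "\<exists>w\<in>L. p w * q w \<noteq> 0"
    if asm: "L \<in> proj_space scale W" "homogeneous scale d p" "homogeneous scale e q"
       "w \<in> L" "p w \<noteq> 0" "w' \<in> L" "q w' \<noteq> 0" for L d e p q w w'
  proof -
    obtain u where u: "L = span {u}" using asm(1) unfolding proj_space_def by blast
    then obtain c c' where "w = scale c u" "w' = scale c' u"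
      using asm(4,6) by (auto simp: span_singleton)
    then have "p u * q u \<noteq> 0" using asm by (auto simp: homogeneous_def)
    moreover have "u \<in> L" using u by (simp add: span_base)
    ultimately show ?thesis by blast
  qed
  have "istopology ?op"
    unfolding istopology_def
  proof (intro conjI allI impI)
    fix S T assume "?op S" "?op T"
    then obtain F G where F: "\<forall>p\<in>F. \<exists>d. homogeneous scale d p"
        "S = {L \<in> proj_space scale W. \<exists>p\<in>F. \<exists>w\<in>L. p w \<noteq> 0}"
      and G: "\<forall>p\<in>G. \<exists>d. homogeneous scale d p"
        "T = {L \<in> proj_space scale W. \<exists>p\<in>G. \<exists>w\<in>L. p w \<noteq> 0}" by blast
    let ?FG = "{\<lambda>w. p w * q w | p q. p \<in> F \<and> q \<in> G}"
    have "\<forall>r\<in>?FG. \<exists>d. homogeneous scale d r" using F(1) G(1) prod by fast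
    moreover have "S \<inter> T = {L \<in> proj_space scale W. \<exists>r\<in>?FG. \<exists>w\<in>L. r w \<noteq> 0}"
    proof (intro equalityI subsetI)
      fix L assume "L \<in> S \<inter> T"
      then obtain p w q w' where *: "L \<in> proj_space scale W" "p \<in> F" "w \<in> L" "p w \<noteq> 0"
        "q \<in> G" "w' \<in> L" "q w' \<noteq> 0" using F(2) G(2) by blast
      then obtain d e where "homogeneous scale d p" "homogeneous scale e q"
        using F(1) G(1) by blast
      from line[OF *(1) this *(3,4,6,7)] obtain u where u: "u \<in> L" "p u * q u \<noteq> 0" by blast
      have "(\<lambda>w. p w * q w) \<in> ?FG" using *(2,5) by blast
      then have "\<exists>r\<in>?FG. \<exists>w\<in>L. r w \<noteq> 0"
        using u by (intro bexI[of _ "\<lambda>w. p w * q w"] bexI[of _ u])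
      then show "L \<in> {L \<in> proj_space scale W. \<exists>r\<in>?FG. \<exists>w\<in>L. r w \<noteq> 0}" using *(1) by simp
    next
      fix L assume "L \<in> {L \<in> proj_space scale W. \<exists>r\<in>?FG. \<exists>w\<in>L. r w \<noteq> 0}"
      then obtain p q w where *: "L \<in> proj_space scale W" "p \<in> F" "q \<in> G" "w \<in> L" "p w * q w \<noteq> 0"
        by blast
      then have "p w \<noteq> 0" "q w \<noteq> 0" by auto
      with * show "L \<in> S \<inter> T" unfolding F(2) G(2) by blast
    qed
    ultimately show "?op (S \<inter> T)" by (intro exI[of _ ?FG] conjI)
  next
    fix \<K> assume K: "\<forall>S\<in>\<K>. ?op S"
    from bchoice[OF K] obtain F where F: "\<forall>S\<in>\<K>. (\<forall>p\<in>F S. \<exists>d. homogeneous scale d p) \<and>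
        S = {L \<in> proj_space scale W. \<exists>p\<in>F S. \<exists>w\<in>L. p w \<noteq> 0}"
      by (elim exE)
    have "(\<Union>S\<in>\<K>. S) = (\<Union>S\<in>\<K>. {L \<in> proj_space scale W. \<exists>p\<in>F S. \<exists>w\<in>L. p w \<noteq> 0})"
      by (rule SUP_cong[OF refl]) (rule F[rule_format, THEN conjunct2])
    also have "\<dots> = {L \<in> proj_space scale W. \<exists>p\<in>\<Union>(F ` \<K>). \<exists>w\<in>L. p w \<noteq> 0}" by blast
    finally have "\<Union>\<K> = \<dots>" by (simp only: image_ident)
    moreover have "\<forall>p\<in>\<Union>(F ` \<K>). \<exists>d. homogeneous scale d p" using F by blast
    ultimately show "?op (\<Union>\<K>)" by (intro exI[of _ "\<Union>(F ` \<K>)"] conjI)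
  qed
  then show ?thesis by (simp add: proj_zariski_def)
qed


section \<open>Dimension and secant varieties\<close>

definition irreducible_in :: "'p topology \<Rightarrow> 'p set \<Rightarrow> bool"
  where "irreducible_in X C \<longleftrightarrow> C \<noteq> {} \<and> C \<subseteq> topspace X \<and>
    (\<forall>A B. closedin X A \<longrightarrow> closedin X B \<longrightarrow> C \<subseteq> A \<union> B \<longrightarrow> C \<subseteq> A \<or> C \<subseteq> B)"

definition krull_dim :: "'p topology \<Rightarrow> enat"
  where "krull_dim X = Sup {enat m | m. \<exists>C :: nat \<Rightarrow> 'p set.
    (\<forall>i\<le>m. closedin X (C i) \<and> irreducible_in X (C i)) \<and> (\<forall>i<m. C i \<subset> C (Suc i))}"

definition variety_dim ::
  "('a::field \<Rightarrow> 'w::ab_group_add \<Rightarrow> 'w) \<Rightarrow> 'w set \<Rightarrow> 'w set set \<Rightarrow> enat"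
  where "variety_dim scale W X = krull_dim (subtopology (proj_zariski scale W) X)"

text \<open>
  The points of \<open>\<P>(W)\<close> in the projective linear space spanned by a set \<open>P\<close> of points
  are the lines contained in the linear span of \<open>\<Union>P\<close>.
\<close>

definition secant_variety ::
  "('a::field \<Rightarrow> 'w::ab_group_add \<Rightarrow> 'w) \<Rightarrow> 'w set \<Rightarrow> 'w set set \<Rightarrow> nat \<Rightarrow> 'w set set"
  where "secant_variety scale W X s = proj_zariski scale W closure_of
    (\<Union>P\<in>{P. P \<subseteq> X \<and> finite P \<and> card P = s}.
        {L \<in> proj_space scale W. L \<subseteq> module.span scale (\<Union>P)})"

text \<open>
  With \<open>N = dim W - 1\<close> the dimension of the ambient projective space, the expected
  dimension of the \<open>s\<close>-th secant variety is the minimum of \<open>N\<close> and the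
  parameter count \<open>s dim X + s - 1\<close>.
\<close>

definition ambient_dim :: "('a::field \<Rightarrow> 'w::ab_group_add \<Rightarrow> 'w) \<Rightarrow> 'w set \<Rightarrow> enat"
  where "ambient_dim scale W = enat (vector_space.dim scale W - 1)"

definition parameter_count ::
  "('a::field \<Rightarrow> 'w::ab_group_add \<Rightarrow> 'w) \<Rightarrow> 'w set \<Rightarrow> 'w set set \<Rightarrow> nat \<Rightarrow> enat"
  where "parameter_count scale W X s = enat s * variety_dim scale W X + enat (s - 1)"

definition expected_secant_dim ::
  "('a::field \<Rightarrow> 'w::ab_group_add \<Rightarrow> 'w) \<Rightarrow> 'w set \<Rightarrow> 'w set set \<Rightarrow> nat \<Rightarrow> enat"
  where "expected_secant_dim scale W X s =
    min (ambient_dim scale W) (parameter_count scale W X s)"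

definition secant_dim ::
  "('a::field \<Rightarrow> 'w::ab_group_add \<Rightarrow> 'w) \<Rightarrow> 'w set \<Rightarrow> 'w set set \<Rightarrow> nat \<Rightarrow> enat"
  where "secant_dim scale W X s = variety_dim scale W (secant_variety scale W X s)"

definition defective ::
  "('a::field \<Rightarrow> 'w::ab_group_add \<Rightarrow> 'w) \<Rightarrow> 'w set \<Rightarrow> 'w set set \<Rightarrow> nat \<Rightarrow> bool"
  where "defective scale W X s \<longleftrightarrow> secant_dim scale W X s < expected_secant_dim scale W X s"

definition defectiveness ::
  "('a::field \<Rightarrow> 'w::ab_group_add \<Rightarrow> 'w) \<Rightarrow> 'w set \<Rightarrow> 'w set set \<Rightarrow> nat \<Rightarrow> enat"
  where "defectiveness scale W X s = expected_secant_dim scale W X s - secant_dim scale W X s"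


section \<open>Grassmannians and typical rank\<close>

definition grassmannian :: "('a::field \<Rightarrow> 'v::ab_group_add \<Rightarrow> 'v) \<Rightarrow> nat \<Rightarrow> 'v set set"
  where "grassmannian scale k =
    {U. module.subspace scale U \<and> vector_space.dim scale U = k}"

text \<open>
  All vectors \<open>v\<^sub>1 \<and> \<dots> \<and> v\<^sub>k\<close> with \<open>\<langle>v\<^sub>1, \<dots>, v\<^sub>k\<rangle> = U\<close> are nonzero multiples of each other
  when \<open>dim U = k\<close>, so the span below is the point \<open>[v\<^sub>1 \<and> \<dots> \<and> v\<^sub>k]\<close>.
\<close>

definition plucker ::
  "('a::field \<Rightarrow> 'v::ab_group_add \<Rightarrow> 'v) \<Rightarrow> nat \<Rightarrow> 'v set \<Rightarrow> (('v list \<Rightarrow> 'a) \<Rightarrow> 'a) set"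
  where "plucker scale k U =
    module.span fscale {wedge scale k vs | vs. length vs = k \<and> module.span scale (set vs) = U}"

definition wedge_rank ::
  "('a::field \<Rightarrow> 'v::ab_group_add \<Rightarrow> 'v) \<Rightarrow> nat \<Rightarrow> (('v list \<Rightarrow> 'a) \<Rightarrow> 'a) \<Rightarrow> nat"
  where "wedge_rank scale k T = (LEAST r. \<exists>vss. length vss = r \<and>
    (\<forall>vs\<in>set vss. length vs = k) \<and> T = sum_list (map (wedge scale k) vss))"

definition typical_rank :: "('a::field \<Rightarrow> 'v::ab_group_add \<Rightarrow> 'v) \<Rightarrow> nat \<Rightarrow> nat"
  where "typical_rank scale k = (LEAST r. \<exists>D \<subseteq> exterior_power scale k.
    affine_zariski fscale (exterior_power scale k) closure_of D = exterior_power scale k \<and>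
    (\<forall>T\<in>D. wedge_rank scale k T \<le> r))"

end

theory Submission
  imports Defs "HOL-Combinatorics.Permutations"
begin

text \<open>
  The dimension of a projective set is read off from the growth in \<open>d\<close> of the number of linearly
  independent forms of degree \<open>d\<close> on it.  Let \<open>C\<^sub>0 \<subset> \<dots> \<subset> C\<^sub>m\<close> be irreducible closed sets, and let
  \<open>f\<close> be a form that vanishes on \<open>C\<^sub>i\<close> but not on \<open>C\<^sub>i\<^sub>+\<^sub>1\<close>.  Independent forms on \<open>C\<^sub>i\<close> together with
  the multiples by \<open>f\<close> of independent forms on \<open>C\<^sub>i\<^sub>+\<^sub>1\<close> are again independent on \<open>C\<^sub>i\<^sub>+\<^sub>1\<close>, so each
  step of the chain raises the order of growth by one (\<open>chain_hom_indep\<close>).  If, on the other hand,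
  a polynomial map of \<open>r\<close> parameters is dense in the set, in the sense that a form vanishing on
  the image vanishes on the set, then pulling forms back to the parameter space bounds the growth
  by a multiple of \<open>d\<^sup>r\<close> (\<open>hom_indep_bound\<close>).  Hence the Krull dimension is at most \<open>r\<close>.  Conversely, if some
  linear functionals agree with the parameters to first order at the origin, their monomials are
  independent on the image, by comparison of terms of lowest order.  Applied to the coordinate
  subspaces of the parameter space this shows that the closures of the images of a full flag of
  such subspaces are pairwise different, and they form a chain of length \<open>r\<close>
  (\<open>krull_dim_ge_parameters\<close>).

  So it suffices to find, for the set of sums of \<open>s\<close> decomposable vectors, a dense polynomial map
  whose parameters are visible to first order.  Its number of parameters is the dimension of the
  secant variety; the case \<open>s = 1\<close> gives the Grassmannian itself.  Put \<open>m = n + 1\<close>.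

  When \<open>k s \<le> m\<close>, take \<open>s\<close> disjoint blocks of \<open>k\<close> basis vectors, and let the span of each block
  vary in its affine chart of the Grassmannian.  To first order the \<open>b\<close>-th summand moves in the
  directions of the basis vectors \<open>e\<^sub>J\<close> where \<open>J\<close> arises from the block by exchanging one index.  Such
  a \<open>J\<close> has at least \<open>k - 1\<close> indices in the block, so for \<open>k \<ge> 3\<close> different blocks have no direction
  in common (\<open>coord_update_update\<close>).  All \<open>s k (m - k)\<close> directions, and the \<open>s - 1\<close> relative weights
  of the summands, are therefore independent, which is the expected dimension.

  For \<open>k = 2\<close> the direction \<open>e\<^sub>i \<and> e\<^sub>j\<close> with \<open>i\<close> and \<open>j\<close> in different blocks belongs to both of them, and
  this overlap is the defect.  A sum of \<open>s\<close> decomposable bivectors is a bivector on a subspace of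
  dimension \<open>2 s\<close>, and conversely every such bivector is a sum of \<open>s\<close> decomposable ones
  (\<open>bivectors_wedge_sums\<close>).  The position of the subspace and the bivector on it, up to scaling,
  make \<open>2 s (m - 2 s) + s (2 s - 1) - 1\<close> parameters, which is \<open>2 s (s - 1)\<close> less than the parameter
  count.  Since all bivectors are sums of \<open>m div 2\<close> decomposable ones while fewer summands leave the
  dimension smaller, the typical rank is \<open>m div 2\<close>.
\<close>

section \<open>Polynomial functions on a coordinate space\<close>

interpretation fun_space: vector_space "fscale :: 'a::field \<Rightarrow> ('c \<Rightarrow> 'a) \<Rightarrow> 'c \<Rightarrow> 'a"
  by (rule vector_space_fscale)

lemma sum_fun_apply: "(\<Sum>i\<in>S. f i) x = (\<Sum>i\<in>S. f i x)"
  by (induction S rule: infinite_finite_induct) auto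

inductive poly_upto :: "'i set \<Rightarrow> nat \<Rightarrow> (('i \<Rightarrow> 'a::field) \<Rightarrow> 'a) \<Rightarrow> bool"
  for I where
  const: "poly_upto I d (\<lambda>_. c)"
| var: "i \<in> I \<Longrightarrow> poly_upto I (Suc d) (\<lambda>t. t i)"
| add: "poly_upto I d p \<Longrightarrow> poly_upto I d q \<Longrightarrow> poly_upto I d (\<lambda>t. p t + q t)"
| mult: "poly_upto I d p \<Longrightarrow> poly_upto I e q \<Longrightarrow> poly_upto I (d + e) (\<lambda>t. p t * q t)"

lemma poly_upto_sum:
  assumes "\<And>j. j \<in> J \<Longrightarrow> poly_upto I d (p j)"
  shows "poly_upto I d (\<lambda>t. \<Sum>j\<in>J. p j t)"
  using assms by (induction J rule: infinite_finite_induct)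
    (auto intro: poly_upto.const poly_upto.add)

lemma poly_upto_prod:
  assumes "\<And>j. j \<in> J \<Longrightarrow> \<exists>d. poly_upto I d (p j)"
  shows "\<exists>d. poly_upto I d (\<lambda>t. \<Prod>j\<in>J. p j t)"
  using assms
proof (induction J rule: infinite_finite_induct)
  case (insert j J)
  then obtain d e where "poly_upto I d (p j)" "poly_upto I e (\<lambda>t. \<Prod>j\<in>J. p j t)" by blast
  then have "poly_upto I (d + e) (\<lambda>t. p j t * (\<Prod>j\<in>J. p j t))" by (rule poly_upto.mult)
  then show ?case using insert.hyps by auto
qed (auto intro: poly_upto.const)

lemma poly_upto_restrict:
  assumes "poly_upto I d p" "J \<subseteq> I"
  shows "poly_upto J d (\<lambda>t. p (\<lambda>i. if i \<in> J then t i else 0))"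
  using assms(1)
proof induction
  case (var i d)
  then show ?case by (cases "i \<in> J") (auto intro: poly_upto.intros)
qed (auto intro: poly_upto.intros)

lemma poly_upto_line:
  assumes "poly_upto I d p"
  shows "\<exists>q. \<forall>x. p (\<lambda>i. a i + x * b i) = poly q x"
  using assms
proof induction
  case (const d c)
  show ?case by (rule exI[of _ "[:c:]"]) simp
next
  case (var i d)
  show ?case by (rule exI[of _ "[:a i, b i:]"]) simp
next
  case (add d p q)
  then obtain P Q where "\<forall>x. p (\<lambda>i. a i + x * b i) = poly P x" "\<forall>x. q (\<lambda>i. a i + x * b i) = poly Q x"
    by blast
  then show ?case by (intro exI[of _ "P + Q"]) simp
next
  case (mult d p e q)
  then obtain P Q where "\<forall>x. p (\<lambda>i. a i + x * b i) = poly P x" "\<forall>x. q (\<lambda>i. a i + x * b i) = poly Q x"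
    by blast
  then show ?case by (intro exI[of _ "P * Q"]) simp
qed

text \<open>
  On the line through a point with \<open>p \<noteq> 0\<close> and a point with \<open>q \<noteq> 0\<close> both functions are nonzero
  polynomials in one variable.
\<close>

lemma poly_upto_mult_eq_0:
  fixes p q :: "('i \<Rightarrow> 'a::field_char_0) \<Rightarrow> 'a"
  assumes "poly_upto I d p" "poly_upto I e q" and 0: "\<And>t. p t * q t = 0"
  shows "(\<forall>t. p t = 0) \<or> (\<forall>t. q t = 0)"
proof (rule ccontr)
  assume "\<not> ?thesis"
  then obtain a b where ab: "p a \<noteq> 0" "q b \<noteq> 0" by blast
  obtain P Q where P: "\<And>x. p (\<lambda>i. a i + x * (b i - a i)) = poly P x"
    and Q: "\<And>x. q (\<lambda>i. a i + x * (b i - a i)) = poly Q x"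
    using poly_upto_line[OF assms(1), of a "\<lambda>i. b i - a i"]
      poly_upto_line[OF assms(2), of a "\<lambda>i. b i - a i"] by blast
  have "poly (P * Q) x = 0" for x using 0 P Q by (metis poly_mult)
  then have "P * Q = 0" using poly_all_0_iff_0 by blast
  moreover have "P \<noteq> 0" using P[of 0] ab(1) by auto
  moreover have "Q \<noteq> 0" using Q[of 1] ab(2) by auto
  ultimately show False by simp
qed

text \<open>
  Exponents are bounded separately in each variable: the count of monomials is then a pure power,
  and the bound for total degree \<open>d\<close> loses only a constant factor.
\<close>

definition monomials :: "'i set \<Rightarrow> nat \<Rightarrow> (('i \<Rightarrow> 'a::field) \<Rightarrow> 'a) set"
  where "monomials I d = (\<lambda>\<alpha> t. \<Prod>i\<in>I. t i ^ \<alpha> i) ` (PiE I (\<lambda>_. {..d}))"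

lemma finite_monomials: "finite I \<Longrightarrow> finite (monomials I d)"
  by (simp add: monomials_def finite_PiE)

lemma card_monomials_le: "finite I \<Longrightarrow> card (monomials I d) \<le> (d + 1) ^ card I"
  unfolding monomials_def
  by (rule order_trans[OF card_image_le]) (simp_all add: finite_PiE card_PiE)

lemma monomials_span_mult:
  assumes "finite I" "f \<in> fun_space.span (monomials I d)" "g \<in> fun_space.span (monomials I e)"
  shows "(\<lambda>t. f t * g t) \<in> fun_space.span (monomials I (d + e))"
  using assms(2)
proof (induction rule: fun_space.span_induct_alt)
  case base
  have "(\<lambda>t. 0 t * g t) = 0" by auto
  then show ?case by (simp only: fun_space.span_zero)
next
  case (step c x y)
  have "(\<lambda>t. x t * g t) \<in> fun_space.span (monomials I (d + e))"
    using assms(3)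
  proof (induction rule: fun_space.span_induct_alt)
    case base
    have "(\<lambda>t. x t * 0 t) = 0" by auto
    then show ?case by (simp only: fun_space.span_zero)
  next
    case (step c' x' y')
    obtain \<alpha> where \<alpha>: "\<alpha> \<in> PiE I (\<lambda>_. {..d})" "x = (\<lambda>t. \<Prod>i\<in>I. t i ^ \<alpha> i)"
      using \<open>x \<in> monomials I d\<close> unfolding monomials_def by blast
    obtain \<beta> where \<beta>: "\<beta> \<in> PiE I (\<lambda>_. {..e})" "x' = (\<lambda>t. \<Prod>i\<in>I. t i ^ \<beta> i)"
      using step(1) unfolding monomials_def by blast
    have "(\<lambda>t. x t * x' t) = (\<lambda>t. \<Prod>i\<in>I. t i ^ (restrict (\<lambda>i. \<alpha> i + \<beta> i) I) i)"
      unfolding \<alpha> \<beta> by (rule ext) (simp add: prod.distrib power_add)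
    moreover have "restrict (\<lambda>i. \<alpha> i + \<beta> i) I \<in> PiE I (\<lambda>_. {..d+e})"
      using \<alpha>(1) \<beta>(1) by (fastforce simp: PiE_iff intro: add_mono)
    ultimately have "(\<lambda>t. x t * x' t) \<in> monomials I (d + e)"
      unfolding monomials_def by blast
    then have "(\<lambda>t. x t * x' t) \<in> fun_space.span (monomials I (d + e))"
      by (rule fun_space.span_base)
    then have "fscale c' (\<lambda>t. x t * x' t) + (\<lambda>t. x t * y' t) \<in> fun_space.span (monomials I (d + e))"
      by (intro fun_space.span_add fun_space.span_scale step(2))
    moreover have "fscale c' (\<lambda>t. x t * x' t) + (\<lambda>t. x t * y' t) = (\<lambda>t. x t * (fscale c' x' + y') t)"
      by (auto simp: fscale_def algebra_simps)
    ultimately show ?case by simp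
  qed
  then have "fscale c (\<lambda>t. x t * g t) + (\<lambda>t. y t * g t) \<in> fun_space.span (monomials I (d + e))"
    by (intro fun_space.span_add fun_space.span_scale step(2))
  moreover have "fscale c (\<lambda>t. x t * g t) + (\<lambda>t. y t * g t) = (\<lambda>t. (fscale c x + y) t * g t)"
    by (auto simp: fscale_def algebra_simps)
  ultimately show ?case by simp
qed

lemma poly_upto_span:
  fixes p :: "('i \<Rightarrow> 'a::field) \<Rightarrow> 'a"
  assumes "poly_upto I d p" "finite I"
  shows "p \<in> fun_space.span (monomials I d)"
  using assms(1)
proof induction
  case (const d c)
  have "(\<lambda>t. \<Prod>i\<in>I. t i ^ restrict (\<lambda>_. 0) I i) \<in> monomials I d"
    unfolding monomials_def by (rule imageI) auto
  then have "fscale c (\<lambda>t. \<Prod>i\<in>I. t i ^ restrict (\<lambda>_. 0) I i) \<in> fun_space.span (monomials I d)"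
    by (intro fun_space.span_scale fun_space.span_base)
  moreover have "fscale c (\<lambda>t. \<Prod>i\<in>I. t i ^ restrict (\<lambda>_. 0) I i) = (\<lambda>_. c)"
    by (simp add: fscale_def)
  ultimately show ?case by simp
next
  case (var i d)
  define \<alpha> where "\<alpha> = restrict (\<lambda>j. if j = i then 1 else 0::nat) I"
  have "(\<lambda>t. \<Prod>j\<in>I. t j ^ \<alpha> j) = (\<lambda>t :: 'i \<Rightarrow> 'a. t i)"
  proof
    fix t :: "'i \<Rightarrow> 'a"
    have "(\<Prod>j\<in>I. t j ^ \<alpha> j) = (\<Prod>j\<in>I. if j = i then t j else 1)"
      by (rule prod.cong) (auto simp: \<alpha>_def)
    then show "(\<Prod>j\<in>I. t j ^ \<alpha> j) = t i" using var assms(2) by simp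
  qed
  moreover have "(\<lambda>t :: 'i \<Rightarrow> 'a. \<Prod>j\<in>I. t j ^ \<alpha> j) \<in> monomials I (Suc d)"
    unfolding monomials_def by (rule imageI) (auto simp: \<alpha>_def)
  ultimately have "(\<lambda>t :: 'i \<Rightarrow> 'a. t i) \<in> monomials I (Suc d)" by (simp only:)
  then show ?case by (rule fun_space.span_base)
next
  case (add d p q)
  then have "p + q \<in> fun_space.span (monomials I d)" by (intro fun_space.span_add)
  then show ?case by (simp add: plus_fun_def)
next
  case (mult d p e q)
  then show ?case using monomials_span_mult[OF assms(2)] by blast
qed

text \<open>
  Induction on the set of variables: for fixed values of the others, a vanishing combination is a
  polynomial in the new variable that is zero everywhere, so its coefficients are zero.
\<close>

lemma monomials_independent:
  fixes c :: "('i \<Rightarrow> nat) \<Rightarrow> 'a::field_char_0"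
  assumes "finite I"
    and "\<And>t. (\<Sum>\<alpha>\<in>PiE I (\<lambda>_. {..d}). c \<alpha> * (\<Prod>i\<in>I. t i ^ \<alpha> i)) = 0"
    and "\<alpha> \<in> PiE I (\<lambda>_. {..d})"
  shows "c \<alpha> = 0"
  using assms
proof (induction I arbitrary: c \<alpha>)
  case empty
  then show ?case by simp
next
  case (insert i I)
  let ?E = "PiE I (\<lambda>_. {..d})"
  have inj: "inj_on (\<lambda>(y, g). g(i := y)) ({..d} \<times> ?E)"
    using insert(2) by (rule inj_combinator)
  have E: "PiE (insert i I) (\<lambda>_. {..d}) = (\<lambda>(y, g). g(i := y)) ` ({..d} \<times> ?E)"
    by (rule PiE_insert_eq)
  have key: "(\<Sum>g\<in>?E. c (g(i := y)) * (\<Prod>j\<in>I. t j ^ g j)) = 0" if y: "y \<le> d" for y t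
  proof -
    let ?a = "\<lambda>y. \<Sum>g\<in>?E. c (g(i := y)) * (\<Prod>j\<in>I. t j ^ g j)"
    have "poly (\<Sum>y\<le>d. monom (?a y) y) x = 0" for x
    proof -
      have "0 = (\<Sum>\<alpha>\<in>PiE (insert i I) (\<lambda>_. {..d}). c \<alpha> * (\<Prod>j\<in>insert i I. (t(i := x)) j ^ \<alpha> j))"
        by (rule insert(4)[symmetric])
      also have "\<dots> = (\<Sum>(y, g)\<in>{..d} \<times> ?E. c (g(i := y)) * (\<Prod>j\<in>insert i I. (t(i := x)) j ^ (g(i := y)) j))"
        unfolding E by (subst sum.reindex[OF inj]) (simp add: case_prod_beta o_def)
      also have "\<dots> = (\<Sum>(y, g)\<in>{..d} \<times> ?E. x ^ y * (c (g(i := y)) * (\<Prod>j\<in>I. t j ^ g j)))"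
      proof (rule sum.cong[OF refl], clarify)
        fix y g
        have "(\<Prod>j\<in>I. (t(i := x)) j ^ (g(i := y)) j) = (\<Prod>j\<in>I. t j ^ g j)"
          using insert(2) by (intro prod.cong) auto
        then show "c (g(i := y)) * (\<Prod>j\<in>insert i I. (t(i := x)) j ^ (g(i := y)) j)
            = x ^ y * (c (g(i := y)) * (\<Prod>j\<in>I. t j ^ g j))"
          using insert(1,2) by simp
      qed
      also have "\<dots> = (\<Sum>y\<le>d. ?a y * x ^ y)"
        by (simp add: sum.cartesian_product[symmetric] sum_distrib_left sum_distrib_right mult_ac)
      finally show ?thesis by (simp add: poly_sum poly_monom)
    qed
    then have "(\<Sum>y\<le>d. monom (?a y) y) = 0" using poly_all_0_iff_0 by blast
    then have "coeff (\<Sum>y\<le>d. monom (?a y) y) y = 0" by simp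
    then show ?thesis using y by (simp add: coeff_sum)
  qed
  obtain y g where yg: "\<alpha> = g(i := y)" "y \<le> d" "g \<in> ?E" using insert(5) unfolding E by auto
  show ?case unfolding yg(1) by (rule insert(3)[OF key[OF yg(2)] yg(3)])
qed

section \<open>Homogeneous polynomials and their pullbacks\<close>

text \<open>
  Homogeneity in the sense of \<open>homogeneous\<close> is a property of the function only; an expression for it
  may contain terms of other degrees that cancel.  Here every subexpression has the right degree, so
  that the degree of a pullback can be bounded.
\<close>

inductive hom_form :: "nat \<Rightarrow> (('c \<Rightarrow> 'a::field) \<Rightarrow> 'a) \<Rightarrow> bool" where
  zero: "hom_form d (\<lambda>_. 0)"
| const: "hom_form 0 (\<lambda>_. c)"
| linear: "Vector_Spaces.linear fscale (*) l \<Longrightarrow> hom_form 1 l"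
| add: "hom_form d p \<Longrightarrow> hom_form d q \<Longrightarrow> hom_form d (\<lambda>w. p w + q w)"
| mult: "hom_form d p \<Longrightarrow> hom_form e q \<Longrightarrow> hom_form (d + e) (\<lambda>w. p w * q w)"

lemma functional_scale:
  "Vector_Spaces.linear fscale (*) l \<Longrightarrow> l (fscale c w) = c * l w"
  by (simp add: Vector_Spaces.linear_iff)

lemma functional_add:
  "Vector_Spaces.linear fscale (*) l \<Longrightarrow> l (v + w) = l v + l w"
  by (simp add: Vector_Spaces.linear_iff)

lemma functional_0:
  fixes l :: "('c \<Rightarrow> 'a::field) \<Rightarrow> 'a"
  assumes "Vector_Spaces.linear fscale (*) l" shows "l 0 = 0"
  using functional_scale[OF assms, of 0 0] by (simp add: fscale_def zero_fun_def)

lemma functional_sum: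
  fixes l :: "('c \<Rightarrow> 'a::field) \<Rightarrow> 'a"
  assumes "Vector_Spaces.linear fscale (*) l" shows "l (\<Sum>i\<in>A. f i) = (\<Sum>i\<in>A. l (f i))"
  by (induction A rule: infinite_finite_induct)
    (simp_all add: functional_0[OF assms] functional_add[OF assms] del: zero_fun_apply plus_fun_apply)

lemma linear_functional_cmult:
  assumes "Vector_Spaces.linear fscale (*) l"
  shows "Vector_Spaces.linear fscale (*) (\<lambda>T. c * l T)"
  unfolding Vector_Spaces.linear_iff
proof (intro conjI allI vector_space_fscale vector_space_mult)
  show "c * l (x + y) = c * l x + c * l y" for x y
    by (simp only: functional_add[OF assms] distrib_left)
  show "c * l (fscale r x) = r * (c * l x)" for r x
    by (simp only: functional_scale[OF assms] mult.left_commute)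
qed

lemma linear_functional_diff:
  assumes "Vector_Spaces.linear fscale (*) l" "Vector_Spaces.linear fscale (*) l'"
  shows "Vector_Spaces.linear fscale (*) (\<lambda>T. l T - l' T)"
  unfolding Vector_Spaces.linear_iff
  by (auto simp: vector_space_fscale vector_space_mult functional_add[OF assms(1)]
      functional_add[OF assms(2)] functional_scale[OF assms(1)] functional_scale[OF assms(2)]
      algebra_simps simp del: plus_fun_apply)

lemma linear_evaluation: "Vector_Spaces.linear fscale (*) (\<lambda>w :: 'c \<Rightarrow> 'a::field. w x)"
  unfolding Vector_Spaces.linear_iff
  using vector_space_fscale vector_space_mult by (auto simp: fscale_def)

lemma hom_form_sum:
  "(\<And>i. i \<in> A \<Longrightarrow> hom_form d (p i)) \<Longrightarrow> hom_form d (\<lambda>w. \<Sum>i\<in>A. p i w)"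
  by (induction A rule: infinite_finite_induct) (auto intro: hom_form.zero hom_form.add)

text \<open>
  The coefficients in \<open>x\<close> of the value at \<open>x \<cdot> w\<close> are the homogeneous parts of \<open>p\<close>.
\<close>

lemma poly_fun_graded:
  assumes "poly_fun fscale (p :: ('c \<Rightarrow> 'a::field) \<Rightarrow> 'a)"
  shows "\<exists>Q. (\<forall>w x. p (fscale x w) = poly (Q w) x) \<and> (\<forall>e. hom_form e (\<lambda>w. coeff (Q w) e))"
  using assms
proof induction
  case (const c)
  have "hom_form e (\<lambda>w. coeff [:c:] e)" for e
    by (cases e) (auto intro: hom_form.intros)
  then show ?case by (intro exI[of _ "\<lambda>_. [:c:]"]) auto
next
  case (linear l)
  have "hom_form e (\<lambda>w. coeff [:0, l w:] e)" for e
  proof -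
    consider "e = 0" | "e = Suc 0" | k where "e = Suc (Suc k)" by (metis not0_implies_Suc)
    then show ?thesis using hom_form.linear[OF linear] by cases (auto intro: hom_form.zero)
  qed
  then show ?case
    by (intro exI[of _ "\<lambda>w. [:0, l w:]"]) (auto simp: functional_scale[OF linear])
next
  case (add p q)
  then obtain P Q where "\<forall>w x. p (fscale x w) = poly (P w) x" "\<forall>e. hom_form e (\<lambda>w. coeff (P w) e)"
    "\<forall>w x. q (fscale x w) = poly (Q w) x" "\<forall>e. hom_form e (\<lambda>w. coeff (Q w) e)" by metis
  then show ?case by (intro exI[of _ "\<lambda>w. P w + Q w"]) (auto intro: hom_form.add)
next
  case (mult p q)
  then obtain P Q where PQ: "\<forall>w x. p (fscale x w) = poly (P w) x" "\<forall>e. hom_form e (\<lambda>w. coeff (P w) e)"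
    "\<forall>w x. q (fscale x w) = poly (Q w) x" "\<forall>e. hom_form e (\<lambda>w. coeff (Q w) e)" by metis
  have "hom_form e (\<lambda>w. coeff (P w) i * coeff (Q w) (e - i))" if "i \<le> e" for e i
    using hom_form.mult[of i "\<lambda>w. coeff (P w) i" "e - i" "\<lambda>w. coeff (Q w) (e - i)"] PQ(2,4) that
    by simp
  then have "hom_form e (\<lambda>w. coeff (P w * Q w) e)" for e
    unfolding coeff_mult by (intro hom_form_sum) auto
  then show ?case using PQ by (intro exI[of _ "\<lambda>w. P w * Q w"]) auto
qed

lemma homogeneous_hom_form:
  fixes p :: "('c \<Rightarrow> 'a::field_char_0) \<Rightarrow> 'a"
  assumes "homogeneous fscale d p" shows "hom_form d p"
proof -
  obtain Q where Q: "\<And>w x. p (fscale x w) = poly (Q w) x" "\<And>e. hom_form e (\<lambda>w. coeff (Q w) e)"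
    using poly_fun_graded assms unfolding homogeneous_def by metis
  have "coeff (Q w) d = p w" for w
  proof -
    have "poly (Q w) x = poly (monom (p w) d) x" for x
      using assms unfolding homogeneous_def poly_monom Q(1)[symmetric] by (simp add: mult.commute)
    then have "Q w = monom (p w) d" by (metis ext poly_eq_poly_eq_iff)
    then show ?thesis by simp
  qed
  then show ?thesis using Q(2)[of d] by simp
qed

lemma homogeneous_0_at_0:
  assumes "homogeneous fscale d p" "p w = 0" shows "p (0 :: 'c \<Rightarrow> 'a::field) = 0"
proof -
  have "p (fscale 0 w) = 0 ^ d * p w" using assms(1) unfolding homogeneous_def by blast
  also have "fscale 0 w = 0" by (rule fun_space.scale_zero_left)
  finally show ?thesis by (simp only: assms(2) mult_zero_right)
qed

lemma homogeneous_mult: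
  "homogeneous fscale d p \<Longrightarrow> homogeneous fscale e q \<Longrightarrow> homogeneous fscale (d + e) (\<lambda>w. p w * q w)"
  by (auto simp: homogeneous_def power_add intro: poly_fun.mult)

lemma homogeneous_const: "homogeneous fscale 0 (\<lambda>_. c)"
  by (auto simp: homogeneous_def intro: poly_fun.const)

lemma homogeneous_linear: "Vector_Spaces.linear fscale (*) l \<Longrightarrow> homogeneous fscale 1 l"
  by (auto simp: homogeneous_def functional_scale intro: poly_fun.linear)

lemma homogeneous_cmult: "homogeneous fscale d p \<Longrightarrow> homogeneous fscale d (\<lambda>w. c * p w)"
  using homogeneous_mult[OF homogeneous_const] by fastforce

lemma homogeneous_sum:
  assumes "\<And>i. i \<in> A \<Longrightarrow> homogeneous fscale d (p i)"
  shows "homogeneous fscale d (\<lambda>w. \<Sum>i\<in>A. p i w)"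
proof -
  have "poly_fun fscale (\<lambda>w. \<Sum>i\<in>A. p i w)"
    using assms by (induction A rule: infinite_finite_induct)
      (auto simp: homogeneous_def intro: poly_fun.intros)
  moreover have "(\<Sum>i\<in>A. p i (fscale c w)) = c ^ d * (\<Sum>i\<in>A. p i w)" for c w
    unfolding sum_distrib_left using assms by (intro sum.cong) (auto simp: homogeneous_def)
  ultimately show ?thesis by (simp add: homogeneous_def)
qed

lemma homogeneous_power:
  "Vector_Spaces.linear fscale (*) l \<Longrightarrow> homogeneous fscale n (\<lambda>w. l w ^ n)"
proof (induction n)
  case (Suc n)
  then show ?case using homogeneous_mult[OF homogeneous_linear[OF Suc.prems] Suc.IH] by simp
qed (simp add: homogeneous_const)

lemma homogeneous_prod_power:
  assumes "\<And>i. i \<in> A \<Longrightarrow> Vector_Spaces.linear fscale (*) (l i)"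
  shows "homogeneous fscale (\<Sum>i\<in>A. n i) (\<lambda>w. \<Prod>i\<in>A. l i w ^ n i)"
  using assms
proof (induction A rule: infinite_finite_induct)
  case (insert i A)
  then show ?case
    using homogeneous_mult[OF homogeneous_power[of "l i" "n i"], of "\<Sum>i\<in>A. n i" "\<lambda>w. \<Prod>i\<in>A. l i w ^ n i"]
    by simp
qed (auto intro: homogeneous_const)

text \<open>
  The target is a space of functions on an infinite set, where coordinates are not at hand; being
  polynomial is tested on all linear functionals.
\<close>

definition polynomial_map ::
  "'i set \<Rightarrow> nat \<Rightarrow> (('i \<Rightarrow> 'a::field) \<Rightarrow> ('c \<Rightarrow> 'a)) \<Rightarrow> bool"
  where "polynomial_map I \<delta> \<phi> \<longleftrightarrow>
    (\<forall>l. Vector_Spaces.linear fscale (*) l \<longrightarrow> poly_upto I \<delta> (\<lambda>t. l (\<phi> t)))"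

lemma hom_form_pullback:
  assumes "hom_form d p" "polynomial_map I \<delta> \<phi>"
  shows "poly_upto I (\<delta> * d) (\<lambda>t. p (\<phi> t))"
  using assms(1)
proof induction
  case (linear l)
  then show ?case using assms(2) by (simp add: polynomial_map_def)
next
  case (mult d p e q)
  then show ?case using poly_upto.mult[OF mult.IH] by (simp only: distrib_left)
qed (auto intro: poly_upto.intros)

lemma homogeneous_pullback:
  fixes p :: "('c \<Rightarrow> 'a::field_char_0) \<Rightarrow> 'a"
  assumes "homogeneous fscale d p" "polynomial_map I \<delta> \<phi>"
  shows "poly_upto I (\<delta> * d) (\<lambda>t. p (\<phi> t))"
  using hom_form_pullback[OF homogeneous_hom_form] assms by blast

section \<open>Growth of the space of homogeneous polynomials\<close>

text \<open>
  For a cone \<open>S\<close> this says that the Hilbert function of the projective set given by \<open>S\<close> is at least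
  \<open>N\<close> in degree \<open>d\<close>.
\<close>

definition hom_indep :: "('c \<Rightarrow> 'a::field) set \<Rightarrow> nat \<Rightarrow> nat \<Rightarrow> bool"
  where "hom_indep S d N \<longleftrightarrow> (\<exists>g. (\<forall>j<N. homogeneous fscale d (g j)) \<and>
    (\<forall>c. (\<forall>w\<in>S. (\<Sum>j<N. c j * g j w) = 0) \<longrightarrow> (\<forall>j<N. c j = 0)))"

lemma hom_indep_mono:
  assumes "hom_indep S d N" "S \<subseteq> T" shows "hom_indep T d N"
proof -
  obtain g where "\<forall>j<N. homogeneous fscale d (g j)"
    "\<forall>c. (\<forall>w\<in>S. (\<Sum>j<N. c j * g j w) = 0) \<longrightarrow> (\<forall>j<N. c j = 0)"
    using assms(1) unfolding hom_indep_def by blast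
  then show ?thesis using assms(2) unfolding hom_indep_def by (intro exI[of _ g]) blast
qed

text \<open>
  For cones this means that the projective set of \<open>T\<close> lies in the Zariski closure of the one of \<open>S\<close>.
\<close>

definition dominates :: "('c \<Rightarrow> 'a::field) set \<Rightarrow> ('c \<Rightarrow> 'a) set \<Rightarrow> bool"
  where "dominates S T \<longleftrightarrow>
    (\<forall>d p. homogeneous fscale d p \<longrightarrow> (\<forall>w\<in>S. p w = 0) \<longrightarrow> (\<forall>w\<in>T. p w = 0))"

lemma (in vector_space) independent_family_bound:
  assumes "finite B" "\<And>j. j < N \<Longrightarrow> v j \<in> span B"
    and ind: "\<And>c. (\<Sum>j<N. scale (c j) (v j)) = 0 \<Longrightarrow> \<forall>j<N. c j = 0"
  shows "N \<le> card B"
proof -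
  have inj: "inj_on v {..<N}"
  proof (rule inj_onI, rule ccontr)
    fix i j assume ij: "i \<in> {..<N}" "j \<in> {..<N}" "v i = v j" "i \<noteq> j"
    define c :: "nat \<Rightarrow> 'a" where "c = (\<lambda>k. (if k = i then 1 else 0) - (if k = j then 1 else 0))"
    have "(\<Sum>k<N. scale (c k) (v k))
        = (\<Sum>k<N. if k = i then v k else 0) - (\<Sum>k<N. if k = j then v k else 0)"
      unfolding sum_subtractf[symmetric]
      by (rule sum.cong) (auto simp: c_def scale_left_diff_distrib)
    also have "\<dots> = 0" using ij by simp
    finally have "c i = 0" using ind[of c] ij by auto
    then show False using ij(4) by (simp add: c_def)
  qed
  have "independent (v ` {..<N})"
  proof
    assume "dependent (v ` {..<N})"
    then obtain u where u: "\<exists>x\<in>v ` {..<N}. u x \<noteq> 0" "(\<Sum>x\<in>v ` {..<N}. scale (u x) x) = 0"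
      by (auto simp: dependent_finite)
    from u(2) have "(\<Sum>j<N. scale (u (v j)) (v j)) = 0" by (simp add: sum.reindex[OF inj])
    then show False using ind[of "\<lambda>j. u (v j)"] u(1) by auto
  qed
  then have "card (v ` {..<N}) \<le> card B"
    using independent_span_bound[OF assms(1)] assms(2) by blast
  then show ?thesis using card_image[OF inj] by simp
qed

text \<open>
  Independent forms on \<open>T\<close> have independent pullbacks along \<open>\<phi>\<close>, because a combination that vanishes
  on the image vanishes on \<open>T\<close>.  The pullbacks are polynomials of degree at most \<open>\<delta> d\<close> in the parameters.
\<close>

lemma hom_indep_bound:
  fixes \<phi> :: "('i \<Rightarrow> 'a::field_char_0) \<Rightarrow> ('c \<Rightarrow> 'a)"
  assumes "finite I" "polynomial_map I \<delta> \<phi>" "dominates (range \<phi>) T" "hom_indep T d N"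
  shows "N \<le> (\<delta> * d + 1) ^ card I"
proof -
  obtain g where g: "\<And>j. j < N \<Longrightarrow> homogeneous fscale d (g j)"
    "\<And>c. (\<forall>w\<in>T. (\<Sum>j<N. c j * g j w) = 0) \<Longrightarrow> (\<forall>j<N. c j = 0)"
    using assms(4) unfolding hom_indep_def by metis
  have "N \<le> card (monomials I (\<delta> * d) :: (('i \<Rightarrow> 'a) \<Rightarrow> 'a) set)"
  proof (rule fun_space.independent_family_bound)
    show "finite (monomials I (\<delta> * d) :: (('i \<Rightarrow> 'a) \<Rightarrow> 'a) set)" by (rule finite_monomials[OF assms(1)])
    show "(\<lambda>t. g j (\<phi> t)) \<in> fun_space.span (monomials I (\<delta> * d))" if "j < N" for j
      by (rule poly_upto_span[OF homogeneous_pullback[OF g(1)[OF that] assms(2)] assms(1)])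
  next
    fix c assume "(\<Sum>j<N. fscale (c j) (\<lambda>t. g j (\<phi> t))) = 0"
    then have 0: "(\<Sum>j<N. c j * g j (\<phi> t)) = 0" for t
      by (metis (mono_tags, lifting) fscale_def sum.cong sum_fun_apply zero_fun_apply)
    have "homogeneous fscale d (\<lambda>w. \<Sum>j<N. c j * g j w)"
      by (intro homogeneous_sum homogeneous_cmult g(1)) simp
    then have "\<forall>w\<in>T. (\<Sum>j<N. c j * g j w) = 0"
      using 0 assms(3) unfolding dominates_def by blast
    then show "\<forall>j<N. c j = 0" by (rule g(2))
  qed
  also have "\<dots> \<le> (\<delta> * d + 1) ^ card I" by (rule card_monomials_le[OF assms(1)])
  finally show ?thesis .
qed

lemma polynomial_growth_exponent:
  fixes a m M :: nat
  assumes "\<And>x. (x + 1) ^ m \<le> (a * x + 1) ^ M"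
  shows "m \<le> M"
proof (rule ccontr)
  assume "\<not> m \<le> M"
  define x where "x = (a + 1) ^ M"
  have "(x + 1) ^ Suc M \<le> (x + 1) ^ m" using \<open>\<not> m \<le> M\<close> by (intro power_increasing) auto
  also have "\<dots> \<le> (a * x + 1) ^ M" by (rule assms)
  also have "\<dots> \<le> ((a + 1) * (x + 1)) ^ M" by (intro power_mono) (auto simp: algebra_simps)
  also have "\<dots> = x * (x + 1) ^ M" by (simp only: power_mult_distrib x_def)
  also have "\<dots> < (x + 1) ^ Suc M" by simp
  finally show False by simp
qed

section \<open>Local parameters\<close>

text \<open>
  The first two Taylor coefficients at \<open>0\<close> of a polynomial function of one variable.
\<close>

definition jet :: "('a::field \<Rightarrow> 'a) \<Rightarrow> 'a \<Rightarrow> 'a \<Rightarrow> bool"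
  where "jet F a b \<longleftrightarrow> (\<exists>p. (\<forall>x. F x = poly p x) \<and> coeff p 0 = a \<and> coeff p 1 = b)"

lemma jet_const: "jet (\<lambda>_. c) c 0"
  unfolding jet_def by (rule exI[of _ "[:c:]"]) simp

lemma jet_affine: "jet (\<lambda>x. a + x * b) a b"
  unfolding jet_def by (rule exI[of _ "[:a, b:]"]) simp

lemma jet_add:
  assumes "jet F a b" "jet G c d" shows "jet (\<lambda>x. F x + G x) (a + c) (b + d)"
proof -
  obtain p q where "\<forall>x. F x = poly p x" "coeff p 0 = a" "coeff p 1 = b"
    "\<forall>x. G x = poly q x" "coeff q 0 = c" "coeff q 1 = d" using assms unfolding jet_def by metis
  then show ?thesis unfolding jet_def by (intro exI[of _ "p + q"]) auto
qed

lemma jet_mult: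
  assumes "jet F a b" "jet G c d" shows "jet (\<lambda>x. F x * G x) (a * c) (a * d + b * c)"
proof -
  obtain p q where "\<forall>x. F x = poly p x" "coeff p 0 = a" "coeff p 1 = b"
    "\<forall>x. G x = poly q x" "coeff q 0 = c" "coeff q 1 = d" using assms unfolding jet_def by metis
  then show ?thesis unfolding jet_def by (intro exI[of _ "p * q"]) (auto simp: coeff_mult)
qed

lemma jet_diff:
  assumes "jet F a b" "jet G c d" shows "jet (\<lambda>x. F x - G x) (a - c) (b - d)"
  using jet_add[OF assms(1) jet_mult[OF jet_const[of "-1"] assms(2)]] by simp

lemma jet_sum:
  assumes "\<And>i. i \<in> A \<Longrightarrow> jet (F i) (a i) (b i)"
  shows "jet (\<lambda>x. \<Sum>i\<in>A. F i x) (\<Sum>i\<in>A. a i) (\<Sum>i\<in>A. b i)"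
  using assms by (induction A rule: infinite_finite_induct) (auto intro: jet_add jet_const)

text \<open>
  Near the origin of the parameter space, where \<open>l0\<close> equals \<open>1\<close> up to second order, the affine
  coordinates \<open>l i / l0\<close> agree with the parameters to first order.  This replaces the statement that
  the derivative of the induced map to projective space is injective; it is tested on rays through
  the origin, so that only polynomials in one variable occur.
\<close>

definition local_parameters :: "'i set \<Rightarrow> (('i \<Rightarrow> 'a::field) \<Rightarrow> ('c \<Rightarrow> 'a)) \<Rightarrow> bool"
  where "local_parameters I \<phi> \<longleftrightarrow> (\<exists>l0 l.
    Vector_Spaces.linear fscale (*) l0 \<and> (\<forall>i\<in>I. Vector_Spaces.linear fscale (*) (l i)) \<and>
    (\<forall>t. jet (\<lambda>x. l0 (\<phi> (\<lambda>i. x * t i))) 1 0) \<and>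
    (\<forall>i\<in>I. \<forall>t. jet (\<lambda>x. l i (\<phi> (\<lambda>i. x * t i))) 0 (t i)))"

text \<open>
  The form \<open>l0\<^bsup>D - |\<alpha>|\<^esup> \<Prod> (l i)\<^bsup>\<alpha> i\<^esup>\<close> has the lowest-order term \<open>t\<^sup>\<alpha>\<close> at the origin.  If a combination of
  these forms vanishes, so does its part of lowest order, which is a combination of monomials.
\<close>

lemma local_parameters_hom_indep:
  fixes \<phi> :: "('i \<Rightarrow> 'a::field_char_0) \<Rightarrow> ('c \<Rightarrow> 'a)"
  assumes I: "finite I" and "local_parameters I \<phi>"
  shows "hom_indep (range \<phi>) (card I * K) ((K + 1) ^ card I)"
proof -
  obtain l0 l where l0: "Vector_Spaces.linear fscale (*) l0"
    and l: "\<And>i. i \<in> I \<Longrightarrow> Vector_Spaces.linear fscale (*) (l i)"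
    and j0: "\<And>t. jet (\<lambda>x. l0 (\<phi> (\<lambda>i. x * t i))) 1 0"
    and j: "\<And>i t. i \<in> I \<Longrightarrow> jet (\<lambda>x. l i (\<phi> (\<lambda>i. x * t i))) 0 (t i)"
    using assms(2) unfolding local_parameters_def by metis
  let ?A = "PiE I (\<lambda>_. {..K})"
  let ?d = "card I * K"
  define s where "s \<alpha> = (\<Sum>i\<in>I. \<alpha> i)" for \<alpha> :: "'i \<Rightarrow> nat"
  have s_le: "s \<alpha> \<le> ?d" if "\<alpha> \<in> ?A" for \<alpha>
  proof -
    have "s \<alpha> \<le> (\<Sum>i\<in>I. K)" unfolding s_def using that by (intro sum_mono) auto
    then show ?thesis by simp
  qed
  \<comment> \<open>The power of \<open>l0\<close> brings all monomials to the same degree.\<close>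
  define G where "G \<alpha> w = l0 w ^ (?d - s \<alpha>) * (\<Prod>i\<in>I. l i w ^ \<alpha> i)" for \<alpha> w
  have hom: "homogeneous fscale ?d (G \<alpha>)" if "\<alpha> \<in> ?A" for \<alpha>
  proof -
    have "homogeneous fscale (?d - s \<alpha> + s \<alpha>) (G \<alpha>)"
      unfolding G_def s_def
      by (intro homogeneous_mult homogeneous_power homogeneous_prod_power l0 l)
    then show ?thesis using s_le[OF that] by simp
  qed
  have finA: "finite ?A" by (intro finite_PiE I) auto
  have indep: "\<forall>\<alpha>\<in>?A. c \<alpha> = 0" if 0: "\<And>t. (\<Sum>\<alpha>\<in>?A. c \<alpha> * G \<alpha> (\<phi> t)) = 0" for c
  proof (rule ccontr)
    assume "\<not> ?thesis"
    then have ne: "{\<alpha>\<in>?A. c \<alpha> \<noteq> 0} \<noteq> {}" by auto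
    \<comment> \<open>\<open>e\<close> is the lowest order that occurs.\<close>
    define e where "e = Min (s ` {\<alpha>\<in>?A. c \<alpha> \<noteq> 0})"
    have e_in: "e \<in> s ` {\<alpha>\<in>?A. c \<alpha> \<noteq> 0}" unfolding e_def using ne finA by (intro Min_in) auto
    have e_le: "e \<le> s \<alpha>" if "\<alpha> \<in> ?A" "c \<alpha> \<noteq> 0" for \<alpha>
      unfolding e_def using that finA by (intro Min_le) auto
    define c' where "c' \<alpha> = (if s \<alpha> = e then c \<alpha> else 0)" for \<alpha>
    have "(\<Sum>\<alpha>\<in>?A. c' \<alpha> * (\<Prod>i\<in>I. t i ^ \<alpha> i)) = 0" for t
    proof -
      obtain P0 where P0: "\<And>x. l0 (\<phi> (\<lambda>i. x * t i)) = poly P0 x" "coeff P0 0 = 1"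
        using j0[of t] unfolding jet_def by metis
      have "\<forall>i\<in>I. \<exists>R. (\<forall>x. l i (\<phi> (\<lambda>i. x * t i)) = x * poly R x) \<and> poly R 0 = t i"
      proof
        fix i assume "i \<in> I"
        then obtain p where p: "\<And>x. l i (\<phi> (\<lambda>i. x * t i)) = poly p x" "coeff p 0 = 0" "coeff p 1 = t i"
          using j[of i t] unfolding jet_def by metis
        obtain a R where R: "p = pCons a R" by (cases p)
        show "\<exists>R. (\<forall>x. l i (\<phi> (\<lambda>i. x * t i)) = x * poly R x) \<and> poly R 0 = t i"
          using p R by (intro exI[of _ R]) (auto simp: poly_0_coeff_0)
      qed
      then obtain R where R: "\<And>i x. i \<in> I \<Longrightarrow> l i (\<phi> (\<lambda>i. x * t i)) = x * poly (R i) x"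
        "\<And>i. i \<in> I \<Longrightarrow> poly (R i) 0 = t i" by metis
      define q where "q \<alpha> = P0 ^ (?d - s \<alpha>) * (\<Prod>i\<in>I. R i ^ \<alpha> i)" for \<alpha>
      have Gq: "G \<alpha> (\<phi> (\<lambda>i. x * t i)) = x ^ s \<alpha> * poly (q \<alpha>) x" for \<alpha> x
      proof -
        have "(\<Prod>i\<in>I. l i (\<phi> (\<lambda>i. x * t i)) ^ \<alpha> i) = (\<Prod>i\<in>I. x ^ \<alpha> i * poly (R i) x ^ \<alpha> i)"
          by (intro prod.cong refl) (simp add: R(1) power_mult_distrib)
        also have "\<dots> = x ^ s \<alpha> * (\<Prod>i\<in>I. poly (R i) x ^ \<alpha> i)"
          by (simp add: prod.distrib power_sum[symmetric] s_def)
        finally show ?thesis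
          by (simp add: G_def q_def P0(1) poly_prod poly_power)
      qed
      have q0: "poly (q \<alpha>) 0 = (\<Prod>i\<in>I. t i ^ \<alpha> i)" for \<alpha>
      proof -
        have "poly P0 0 = 1" using P0(2) by (simp add: poly_0_coeff_0)
        then show ?thesis using R(2) by (simp add: q_def poly_prod poly_power del: poly_0_coeff_0)
      qed
      \<comment> \<open>\<open>Q\<close> is the combination on the ray through \<open>t\<close>, divided by the \<open>e\<close>-th power of the variable.\<close>
      define Q where "Q = (\<Sum>\<alpha>\<in>?A. smult (c \<alpha>) (monom 1 (s \<alpha> - e) * q \<alpha>))"
      have "poly (monom 1 e * Q) x = 0" for x
      proof -
        have "poly (monom 1 e * Q) x = (\<Sum>\<alpha>\<in>?A. c \<alpha> * (x ^ e * x ^ (s \<alpha> - e) * poly (q \<alpha>) x))"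
          by (simp add: Q_def poly_monom poly_sum sum_distrib_left mult_ac)
        also have "\<dots> = (\<Sum>\<alpha>\<in>?A. c \<alpha> * G \<alpha> (\<phi> (\<lambda>i. x * t i)))"
        proof (intro sum.cong refl)
          fix \<alpha> assume "\<alpha> \<in> ?A"
          show "c \<alpha> * (x ^ e * x ^ (s \<alpha> - e) * poly (q \<alpha>) x) = c \<alpha> * G \<alpha> (\<phi> (\<lambda>i. x * t i))"
          proof (cases "c \<alpha> = 0")
            case False
            then have "e \<le> s \<alpha>" using e_le \<open>\<alpha> \<in> ?A\<close> by blast
            then show ?thesis by (simp add: Gq power_add[symmetric])
          qed simp
        qed
        also have "\<dots> = 0" by (rule 0)
        finally show ?thesis .
      qed
      then have "monom 1 e * Q = 0" using poly_all_0_iff_0 by blast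
      then have "Q = 0" by simp
      then have "0 = poly Q 0" by simp
      also have "\<dots> = (\<Sum>\<alpha>\<in>?A. c \<alpha> * (0 ^ (s \<alpha> - e) * (\<Prod>i\<in>I. t i ^ \<alpha> i)))"
        by (simp add: Q_def poly_sum poly_monom q0)
      also have "\<dots> = (\<Sum>\<alpha>\<in>?A. c' \<alpha> * (\<Prod>i\<in>I. t i ^ \<alpha> i))"
      proof (intro sum.cong refl)
        fix \<alpha> assume "\<alpha> \<in> ?A"
        then show "c \<alpha> * (0 ^ (s \<alpha> - e) * (\<Prod>i\<in>I. t i ^ \<alpha> i)) = c' \<alpha> * (\<Prod>i\<in>I. t i ^ \<alpha> i)"
          using e_le[of \<alpha>] by (cases "c \<alpha> = 0") (auto simp: c'_def power_0_left)
      qed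
      finally show ?thesis by simp
    qed
    then have c'0: "c' \<alpha> = 0" if "\<alpha> \<in> ?A" for \<alpha> using monomials_independent[OF I _ that] by blast
    obtain \<alpha> where "\<alpha> \<in> ?A" "c \<alpha> \<noteq> 0" "s \<alpha> = e" using e_in by blast
    then show False using c'0[of \<alpha>] by (simp add: c'_def)
  qed
  have card: "card ?A = (K + 1) ^ card I" using I by (simp add: card_PiE)
  obtain h where h: "bij_betw h {..<(K + 1) ^ card I} ?A"
    using ex_bij_betw_nat_finite[OF finA] unfolding card lessThan_atLeast0[symmetric] by blast
  show ?thesis
    unfolding hom_indep_def
  proof (intro exI[of _ "\<lambda>j. G (h j)"] conjI allI impI)
    fix j assume "j < (K + 1) ^ card I"
    then show "homogeneous fscale ?d (G (h j))" using h hom by (auto dest: bij_betwE)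
  next
    fix c j assume 0: "\<forall>w\<in>range \<phi>. (\<Sum>j<(K + 1) ^ card I. c j * G (h j) w) = 0"
      and j: "j < (K + 1) ^ card I"
    define h' where "h' = inv_into {..<(K + 1) ^ card I} h"
    have inv: "h' (h j) = j" if "j < (K + 1) ^ card I" for j
      unfolding h'_def using h that by (intro inv_into_f_f) (auto simp: bij_betw_def)
    have "(\<Sum>\<alpha>\<in>?A. c (h' \<alpha>) * G \<alpha> (\<phi> t)) = 0" for t
    proof -
      have "(\<Sum>\<alpha>\<in>?A. c (h' \<alpha>) * G \<alpha> (\<phi> t)) = (\<Sum>j<(K + 1) ^ card I. c (h' (h j)) * G (h j) (\<phi> t))"
        by (rule sum.reindex_bij_betw[OF h, symmetric])
      also have "\<dots> = (\<Sum>j<(K + 1) ^ card I. c j * G (h j) (\<phi> t))"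
        using inv by (intro sum.cong) auto
      also have "\<dots> = 0" using 0 by blast
      finally show ?thesis .
    qed
    then have "\<forall>\<alpha>\<in>?A. c (h' \<alpha>) = 0" using indep[of "\<lambda>\<alpha>. c (h' \<alpha>)"] by blast
    moreover have "h j \<in> ?A" using h j by (auto dest: bij_betwE)
    ultimately show "c j = 0" using inv[OF j] by force
  qed
qed

lemma not_dominates_of_fewer_parameters:
  fixes \<phi> :: "('i \<Rightarrow> 'a::field_char_0) \<Rightarrow> ('c \<Rightarrow> 'a)" and \<psi> :: "('j \<Rightarrow> 'a) \<Rightarrow> ('c \<Rightarrow> 'a)"
  assumes "finite I" "polynomial_map I \<delta> \<phi>" "finite J" "local_parameters J \<psi>"
    and "card I < card J"
  shows "\<not> dominates (range \<phi>) (range \<psi>)"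
proof
  assume dom: "dominates (range \<phi>) (range \<psi>)"
  have "(K + 1) ^ card J \<le> (\<delta> * card J * K + 1) ^ card I" for K
    using hom_indep_bound[OF assms(1,2) dom local_parameters_hom_indep[OF assms(3,4)]]
    by (simp add: mult.assoc)
  then have "card J \<le> card I" by (rule polynomial_growth_exponent)
  then show False using assms(5) by simp
qed

section \<open>Krull dimension of parametrised projective sets\<close>

lemma closedin_proj_zariski:
  "closedin (proj_zariski fscale W) A \<longleftrightarrow>
    (\<exists>F. (\<forall>p\<in>F. \<exists>d. homogeneous (fscale :: 'a::field \<Rightarrow> ('c \<Rightarrow> 'a) \<Rightarrow> 'c \<Rightarrow> 'a) d p) \<and>
         A = {L \<in> proj_space fscale W. \<forall>p\<in>F. \<forall>w\<in>L. p w = 0})"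
  (is "_ \<longleftrightarrow> ?R") and topspace_proj_zariski:
  "topspace (proj_zariski (fscale :: 'a::field \<Rightarrow> ('c \<Rightarrow> 'a) \<Rightarrow> 'c \<Rightarrow> 'a) W) = proj_space fscale W"
proof -
  let ?P = "proj_zariski (fscale :: 'a \<Rightarrow> ('c \<Rightarrow> 'a) \<Rightarrow> 'c \<Rightarrow> 'a) W"
  let ?U = "\<lambda>F. {L \<in> proj_space (fscale :: 'a \<Rightarrow> ('c \<Rightarrow> 'a) \<Rightarrow> 'c \<Rightarrow> 'a) W. \<exists>p\<in>F. \<exists>w\<in>L. p w \<noteq> 0}"
  have o: "openin ?P U \<longleftrightarrow> (\<exists>F. (\<forall>p\<in>F. \<exists>d. homogeneous fscale d p) \<and> U = ?U F)" for U
    by (rule openin_proj_zariski[OF vector_space_fscale])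
  have ne: "\<exists>w. w \<in> L" if "L \<in> proj_space (fscale :: 'a \<Rightarrow> ('c \<Rightarrow> 'a) \<Rightarrow> 'c \<Rightarrow> 'a) W" for L
    using that fun_space.span_base unfolding proj_space_def by blast
  show top: "topspace ?P = proj_space fscale W"
  proof
    show "topspace ?P \<subseteq> proj_space fscale W"
    proof
      fix L assume "L \<in> topspace ?P"
      then obtain U where U: "openin ?P U" "L \<in> U" unfolding topspace_def by blast
      from o[THEN iffD1, OF U(1)] U(2) show "L \<in> proj_space fscale W" by (elim exE conjE) simp
    qed
    have "openin ?P (?U {\<lambda>_ :: 'c \<Rightarrow> 'a. 1 :: 'a})"
      by (rule o[THEN iffD2], rule exI[of _ "{\<lambda>_ :: 'c \<Rightarrow> 'a. 1 :: 'a}"]) (use homogeneous_const[of 1] in blast)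
    moreover have "proj_space fscale W \<subseteq> ?U {\<lambda>_ :: 'c \<Rightarrow> 'a. 1 :: 'a}" using ne by auto
    ultimately show "proj_space fscale W \<subseteq> topspace ?P" by (meson openin_subset order_trans)
  qed
  show "closedin ?P A \<longleftrightarrow> ?R"
  proof
    assume "closedin ?P A"
    then have A: "A \<subseteq> proj_space fscale W" and "openin ?P (proj_space fscale W - A)"
      by (simp_all only: closedin_def top)
    from o[THEN iffD1, OF this(2)]
    obtain F where F: "\<forall>p\<in>F. \<exists>d. homogeneous fscale d p" "proj_space fscale W - A = ?U F"
      by (elim exE conjE)
    have "A = proj_space fscale W - ?U F" using F(2) A by blast
    then have "A = {L \<in> proj_space fscale W. \<forall>p\<in>F. \<forall>w\<in>L. p w = 0}" by blast
    with F(1) show ?R by (intro exI[of _ F] conjI)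
  next
    assume ?R
    then obtain F where F: "\<forall>p\<in>F. \<exists>d. homogeneous (fscale :: 'a \<Rightarrow> ('c \<Rightarrow> 'a) \<Rightarrow> 'c \<Rightarrow> 'a) d p"
      "A = {L \<in> proj_space fscale W. \<forall>p\<in>F. \<forall>w\<in>L. p w = 0}" by (elim exE conjE)
    then have "proj_space fscale W - A = ?U F" by blast
    then have "openin ?P (proj_space fscale W - A)"
      using F(1) by (intro o[THEN iffD2] exI[of _ F] conjI)
    moreover have "A \<subseteq> proj_space fscale W" using F(2) by auto
    ultimately show "closedin ?P A" by (simp only: closedin_def top simp_thms)
  qed
qed

lemma closedin_zero_locus:
  assumes "homogeneous fscale d p"
  shows "closedin (proj_zariski fscale W) {L \<in> proj_space fscale W. \<forall>w\<in>L. p w = 0}"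
  unfolding closedin_proj_zariski using assms by (intro exI[of _ "{p}"]) auto

lemma homogeneous_zero_on_line:
  assumes "homogeneous fscale d p" "p u = 0" "w \<in> fun_space.span {u}"
  shows "p w = 0"
proof -
  obtain c where "w = fscale c u" using assms(3) by (auto simp: fun_space.span_singleton)
  then show ?thesis using assms(1,2) by (simp add: homogeneous_def)
qed

text \<open>
  On a single point of the projective set one of the two factors vanishes, so \<open>C\<close> is covered by two
  closed sets.
\<close>

lemma irreducible_zero_product:
  fixes f :: "('c \<Rightarrow> 'a::field) \<Rightarrow> 'a"
  assumes Z: "Z \<subseteq> proj_space fscale W"
    and irr: "irreducible_in (subtopology (proj_zariski fscale W) Z) C"
    and f: "homogeneous fscale d f" and g: "homogeneous fscale e g"
    and 0: "\<And>w. w \<in> \<Union>C \<Longrightarrow> f w * g w = 0"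
  shows "(\<forall>w\<in>\<Union>C. f w = 0) \<or> (\<forall>w\<in>\<Union>C. g w = 0)"
proof -
  let ?A = "Z \<inter> {L \<in> proj_space fscale W. \<forall>w\<in>L. f w = 0}"
  let ?B = "Z \<inter> {L \<in> proj_space fscale W. \<forall>w\<in>L. g w = 0}"
  have sub: "C \<subseteq> Z" using irr Z by (auto simp: irreducible_in_def)
  have "closedin (subtopology (proj_zariski fscale W) Z) ?A"
    "closedin (subtopology (proj_zariski fscale W) Z) ?B"
    using closedin_zero_locus[OF f] closedin_zero_locus[OF g] by (auto simp: closedin_subtopology)
  moreover have "C \<subseteq> ?A \<union> ?B"
  proof
    fix L assume L: "L \<in> C"
    then have LZ: "L \<in> Z" "L \<in> proj_space fscale W" using sub Z by auto
    then obtain u where u: "L = fun_space.span {u}" unfolding proj_space_def by blast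
    then have "u \<in> L" by (simp add: fun_space.span_base)
    then have "f u = 0 \<or> g u = 0" using 0 L by (metis UnionI mult_eq_0_iff)
    then show "L \<in> ?A \<union> ?B"
      using homogeneous_zero_on_line[OF f] homogeneous_zero_on_line[OF g] u LZ by blast
  qed
  ultimately have "C \<subseteq> ?A \<or> C \<subseteq> ?B" using irr unfolding irreducible_in_def by blast
  then show ?thesis by blast
qed

text \<open>
  A relation between the forms \<open>g\<close> and the multiples \<open>f h\<close> restricts on \<open>C\<close> to a relation between the
  \<open>g\<close>.  What remains is \<open>f\<close> times a relation between the \<open>h\<close>, and \<open>f\<close> can be cancelled on the
  irreducible set \<open>C'\<close>.
\<close>

lemma hom_indep_step:
  fixes f :: "('c \<Rightarrow> 'a::field) \<Rightarrow> 'a"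
  assumes Z: "Z \<subseteq> proj_space fscale W"
    and irr: "irreducible_in (subtopology (proj_zariski fscale W) Z) C'"
    and sub: "C \<subseteq> C'"
    and f: "homogeneous fscale e f" "\<forall>w\<in>\<Union>C. f w = 0" "w' \<in> \<Union>C'" "f w' \<noteq> 0"
    and M: "hom_indep (\<Union>C) (d + e) M" and N: "hom_indep (\<Union>C') d N"
  shows "hom_indep (\<Union>C') (d + e) (M + N)"
proof -
  obtain g where g: "\<And>j. j < M \<Longrightarrow> homogeneous fscale (d + e) (g j)"
    "\<And>c. (\<forall>w\<in>\<Union>C. (\<Sum>j<M. c j * g j w) = 0) \<Longrightarrow> (\<forall>j<M. c j = 0)"
    using M unfolding hom_indep_def by metis
  obtain h where h: "\<And>j. j < N \<Longrightarrow> homogeneous fscale d (h j)"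
    "\<And>c. (\<forall>w\<in>\<Union>C'. (\<Sum>j<N. c j * h j w) = 0) \<Longrightarrow> (\<forall>j<N. c j = 0)"
    using N unfolding hom_indep_def by metis
  define k where "k j = (if j < M then g j else (\<lambda>w. h (j - M) w * f w))" for j
  have split: "(\<Sum>j<M+N. c j * k j w) = (\<Sum>j<M. c j * g j w) + f w * (\<Sum>j<N. c (M + j) * h j w)" for c w
  proof -
    have "(\<Sum>j<M+N. c j * k j w) = (\<Sum>j<M. c j * k j w) + (\<Sum>j<N. c (M + j) * k (M + j) w)"
      by (induction N) (simp_all add: add.assoc)
    then show ?thesis by (simp add: k_def sum_distrib_left mult_ac)
  qed
  show ?thesis
    unfolding hom_indep_def
  proof (intro exI[of _ k] conjI allI impI)
    fix j assume "j < M + N"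
    then show "homogeneous fscale (d + e) (k j)"
      using g(1)[of j] homogeneous_mult[OF h(1)[of "j - M"] f(1)] by (auto simp: k_def)
  next
    fix c j assume 0: "\<forall>w\<in>\<Union>C'. (\<Sum>j<M+N. c j * k j w) = 0" and j: "j < M + N"
    have "\<forall>w\<in>\<Union>C. (\<Sum>j<M. c j * g j w) = 0"
    proof
      fix w assume w: "w \<in> \<Union>C"
      then have "(\<Sum>j<M+N. c j * k j w) = 0" using 0 sub by blast
      then show "(\<Sum>j<M. c j * g j w) = 0" unfolding split using f(2) w by auto
    qed
    then have c1: "\<forall>j<M. c j = 0" by (rule g(2))
    have "f w * (\<Sum>j<N. c (M + j) * h j w) = 0" if "w \<in> \<Union>C'" for w
      using 0 that c1 unfolding split by auto
    moreover have "homogeneous fscale d (\<lambda>w. \<Sum>j<N. c (M + j) * h j w)"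
      by (intro homogeneous_sum homogeneous_cmult h(1)) simp
    ultimately have "\<forall>w\<in>\<Union>C'. (\<Sum>j<N. c (M + j) * h j w) = 0"
      using irreducible_zero_product[OF Z irr f(1)] f(3,4) by blast
    then have "\<forall>j<N. c (M + j) = 0" by (rule h(2)[of "\<lambda>j. c (M + j)"])
    then show "c j = 0" using c1 j by (metis add_less_cancel_left le_add_diff_inverse not_less)
  qed
qed

lemma chain_separating_form:
  fixes W :: "('c \<Rightarrow> 'a::field) set"
  assumes Z: "Z \<subseteq> proj_space fscale W"
    and "closedin (subtopology (proj_zariski fscale W) Z) C" "C \<subset> C'" "C' \<subseteq> Z"
  shows "\<exists>e f. homogeneous fscale e f \<and> (\<forall>w\<in>\<Union>C. f w = 0) \<and> (\<exists>w\<in>\<Union>C'. f w \<noteq> 0)"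
proof -
  obtain T where T: "closedin (proj_zariski fscale W) T" "C = T \<inter> Z"
    using assms(2) unfolding closedin_subtopology by blast
  then obtain F where F: "\<forall>p\<in>F. \<exists>d. homogeneous fscale d p"
      "T = {L \<in> proj_space fscale W. \<forall>p\<in>F. \<forall>w\<in>L. p w = 0}"
    unfolding closedin_proj_zariski by blast
  obtain L where L: "L \<in> C'" "L \<notin> C" using assms(3) by blast
  then have "L \<in> Z" "L \<notin> T" using assms(4) T(2) by auto
  then obtain p w where "p \<in> F" "w \<in> L" "p w \<noteq> 0" using F(2) Z by blast
  moreover have "\<forall>w\<in>\<Union>C. p w = 0" using T(2) F(2) \<open>p \<in> F\<close> by blast
  ultimately show ?thesis using F(1) L(1) by blast
qed

lemma point_hom_indep:
  assumes "L \<in> C" "C \<subseteq> proj_space fscale (W :: ('c \<Rightarrow> 'a::field) set)"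
  shows "hom_indep (\<Union>C) d 1"
proof -
  obtain u where u: "L = fun_space.span {u}" "u \<noteq> 0" using assms unfolding proj_space_def by blast
  then obtain x where x: "u x \<noteq> 0" by (auto simp: fun_eq_iff)
  have "u \<in> \<Union>C" using u(1) assms(1) fun_space.span_base by blast
  then show ?thesis
    unfolding hom_indep_def using homogeneous_power[OF linear_evaluation[of x]] x
    by (intro exI[of _ "\<lambda>_ w. w x ^ d"]) auto
qed

text \<open>
  By \<open>hom_indep_step\<close> with a form of degree \<open>e\<close>, the number of independent forms on \<open>C (i + 1)\<close> is at
  least the sum of the numbers on \<open>C i\<close> in the degrees \<open>d, d - e, \<dots>, d - K e\<close>.
\<close>

lemma chain_hom_indep:
  fixes W :: "('c \<Rightarrow> 'a::field) set"
  assumes Z: "Z \<subseteq> proj_space fscale W"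
    and C: "\<And>i. i \<le> m \<Longrightarrow> closedin (subtopology (proj_zariski fscale W) Z) (C i)"
      "\<And>i. i \<le> m \<Longrightarrow> irreducible_in (subtopology (proj_zariski fscale W) Z) (C i)"
    and strict: "\<And>i. i < m \<Longrightarrow> C i \<subset> C (Suc i)"
    and "i \<le> m"
  shows "\<exists>E. \<forall>d K. E * K \<le> d \<longrightarrow> hom_indep (\<Union>(C i)) d ((K + 1) ^ i)"
  using \<open>i \<le> m\<close>
proof (induction i)
  have CZ: "C i \<subseteq> Z" if "i \<le> m" for i
    using C(1)[OF that] Z by (auto simp: closedin_subtopology)
  {
    case 0
    obtain L where "L \<in> C 0" using C(2)[OF 0] unfolding irreducible_in_def by blast
    then show ?case using point_hom_indep[of L "C 0" W] CZ[OF 0] Z by auto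
  next
    case (Suc i)
    then obtain E where E: "\<And>d K. E * K \<le> d \<Longrightarrow> hom_indep (\<Union>(C i)) d ((K + 1) ^ i)" by auto
    have lt: "C i \<subset> C (Suc i)" using strict Suc.prems by simp
    obtain e f w' where f: "homogeneous fscale e f" "\<forall>w\<in>\<Union>(C i). f w = 0"
        "w' \<in> \<Union>(C (Suc i))" "f w' \<noteq> 0"
      using chain_separating_form[OF Z C(1) lt CZ] Suc.prems by (metis Suc_leD)
    have "hom_indep (\<Union>(C (Suc i))) d ((j + 1) * (K + 1) ^ i)" if "E * K + e * j \<le> d" for d K j
      using that
    proof (induction j arbitrary: d)
      case 0
      then have "hom_indep (\<Union>(C i)) d ((K + 1) ^ i)" by (intro E) simp
      then show ?case using hom_indep_mono[of _ d _ "\<Union>(C (Suc i))"] lt by fastforce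
    next
      case (Suc j)
      have "hom_indep (\<Union>(C (Suc i))) (d - e + e) ((K + 1) ^ i + (j + 1) * (K + 1) ^ i)"
      proof (rule hom_indep_step[OF Z C(2)[OF \<open>Suc i \<le> m\<close>] _ f])
        show "C i \<subseteq> C (Suc i)" using lt by blast
        show "hom_indep (\<Union>(C i)) (d - e + e) ((K + 1) ^ i)" using Suc.prems by (intro E) simp
        show "hom_indep (\<Union>(C (Suc i))) (d - e) ((j + 1) * (K + 1) ^ i)"
          using Suc.prems by (intro Suc.IH) simp
      qed
      then show ?case using Suc.prems by (simp add: algebra_simps)
    qed
    then have "hom_indep (\<Union>(C (Suc i))) d ((K + 1) ^ Suc i)" if "(E + e) * K \<le> d" for d K
      using that by (simp only: power_Suc distrib_right)
    then show ?case by blast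
  }
qed

lemma krull_dim_le_parameters:
  fixes \<phi> :: "('i \<Rightarrow> 'a::field_char_0) \<Rightarrow> ('c \<Rightarrow> 'a)"
  assumes Z: "Z \<subseteq> proj_space fscale W"
    and "finite I" "polynomial_map I \<delta> \<phi>" "dominates (range \<phi>) (\<Union>Z)"
  shows "krull_dim (subtopology (proj_zariski fscale W) Z) \<le> enat (card I)"
  unfolding krull_dim_def
proof (rule Sup_least, clarify)
  fix m and C :: "nat \<Rightarrow> ('c \<Rightarrow> 'a) set set"
  assume C: "\<forall>i\<le>m. closedin (subtopology (proj_zariski fscale W) Z) (C i) \<and>
      irreducible_in (subtopology (proj_zariski fscale W) Z) (C i)" "\<forall>i<m. C i \<subset> C (Suc i)"
  obtain E where E: "\<And>d K. E * K \<le> d \<Longrightarrow> hom_indep (\<Union>(C m)) d ((K + 1) ^ m)"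
    using chain_hom_indep[OF Z, of m C m] C by blast
  have "C m \<subseteq> Z" using C(1) Z by (auto simp: closedin_subtopology)
  then have dom: "dominates (range \<phi>) (\<Union>(C m))" using assms(4) unfolding dominates_def by blast
  have "(K + 1) ^ m \<le> (\<delta> * E * K + 1) ^ card I" for K
    using hom_indep_bound[OF assms(2,3) dom E[of K "E * K"]] by (simp add: mult.assoc)
  then have "m \<le> card I" by (rule polynomial_growth_exponent)
  then show "enat m \<le> enat (card I)" by simp
qed

text \<open>
  The image of an affine space is irreducible: forms that cut out two closed sets covering the image
  pull back to two polynomials with product zero.  The extra factor \<open>\<phi> t x\<close> takes care of the
  parameters with \<open>\<phi> t = 0\<close>, which do not give a point.
\<close>

lemma irreducible_in_image:
  fixes \<phi> :: "('i \<Rightarrow> 'a::field_char_0) \<Rightarrow> ('c \<Rightarrow> 'a)"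
  assumes Z: "Z \<subseteq> proj_space fscale W" and \<phi>: "polynomial_map I \<delta> \<phi>" "\<phi> t0 \<noteq> 0"
    and sub: "proj_space fscale (range \<phi>) \<subseteq> Z"
  shows "irreducible_in (subtopology (proj_zariski fscale W) Z) (proj_space fscale (range \<phi>))"
  unfolding irreducible_in_def
proof (intro conjI allI impI)
  let ?X = "subtopology (proj_zariski fscale W) Z"
  let ?Y = "proj_space fscale (range \<phi>)"
  show "?Y \<noteq> {}" using \<phi>(2) by (auto simp: proj_space_def)
  show "?Y \<subseteq> topspace ?X" using sub Z by (auto simp: topspace_proj_zariski)
  fix A B assume A: "closedin ?X A" and B: "closedin ?X B" and AB: "?Y \<subseteq> A \<union> B"
  have witness: "\<exists>d p a. homogeneous fscale d p \<and> p (\<phi> a) \<noteq> 0 \<and> (\<forall>w\<in>\<Union>T. p w = 0)"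
    if T: "closedin ?X T" "\<not> ?Y \<subseteq> T" for T
  proof -
    obtain T' where T': "closedin (proj_zariski fscale W) T'" "T = T' \<inter> Z"
      using T(1) unfolding closedin_subtopology by blast
    then obtain F where F: "\<forall>p\<in>F. \<exists>d. homogeneous fscale d p"
        "T' = {L \<in> proj_space fscale W. \<forall>p\<in>F. \<forall>w\<in>L. p w = 0}"
      unfolding closedin_proj_zariski by blast
    obtain L where L: "L \<in> ?Y" "L \<notin> T" using T(2) by blast
    then obtain a where a: "L = fun_space.span {\<phi> a}" unfolding proj_space_def by blast
    obtain p w where p: "p \<in> F" "w \<in> L" "p w \<noteq> 0" using L T' F(2) sub Z by blast
    then obtain d where d: "homogeneous fscale d p" using F(1) by blast
    have "p (\<phi> a) \<noteq> 0" using homogeneous_zero_on_line[OF d] p a by blast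
    moreover have "\<forall>w\<in>\<Union>T. p w = 0" using T'(2) F(2) p(1) by blast
    ultimately show ?thesis using d by blast
  qed
  show "?Y \<subseteq> A \<or> ?Y \<subseteq> B"
  proof (rule ccontr)
    assume "\<not> ?thesis"
    then obtain d p a e q b where p: "homogeneous fscale d p" "p (\<phi> a) \<noteq> 0" "\<forall>w\<in>\<Union>A. p w = 0"
      and q: "homogeneous fscale e q" "q (\<phi> b) \<noteq> 0" "\<forall>w\<in>\<Union>B. q w = 0"
      using witness[OF A] witness[OF B] by blast
    obtain x where x: "\<phi> t0 x \<noteq> 0" using \<phi>(2) by (auto simp: fun_eq_iff)
    have 0: "(p (\<phi> t) * q (\<phi> t)) * \<phi> t x = 0" for t
    proof (cases "\<phi> t = 0")
      case False
      then have "fun_space.span {\<phi> t} \<in> ?Y" unfolding proj_space_def by blast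
      then have "fun_space.span {\<phi> t} \<in> A \<or> fun_space.span {\<phi> t} \<in> B" using AB by blast
      moreover have "\<phi> t \<in> fun_space.span {\<phi> t}" by (simp add: fun_space.span_base)
      ultimately show ?thesis using p(3) q(3) by fastforce
    qed (simp add: zero_fun_def)
    have pp: "poly_upto I (\<delta> * d) (\<lambda>t. p (\<phi> t))" by (rule homogeneous_pullback[OF p(1) \<phi>(1)])
    have pq: "poly_upto I (\<delta> * e) (\<lambda>t. q (\<phi> t))" by (rule homogeneous_pullback[OF q(1) \<phi>(1)])
    have px: "poly_upto I \<delta> (\<lambda>t. \<phi> t x)" using \<phi>(1) linear_evaluation[of x] unfolding polynomial_map_def by blast
    have "(\<forall>t. p (\<phi> t) * q (\<phi> t) = 0) \<or> (\<forall>t. \<phi> t x = 0)"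
      by (rule poly_upto_mult_eq_0[OF poly_upto.mult[OF pp pq] px 0])
    then have "\<And>t. p (\<phi> t) * q (\<phi> t) = 0" using x by blast
    then have "(\<forall>t. p (\<phi> t) = 0) \<or> (\<forall>t. q (\<phi> t) = 0)"
      by (rule poly_upto_mult_eq_0[OF pp pq])
    then show False using p(2) q(2) by blast
  qed
qed

lemma irreducible_in_closure:
  assumes "irreducible_in X Y" shows "irreducible_in X (X closure_of Y)"
  unfolding irreducible_in_def
proof (intro conjI allI impI)
  have Y: "Y \<noteq> {}" "Y \<subseteq> topspace X" using assms by (auto simp: irreducible_in_def)
  have sub: "Y \<subseteq> X closure_of Y" by (rule closure_of_subset[OF Y(2)])
  show "X closure_of Y \<noteq> {}" using sub Y(1) by blast
  show "X closure_of Y \<subseteq> topspace X" by (rule closure_of_subset_topspace)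
  fix A B assume AB: "closedin X A" "closedin X B" "X closure_of Y \<subseteq> A \<union> B"
  then have "Y \<subseteq> A \<or> Y \<subseteq> B" using assms sub unfolding irreducible_in_def by blast
  then show "X closure_of Y \<subseteq> A \<or> X closure_of Y \<subseteq> B"
    using closure_of_minimal AB(1,2) by metis
qed

definition restrict_to :: "'i set \<Rightarrow> ('i \<Rightarrow> 'a::zero) \<Rightarrow> 'i \<Rightarrow> 'a"
  where "restrict_to J t = (\<lambda>i. if i \<in> J then t i else 0)"

lemma polynomial_map_restrict:
  assumes "polynomial_map I \<delta> \<phi>" "J \<subseteq> I"
  shows "polynomial_map J \<delta> (\<lambda>t. \<phi> (restrict_to J t))"
  using poly_upto_restrict[OF _ assms(2)] assms(1)
  unfolding polynomial_map_def restrict_to_def by blast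

lemma local_parameters_restrict:
  assumes "local_parameters I \<phi>" "J \<subseteq> I"
  shows "local_parameters J (\<lambda>t. \<phi> (restrict_to J t))"
proof -
  obtain l0 l where l: "Vector_Spaces.linear fscale (*) l0" "\<forall>i\<in>I. Vector_Spaces.linear fscale (*) (l i)"
    "\<forall>t. jet (\<lambda>x. l0 (\<phi> (\<lambda>i. x * t i))) 1 0"
    "\<forall>i\<in>I. \<forall>t. jet (\<lambda>x. l i (\<phi> (\<lambda>i. x * t i))) 0 (t i)"
    using assms(1) unfolding local_parameters_def by blast
  have eq: "restrict_to J (\<lambda>i. x * t i) = (\<lambda>i. x * restrict_to J t i)" for x and t :: "'a \<Rightarrow> 'b"
    by (auto simp: restrict_to_def)
  have "jet (\<lambda>x. l i (\<phi> (\<lambda>i. x * restrict_to J t i))) 0 (t i)" if "i \<in> J" for i t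
  proof -
    have "jet (\<lambda>x. l i (\<phi> (\<lambda>i. x * restrict_to J t i))) 0 (restrict_to J t i)"
      using l(4) that assms(2) by blast
    then show ?thesis using that by (simp add: restrict_to_def)
  qed
  then show ?thesis unfolding local_parameters_def eq using l assms(2) by blast
qed

lemma local_parameters_nonzero:
  assumes "local_parameters I \<phi>" shows "\<phi> (\<lambda>_. 0) \<noteq> 0"
proof
  assume 0: "\<phi> (\<lambda>_. 0) = 0"
  obtain l0 l where l0: "Vector_Spaces.linear fscale (*) l0"
    and "\<forall>t. jet (\<lambda>x. l0 (\<phi> (\<lambda>i. x * t i))) 1 0"
    using assms unfolding local_parameters_def by blast
  then have "jet (\<lambda>x. l0 (\<phi> (\<lambda>i. x * 0))) 1 0" by (elim allE[of _ "\<lambda>_. 0"])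
  then obtain p where p: "\<And>x. l0 (\<phi> (\<lambda>i. x * 0)) = poly p x" "coeff p 0 = 1"
    unfolding jet_def by blast
  have "poly p 0 = 0" using p(1)[of 0] 0 functional_0[OF l0] by (simp del: zero_fun_apply)
  then show False using p(2) by (simp add: poly_0_coeff_0)
qed

text \<open>
  The chain consists of the closures of the images of the coordinate subspaces spanned by the first
  \<open>i\<close> parameters.  Neighbours differ because the image of a larger subspace carries more independent
  forms than the parameters of the smaller one allow.
\<close>

lemma krull_dim_ge_parameters:
  fixes \<phi> :: "('i \<Rightarrow> 'a::field_char_0) \<Rightarrow> ('c \<Rightarrow> 'a)"
  assumes Z: "Z \<subseteq> proj_space fscale W"
    and I: "finite I" and \<phi>: "polynomial_map I \<delta> \<phi>" "local_parameters I \<phi>"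
    and sub: "proj_space fscale (range \<phi>) \<subseteq> Z"
  shows "enat (card I) \<le> krull_dim (subtopology (proj_zariski fscale W) Z)"
proof -
  let ?X = "subtopology (proj_zariski fscale W) Z"
  obtain h where h: "bij_betw h {..<card I} I"
    using ex_bij_betw_nat_finite[OF I] unfolding lessThan_atLeast0[symmetric] by blast
  define J where "J i = h ` {..<i}" for i
  have J: "J i \<subseteq> I" "card (J i) = i" if "i \<le> card I" for i
  proof -
    have inj: "inj_on h {..<i}" using h that by (auto simp: bij_betw_def intro: inj_on_subset)
    show "card (J i) = i" unfolding J_def using card_image[OF inj] by simp
    show "J i \<subseteq> I" unfolding J_def using h that by (auto simp: bij_betw_def)
  qed
  define \<psi> where "\<psi> i t = \<phi> (restrict_to (J i) t)" for i t
  define Y where "Y i = proj_space fscale (range (\<psi> i))" for i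
  have YZ: "Y i \<subseteq> Z" for i using sub unfolding Y_def \<psi>_def proj_space_def by blast
  have loc: "local_parameters (J i) (\<psi> i)" if "i \<le> card I" for i
    unfolding \<psi>_def by (rule local_parameters_restrict[OF \<phi>(2) J(1)[OF that]])
  have pm: "polynomial_map (J i) \<delta> (\<psi> i)" if "i \<le> card I" for i
    unfolding \<psi>_def by (rule polynomial_map_restrict[OF \<phi>(1) J(1)[OF that]])
  have irr: "irreducible_in ?X (Y i)" if "i \<le> card I" for i
    unfolding Y_def
    by (rule irreducible_in_image[OF Z pm[OF that] local_parameters_nonzero[OF loc[OF that]]])
      (use YZ[of i] in \<open>simp add: Y_def\<close>)
  have strict: "?X closure_of Y i \<subset> ?X closure_of Y (Suc i)" if i: "i < card I" for i
  proof
    have "restrict_to (J i) t = restrict_to (J (Suc i)) (restrict_to (J i) t)" for t :: "'i \<Rightarrow> 'a"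
      unfolding restrict_to_def J_def by (rule ext) (simp add: lessThan_Suc)
    then have "range (\<psi> i) \<subseteq> range (\<psi> (Suc i))" unfolding \<psi>_def by (metis image_subsetI rangeI)
    then have "Y i \<subseteq> Y (Suc i)" unfolding Y_def proj_space_def by blast
    then show "?X closure_of Y i \<subseteq> ?X closure_of Y (Suc i)" by (rule closure_of_mono)
    have "\<not> dominates (range (\<psi> i)) (range (\<psi> (Suc i)))"
      using not_dominates_of_fewer_parameters[OF _ pm _ loc, of i "Suc i"] J i finite_subset[OF _ I]
      by simp
    then obtain d p t where p: "homogeneous fscale d p" "\<forall>w\<in>range (\<psi> i). p w = 0" "p (\<psi> (Suc i) t) \<noteq> 0"
      unfolding dominates_def by blast
    let ?V = "Z \<inter> {L \<in> proj_space fscale W. \<forall>w\<in>L. p w = 0}"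
    have "closedin ?X ?V" using closedin_zero_locus[OF p(1)] by (auto simp: closedin_subtopology)
    moreover have "Y i \<subseteq> ?V"
    proof
      fix L assume L: "L \<in> Y i"
      then obtain t where "L = fun_space.span {\<psi> i t}" unfolding Y_def proj_space_def by blast
      then have "\<forall>w\<in>L. p w = 0" using homogeneous_zero_on_line[OF p(1)] p(2) by blast
      then show "L \<in> ?V" using L YZ Z by blast
    qed
    ultimately have sub_V: "?X closure_of Y i \<subseteq> ?V" by (rule closure_of_minimal[rotated])
    have "p (\<psi> i t) = 0" using p(2) by blast
    then have "p 0 = 0" by (rule homogeneous_0_at_0[OF p(1)])
    then have "\<psi> (Suc i) t \<noteq> 0" using p(3) by (intro notI) (simp del: zero_fun_apply)
    then have "fun_space.span {\<psi> (Suc i) t} \<in> Y (Suc i)" unfolding Y_def proj_space_def by blast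
    moreover have "Y (Suc i) \<subseteq> ?X closure_of Y (Suc i)"
      using irr[of "Suc i"] i by (intro closure_of_subset) (auto simp: irreducible_in_def)
    moreover have "fun_space.span {\<psi> (Suc i) t} \<notin> ?V"
      using p(3) fun_space.span_base[of "\<psi> (Suc i) t" "{\<psi> (Suc i) t}"] by blast
    ultimately show "?X closure_of Y i \<noteq> ?X closure_of Y (Suc i)"
      using sub_V by blast
  qed
  show ?thesis
    unfolding krull_dim_def
  proof (rule Sup_upper, intro CollectI exI conjI refl allI impI)
    fix i assume "i \<le> card I"
    show "closedin ?X (?X closure_of Y i)" by (rule closedin_closure_of)
    show "irreducible_in ?X (?X closure_of Y i)"
      by (rule irreducible_in_closure[OF irr[OF \<open>i \<le> card I\<close>]])
  qed (rule refl, rule strict)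
qed

text \<open>
  The functionals \<open>l0\<close> and \<open>l i\<close> are linearly independent on the image, as their jets are.
\<close>

lemma local_parameters_dim:
  fixes \<phi> :: "('i \<Rightarrow> 'a::field_char_0) \<Rightarrow> ('c \<Rightarrow> 'a)"
  assumes I: "finite I" and "local_parameters I \<phi>"
    and W: "range \<phi> \<subseteq> W" "W \<subseteq> fun_space.span B" "finite B"
  shows "card I + 1 \<le> fun_space.dim W"
proof -
  obtain l0 l where l0: "Vector_Spaces.linear fscale (*) l0"
    and l: "\<And>i. i \<in> I \<Longrightarrow> Vector_Spaces.linear fscale (*) (l i)"
    and j0: "\<And>t. jet (\<lambda>x. l0 (\<phi> (\<lambda>i. x * t i))) 1 0"
    and j: "\<And>i t. i \<in> I \<Longrightarrow> jet (\<lambda>x. l i (\<phi> (\<lambda>i. x * t i))) 0 (t i)"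
    using assms(2) unfolding local_parameters_def by metis
  obtain A where A: "A \<subseteq> W" "fun_space.independent A" "W \<subseteq> fun_space.span A" "card A = fun_space.dim W"
    using fun_space.basis_exists[of W] by metis
  have finA: "finite A" using fun_space.independent_span_bound[OF W(3) A(2)] A(1) W(2) by blast
  obtain h where h: "bij_betw h {..<card I} I"
    using ex_bij_betw_nat_finite[OF I] unfolding lessThan_atLeast0[symmetric] by blast
  define v where "v j = (if j = 0 then l0 else l (h (j - 1)))" for j
  have v: "Vector_Spaces.linear fscale (*) (v j)" if "j < card I + 1" for j
  proof (cases j)
    case (Suc i)
    then have "h i \<in> I" using that h by (auto simp: bij_betw_def)
    then show ?thesis using l Suc by (simp add: v_def)
  qed (simp add: v_def l0)
  have "card I + 1 \<le> card ((\<lambda>a x. if x = a then 1 else 0 :: 'a) ` A)"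
  proof (rule fun_space.independent_family_bound)
    show "finite ((\<lambda>a x. if x = a then 1 else 0 :: 'a) ` A)" using finA by simp
    fix j assume "j < card I + 1"
    have "(\<lambda>w. if w \<in> A then v j w else 0) = (\<Sum>a\<in>A. fscale (v j a) (\<lambda>x. if x = a then 1 else 0))"
      by (rule ext) (simp add: sum_fun_apply fscale_def finA if_distrib cong: if_cong)
    also have "\<dots> \<in> fun_space.span ((\<lambda>a x. if x = a then 1 else 0 :: 'a) ` A)"
      by (intro fun_space.span_sum fun_space.span_scale fun_space.span_base) simp
    finally show "(\<lambda>w. if w \<in> A then v j w else 0) \<in> fun_space.span ((\<lambda>a x. if x = a then 1 else 0 :: 'a) ` A)" .
  next
    fix c assume 0: "(\<Sum>j<card I + 1. fscale (c j) (\<lambda>w. if w \<in> A then v j w else 0)) = 0"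
    have onA: "(\<Sum>j<card I + 1. c j * v j a) = 0" if "a \<in> A" for a
    proof -
      have "(\<Sum>j<card I + 1. c j * v j a)
          = (\<Sum>j<card I + 1. fscale (c j) (\<lambda>w. if w \<in> A then v j w else 0)) a"
        unfolding sum_fun_apply using that by (simp add: fscale_def)
      then show ?thesis unfolding 0 by simp
    qed
    have onW: "(\<Sum>j<card I + 1. c j * v j w) = 0" if w: "w \<in> W" for w
    proof -
      have "w \<in> fun_space.span A" using w A(3) by blast
      then obtain r where "w = (\<Sum>a\<in>A. fscale (r a) a)" using fun_space.span_finite[OF finA] by auto
      then have "(\<Sum>j<card I + 1. c j * v j w) = (\<Sum>j<card I + 1. \<Sum>a\<in>A. r a * (c j * v j a))"
        by (intro sum.cong refl)
          (simp add: functional_sum[OF v] functional_scale[OF v] sum_distrib_left mult_ac)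
      also have "\<dots> = (\<Sum>a\<in>A. r a * (\<Sum>j<card I + 1. c j * v j a))"
        by (subst sum.swap) (simp only: sum_distrib_left)
      also have "\<dots> = 0" using onA by (intro sum.neutral) auto
      finally show ?thesis .
    qed
    have eq: "c 0 * l0 w + (\<Sum>j<card I. c (Suc j) * l (h j) w) = 0" if "w \<in> W" for w
      using onW[OF that] unfolding Suc_eq_plus1[symmetric] sum.lessThan_Suc_shift by (simp add: v_def)
    have jt: "c 0 = 0 \<and> (\<Sum>j<card I. c (Suc j) * t (h j)) = 0" for t
    proof -
      have "jet (\<lambda>x. c 0 * l0 (\<phi> (\<lambda>i. x * t i)) + (\<Sum>j<card I. c (Suc j) * l (h j) (\<phi> (\<lambda>i. x * t i))))
         (c 0 * 1 + (\<Sum>j<card I. c (Suc j) * 0))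
         ((c 0 * 0 + 0 * 1) + (\<Sum>j<card I. c (Suc j) * t (h j) + 0 * 0))"
        by (intro jet_add jet_sum jet_mult jet_const j0 j) (use h in \<open>auto simp: bij_betw_def\<close>)
      moreover have "(\<lambda>x. c 0 * l0 (\<phi> (\<lambda>i. x * t i)) + (\<Sum>j<card I. c (Suc j) * l (h j) (\<phi> (\<lambda>i. x * t i)))) = (\<lambda>x. 0)"
        using eq W(1) by (intro ext) blast
      ultimately have "jet (\<lambda>x. 0) (c 0) (\<Sum>j<card I. c (Suc j) * t (h j))" by simp
      then obtain p where "\<And>x. 0 = poly p x" "coeff p 0 = c 0" "coeff p 1 = (\<Sum>j<card I. c (Suc j) * t (h j))"
        unfolding jet_def by metis
      then show ?thesis using poly_all_0_iff_0[of p] by auto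
    qed
    show "\<forall>j<card I + 1. c j = 0"
    proof (intro allI impI)
      fix j assume j: "j < card I + 1"
      show "c j = 0"
      proof (cases j)
        case 0
        then show ?thesis using jt by blast
      next
        case (Suc i)
        then have i: "i < card I" using j by simp
        have "(\<Sum>j<card I. c (Suc j) * (if h j = h i then 1 else 0)) = 0"
          using jt[of "\<lambda>x. if x = h i then 1 else 0"] by simp
        also have "(\<Sum>j<card I. c (Suc j) * (if h j = h i then 1 else 0)) = (\<Sum>j<card I. if j = i then c (Suc j) else 0)"
          using h i by (intro sum.cong refl) (auto simp: bij_betw_def inj_on_def)
        finally show ?thesis using i Suc by simp
      qed
    qed
  qed
  also have "\<dots> \<le> card A" by (rule card_image_le[OF finA])
  finally show ?thesis using A(4) by simp
qed

section \<open>Wedge products\<close>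

text \<open>
  In characteristic zero the field is infinite, so that polynomials are determined by their values.
\<close>

locale char0_space = vector_space scale
  for scale :: "'a::field_char_0 \<Rightarrow> 'v::ab_group_add \<Rightarrow> 'v"
begin

sublocale form: vector_space_pair scale "(*) :: 'a \<Rightarrow> 'a \<Rightarrow> 'a"
  by (intro vector_space_pair.intro vector_space_axioms vector_space_mult)

sublocale wed: vector_space_pair scale "fscale :: 'a \<Rightarrow> (('v list \<Rightarrow> 'a) \<Rightarrow> 'a) \<Rightarrow> ('v list \<Rightarrow> 'a) \<Rightarrow> 'a"
  by (intro vector_space_pair.intro vector_space_axioms vector_space_fscale)

lemma wedge_linear:
  "length xs + length ys + 1 = k \<Longrightarrow>
    Vector_Spaces.linear scale fscale (\<lambda>x. wedge scale k (xs @ x # ys))"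
  using alternating_wedge[OF vector_space_axioms, of k] unfolding alternating_def by blast

lemma wedge_add:
  "length xs + length ys + 1 = k \<Longrightarrow>
    wedge scale k (xs @ (x + y) # ys) = wedge scale k (xs @ x # ys) + wedge scale k (xs @ y # ys)"
  by (rule wed.linear_add[OF wedge_linear])

lemma wedge_scale:
  "length xs + length ys + 1 = k \<Longrightarrow>
    wedge scale k (xs @ scale c x # ys) = fscale c (wedge scale k (xs @ x # ys))"
  by (rule wed.linear_scale[OF wedge_linear])

lemma wedge_sum:
  "length xs + length ys + 1 = k \<Longrightarrow>
    wedge scale k (xs @ (\<Sum>i\<in>A. f i) # ys) = (\<Sum>i\<in>A. wedge scale k (xs @ f i # ys))"
  by (rule wed.linear_sum[OF wedge_linear])

lemma wedge_zero: "length xs + length ys + 1 = k \<Longrightarrow> wedge scale k (xs @ 0 # ys) = 0"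
  by (rule wed.linear_0[OF wedge_linear])

lemma wedge_not_distinct: "length vs = k \<Longrightarrow> \<not> distinct vs \<Longrightarrow> wedge scale k vs = 0"
  using alternating_wedge[OF vector_space_axioms, of k] unfolding alternating_def by blast

lemma wedge_swap:
  assumes "length xs + length ys + length zs + 2 = k"
  shows "wedge scale k (xs @ x # ys @ y # zs) = - wedge scale k (xs @ y # ys @ x # zs)"
proof -
  let ?w = "\<lambda>a b. wedge scale k (xs @ a # ys @ b # zs)"
  have rep: "?w a a = 0" for a using assms by (intro wedge_not_distinct) auto
  have add1: "?w (a + b) c = ?w a c + ?w b c" for a b c
    using assms by (intro wedge_add) simp
  have add2: "?w c (a + b) = ?w c a + ?w c b" for a b c
    using wedge_add[of "xs @ c # ys" zs k a b] assms by simp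
  have "0 = ?w (x + y) (x + y)" by (simp only: rep)
  also have "\<dots> = ?w x (x + y) + ?w y (x + y)" by (rule add1)
  also have "\<dots> = (?w x x + ?w x y) + (?w y x + ?w y y)" by (simp only: add2)
  also have "\<dots> = ?w x y + ?w y x" by (simp only: rep add_0_left add_0_right)
  finally have "?w x y + ?w y x = 0" by (rule sym)
  then show ?thesis by (rule eq_neg_iff_add_eq_0[THEN iffD2])
qed

lemma wedge_move:
  "length (ps @ as @ u # bs) = k \<Longrightarrow>
    wedge scale k (ps @ as @ u # bs) \<in> {wedge scale k (ps @ u # as @ bs), - wedge scale k (ps @ u # as @ bs)}"
proof (induction as arbitrary: ps)
  case (Cons a as)
  have "wedge scale k ((ps @ [a]) @ as @ u # bs)
      \<in> {wedge scale k ((ps @ [a]) @ u # as @ bs), - wedge scale k ((ps @ [a]) @ u # as @ bs)}"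
    using Cons.prems by (intro Cons.IH) simp
  moreover have "wedge scale k (ps @ a # [] @ u # as @ bs) = - wedge scale k (ps @ u # [] @ a # as @ bs)"
    using Cons.prems by (intro wedge_swap) simp
  ultimately show ?case by auto
qed simp

lemma wedge_permute:
  "mset vs = mset us \<Longrightarrow> length (ps @ us) = k \<Longrightarrow>
    wedge scale k (ps @ vs) \<in> {wedge scale k (ps @ us), - wedge scale k (ps @ us)}"
proof (induction us arbitrary: vs ps)
  case (Cons u us)
  then have "u \<in> set vs" by (metis list.set_intros(1) set_mset_mset)
  then obtain as bs where vs: "vs = as @ u # bs" by (meson split_list)
  then have ms: "mset (as @ bs) = mset us" using Cons.prems(1) by simp
  have len: "length (as @ bs) = length us" using ms by (metis size_mset)
  have "wedge scale k (ps @ vs) \<in> {wedge scale k (ps @ u # as @ bs), - wedge scale k (ps @ u # as @ bs)}"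
    unfolding vs using Cons.prems(2) len by (intro wedge_move) simp
  moreover have "wedge scale k ((ps @ [u]) @ as @ bs)
      \<in> {wedge scale k ((ps @ [u]) @ us), - wedge scale k ((ps @ [u]) @ us)}"
    using Cons.prems(2) by (intro Cons.IH[OF ms]) simp
  ultimately show ?case by auto
qed simp

lemma wedge_expand:
  "set vs \<subseteq> span S \<Longrightarrow> length (ps @ vs) = k \<Longrightarrow>
    wedge scale k (ps @ vs) \<in>
      fun_space.span {wedge scale k (ps @ ws) | ws. length ws = length vs \<and> set ws \<subseteq> S}"
proof (induction vs arbitrary: ps)
  case Nil
  then show ?case by (intro fun_space.span_base) auto
next
  case (Cons v vs)
  let ?G = "{wedge scale k (ps @ ws) | ws. length ws = length (v # vs) \<and> set ws \<subseteq> S}"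
  have lin: "Vector_Spaces.linear scale fscale (\<lambda>x. wedge scale k (ps @ x # vs))"
    using Cons.prems by (intro wedge_linear) simp
  have "wedge scale k (ps @ v # vs) \<in> (\<lambda>x. wedge scale k (ps @ x # vs)) ` span S"
    using Cons.prems by auto
  also have "\<dots> = fun_space.span ((\<lambda>x. wedge scale k (ps @ x # vs)) ` S)"
    by (rule wed.linear_span_image[OF lin, symmetric])
  also have "\<dots> \<subseteq> fun_space.span ?G"
  proof (rule fun_space.span_minimal[OF _ fun_space.subspace_span], clarify)
    fix x assume x: "x \<in> S"
    have "wedge scale k ((ps @ [x]) @ vs)
        \<in> fun_space.span {wedge scale k ((ps @ [x]) @ ws) | ws. length ws = length vs \<and> set ws \<subseteq> S}"
      using Cons.prems by (intro Cons.IH) auto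
    also have "\<dots> \<subseteq> fun_space.span ?G"
    proof (rule fun_space.span_mono, clarify)
      fix ws assume ws: "length ws = length vs" "set ws \<subseteq> S"
      show "\<exists>ws'. wedge scale k ((ps @ [x]) @ ws) = wedge scale k (ps @ ws') \<and>
          length ws' = length (v # vs) \<and> set ws' \<subseteq> S"
        using ws x by (intro exI[of _ "x # ws"]) auto
    qed
    finally show "wedge scale k (ps @ x # vs) \<in> fun_space.span ?G" by simp
  qed
  finally show ?case .
qed

text \<open>
  After expansion by multilinearity only the rearrangements of \<open>us\<close> survive.  This is why the wedge
  product of a basis of a subspace depends on the subspace only, up to a scalar.
\<close>

lemma wedge_in_span:
  assumes "length us = k" "length vs = k" "set vs \<subseteq> span (set us)"
  shows "wedge scale k vs \<in> fun_space.span {wedge scale k us}"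
proof -
  have "wedge scale k ([] @ vs) \<in>
      fun_space.span {wedge scale k ([] @ ws) | ws. length ws = length vs \<and> set ws \<subseteq> set us}"
    using assms by (intro wedge_expand) simp_all
  also have "\<dots> \<subseteq> fun_space.span {wedge scale k us}"
  proof (rule fun_space.span_minimal[OF _ fun_space.subspace_span], clarify)
    fix ws assume ws: "length ws = length vs" "set ws \<subseteq> set us"
    have base: "wedge scale k us \<in> fun_space.span {wedge scale k us}" by (simp add: fun_space.span_base)
    show "wedge scale k ([] @ ws) \<in> fun_space.span {wedge scale k us}"
    proof (cases "distinct ws")
      case True
      then have c: "card (set ws) = k" using ws assms by (simp add: distinct_card)
      then have eq: "set ws = set us"
        using ws(2) card_length[of us] assms(1) by (intro card_seteq) auto
      then have "distinct us" using c assms(1) by (simp add: card_distinct)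
      then have "mset ws = mset us" using True eq by (simp add: set_eq_iff_mset_eq_distinct)
      then have "wedge scale k ([] @ ws) \<in> {wedge scale k ([] @ us), - wedge scale k ([] @ us)}"
        using assms(1) by (intro wedge_permute) simp_all
      then show ?thesis using base fun_space.span_neg[OF base] by auto
    next
      case False
      then have "wedge scale k ws = 0" using ws assms by (intro wedge_not_distinct) auto
      then show ?thesis by (simp add: fun_space.span_zero del: zero_fun_apply)
    qed
  qed
  finally show ?thesis by simp
qed

lemma wedge_nonzeroD:
  assumes "wedge scale k vs \<noteq> 0" "length vs = k"
  shows "distinct vs" "independent (set vs)"
proof -
  show d: "distinct vs" using wedge_not_distinct assms by blast
  show "independent (set vs)"
  proof
    assume "dependent (set vs)"
    then obtain v where v: "v \<in> set vs" "v \<in> span (set vs - {v})" unfolding dependent_def by blast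
    then obtain xs ys where vs: "vs = xs @ v # ys" by (meson split_list)
    have lin: "Vector_Spaces.linear scale fscale (\<lambda>x. wedge scale k (xs @ x # ys))"
      using assms(2) vs by (intro wedge_linear) simp
    have "(\<lambda>x. wedge scale k (xs @ x # ys)) v = 0"
    proof (rule wed.linear_eq_0_on_span[OF lin _ v(2)])
      fix x assume "x \<in> set vs - {v}"
      then show "wedge scale k (xs @ x # ys) = 0"
        using vs assms(2) by (intro wedge_not_distinct) auto
    qed
    then show False using assms(1) vs by simp
  qed
qed

section \<open>Determinantal forms\<close>

text \<open>
  The determinant of the matrix with entries \<open>c\<^sub>i (v\<^sub>j)\<close>.
\<close>

definition detform :: "('v \<Rightarrow> 'a) list \<Rightarrow> 'v list \<Rightarrow> 'a"
  where "detform cs vs =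
    (\<Sum>\<sigma> | \<sigma> permutes {..<length cs}. of_int (sign \<sigma>) * (\<Prod>j<length cs. (cs ! \<sigma> j) (vs ! j)))"

lemma alternating_detform:
  assumes "\<And>c. c \<in> set cs \<Longrightarrow> Vector_Spaces.linear scale (*) c"
  shows "alternating scale (*) (length cs) (detform cs)"
  unfolding alternating_def
proof (intro conjI allI impI)
  fix xs ys :: "'v list" assume len: "length xs + length ys + 1 = length cs"
  define n where "n = length cs"
  have n: "length xs < n" using len n_def by simp
  have prod: "(\<Prod>j<n. (cs ! \<sigma> j) ((xs @ x # ys) ! j))
      = (cs ! \<sigma> (length xs)) x * (\<Prod>j\<in>{..<n} - {length xs}. (cs ! \<sigma> j) ((xs @ 0 # ys) ! j))" for \<sigma> x
  proof -
    have "(\<Prod>j<n. (cs ! \<sigma> j) ((xs @ x # ys) ! j))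
        = (cs ! \<sigma> (length xs)) ((xs @ x # ys) ! length xs) *
          (\<Prod>j\<in>{..<n} - {length xs}. (cs ! \<sigma> j) ((xs @ x # ys) ! j))"
      using n by (intro prod.remove) auto
    also have "(\<Prod>j\<in>{..<n} - {length xs}. (cs ! \<sigma> j) ((xs @ x # ys) ! j))
        = (\<Prod>j\<in>{..<n} - {length xs}. (cs ! \<sigma> j) ((xs @ 0 # ys) ! j))"
      by (intro prod.cong refl) (auto simp: nth_append nth_Cons')
    finally show ?thesis by simp
  qed
  have lin: "Vector_Spaces.linear scale (*) (cs ! \<sigma> (length xs))" if "\<sigma> permutes {..<n}" for \<sigma>
    using assms permutes_in_image[OF that, of "length xs"] n by (simp add: n_def)
  show "Vector_Spaces.linear scale (*) (\<lambda>x. detform cs (xs @ x # ys))"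
    unfolding detform_def n_def[symmetric] prod
    unfolding Vector_Spaces.linear_iff
  proof (intro conjI allI vector_space_axioms vector_space_mult)
    fix x y
    show "(\<Sum>\<sigma> | \<sigma> permutes {..<n}. of_int (sign \<sigma>) * ((cs ! \<sigma> (length xs)) (x + y) *
        (\<Prod>j\<in>{..<n} - {length xs}. (cs ! \<sigma> j) ((xs @ 0 # ys) ! j)))) =
      (\<Sum>\<sigma> | \<sigma> permutes {..<n}. of_int (sign \<sigma>) * ((cs ! \<sigma> (length xs)) x *
        (\<Prod>j\<in>{..<n} - {length xs}. (cs ! \<sigma> j) ((xs @ 0 # ys) ! j)))) +
      (\<Sum>\<sigma> | \<sigma> permutes {..<n}. of_int (sign \<sigma>) * ((cs ! \<sigma> (length xs)) y *
        (\<Prod>j\<in>{..<n} - {length xs}. (cs ! \<sigma> j) ((xs @ 0 # ys) ! j))))"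
      unfolding sum.distrib[symmetric]
      by (intro sum.cong refl) (simp add: form.linear_add[OF lin] distrib_left distrib_right)
  next
    fix a x
    show "(\<Sum>\<sigma> | \<sigma> permutes {..<n}. of_int (sign \<sigma>) * ((cs ! \<sigma> (length xs)) (scale a x) *
        (\<Prod>j\<in>{..<n} - {length xs}. (cs ! \<sigma> j) ((xs @ 0 # ys) ! j)))) =
      a * (\<Sum>\<sigma> | \<sigma> permutes {..<n}. of_int (sign \<sigma>) * ((cs ! \<sigma> (length xs)) x *
        (\<Prod>j\<in>{..<n} - {length xs}. (cs ! \<sigma> j) ((xs @ 0 # ys) ! j))))"
      unfolding sum_distrib_left
      by (intro sum.cong refl) (simp add: form.linear_scale[OF lin])
  qed
next
  fix vs :: "'v list" assume vs: "length vs = length cs \<and> \<not> distinct vs"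
  define n where "n = length cs"
  obtain a b where ab: "a < n" "b < n" "a \<noteq> b" "vs ! a = vs ! b"
    using vs by (auto simp: distinct_conv_nth n_def)
  let ?\<tau> = "Transposition.transpose a b"
  let ?P = "{\<sigma>. \<sigma> permutes {..<n}}"
  have \<tau>: "?\<tau> permutes {..<n}" using ab by (intro permutes_swap_id) auto
  have "detform cs vs = (\<Sum>\<sigma>\<in>?P. of_int (sign (\<sigma> \<circ> ?\<tau>)) * (\<Prod>j<n. (cs ! (\<sigma> \<circ> ?\<tau>) j) (vs ! j)))"
    unfolding detform_def n_def[symmetric] by (rule sum_permutations_compose_right[OF \<tau>])
  also have "\<dots> = (\<Sum>\<sigma>\<in>?P. - (of_int (sign \<sigma>) * (\<Prod>j<n. (cs ! \<sigma> j) (vs ! j))))"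
  proof (intro sum.cong refl)
    fix \<sigma> assume "\<sigma> \<in> ?P"
    then have \<sigma>: "\<sigma> permutes {..<n}" by simp
    have "sign (\<sigma> \<circ> ?\<tau>) = sign \<sigma> * sign ?\<tau>"
      by (intro sign_compose permutation_swap_id) (use \<sigma> permutation_permutes in blast)
    then have sgn: "sign (\<sigma> \<circ> ?\<tau>) = - sign \<sigma>" using ab(3) by (simp add: sign_swap_id)
    have vs\<tau>: "vs ! ?\<tau> j = vs ! j" for j
      using ab(4) by (cases "j = a"; cases "j = b") auto
    have "(\<Prod>j<n. (cs ! \<sigma> j) (vs ! j)) = (\<Prod>j<n. ((\<lambda>j. (cs ! \<sigma> j) (vs ! j)) \<circ> ?\<tau>) j)"
      by (rule prod.permute[OF \<tau>])
    also have "\<dots> = (\<Prod>j<n. (cs ! (\<sigma> \<circ> ?\<tau>) j) (vs ! j))"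
      by (simp add: vs\<tau>)
    finally show "of_int (sign (\<sigma> \<circ> ?\<tau>)) * (\<Prod>j<n. (cs ! (\<sigma> \<circ> ?\<tau>) j) (vs ! j))
        = - (of_int (sign \<sigma>) * (\<Prod>j<n. (cs ! \<sigma> j) (vs ! j)))"
      by (simp add: sgn)
  qed
  also have "\<dots> = - detform cs vs" unfolding detform_def n_def[symmetric] by (rule sum_negf)
  finally have "2 * detform cs vs = 0" unfolding mult_2 by (simp only: eq_neg_iff_add_eq_0)
  then show "detform cs vs = 0" by simp
qed

lemma detform_dual:
  assumes "\<And>i j. i < length cs \<Longrightarrow> j < length cs \<Longrightarrow> (cs ! i) (vs ! j) = (if i = j then 1 else 0)"
  shows "detform cs vs = 1"
proof -
  let ?n = "length cs"
  have "detform cs vs = (\<Sum>\<sigma> | \<sigma> permutes {..<?n}. if \<sigma> = id then 1 else 0)"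
    unfolding detform_def
  proof (intro sum.cong refl)
    fix \<sigma> assume "\<sigma> \<in> {\<sigma>. \<sigma> permutes {..<?n}}"
    then have \<sigma>: "\<sigma> permutes {..<?n}" by simp
    have prod: "(\<Prod>j<?n. (cs ! \<sigma> j) (vs ! j)) = (\<Prod>j<?n. if \<sigma> j = j then 1 else 0)"
      using permutes_in_image[OF \<sigma>] assms by (intro prod.cong refl) simp
    show "of_int (sign \<sigma>) * (\<Prod>j<?n. (cs ! \<sigma> j) (vs ! j)) = (if \<sigma> = id then 1 else 0)"
    proof (cases "\<sigma> = id")
      case False
      then obtain j where j: "\<sigma> j \<noteq> j" by (auto simp: fun_eq_iff)
      then have "j < ?n" using permutes_not_in[OF \<sigma>, of j] by auto
      then have "(\<Prod>j<?n. if \<sigma> j = j then 1 else 0 :: 'a) = 0" using j by (intro prod_zero) auto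
      then show ?thesis using False prod by simp
    next
      case True
      show ?thesis unfolding True using prod[unfolded True] by (simp add: sign_id)
    qed
  qed
  also have "\<dots> = 1" by (simp add: finite_permutations permutes_id)
  finally show ?thesis .
qed

lemma detform_zero_column:
  assumes "j < length cs" "\<And>i. i < length cs \<Longrightarrow> (cs ! i) (vs ! j) = 0"
  shows "detform cs vs = 0"
  unfolding detform_def
proof (intro sum.neutral ballI)
  fix \<sigma> assume "\<sigma> \<in> {\<sigma>. \<sigma> permutes {..<length cs}}"
  then have "\<sigma> j < length cs" using permutes_in_image[of \<sigma> "{..<length cs}" j] assms(1) by simp
  then have "(\<Prod>j<length cs. (cs ! \<sigma> j) (vs ! j)) = 0"
    using assms by (intro prod_zero) auto
  then show "of_int (sign \<sigma>) * (\<Prod>j<length cs. (cs ! \<sigma> j) (vs ! j)) = 0" by simp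
qed

text \<open>
  Elements of the exterior power are functions on alternating forms, so Plucker coordinates are
  evaluations at determinants.
\<close>

definition eval_form :: "('v \<Rightarrow> 'a) list \<Rightarrow> (('v list \<Rightarrow> 'a) \<Rightarrow> 'a) \<Rightarrow> 'a"
  where "eval_form cs T = T (detform cs)"

lemma linear_eval_form: "Vector_Spaces.linear fscale (*) (eval_form cs)"
  unfolding eval_form_def by (rule linear_evaluation)

lemma eval_form_wedge:
  assumes "\<And>c. c \<in> set cs \<Longrightarrow> Vector_Spaces.linear scale (*) c" "length cs = k"
  shows "eval_form cs (wedge scale k vs) = detform cs vs"
  using alternating_detform[of cs, OF assms(1)] assms(2) by (simp add: eval_form_def wedge_def)

text \<open>
  Functionals dual to \<open>vs\<close> give a determinant with value \<open>1\<close>.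
\<close>

lemma wedge_nonzeroI:
  assumes "distinct vs" "independent (set vs)" "length vs = k"
  shows "wedge scale k vs \<noteq> 0"
proof
  assume 0: "wedge scale k vs = 0"
  have "\<forall>i. \<exists>c. Vector_Spaces.linear scale (*) c \<and> (\<forall>v\<in>set vs. c v = (if v = vs ! i then 1 else 0 :: 'a))"
  proof
    fix i
    show "\<exists>c. Vector_Spaces.linear scale (*) c \<and> (\<forall>v\<in>set vs. c v = (if v = vs ! i then 1 else 0 :: 'a))"
      using form.linear_independent_extend[OF assms(2), of "\<lambda>v. if v = vs ! i then 1 else 0"] by blast
  qed
  then obtain c where c: "\<And>i. Vector_Spaces.linear scale (*) (c i)"
    "\<And>i v. v \<in> set vs \<Longrightarrow> c i v = (if v = vs ! i then 1 else 0 :: 'a)" by metis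
  define cs where "cs = map c [0..<k]"
  have "detform cs vs = 1"
    using assms by (intro detform_dual) (auto simp: cs_def c(2) nth_eq_iff_index_eq)
  moreover have "detform cs vs = eval_form cs (wedge scale k vs)"
    by (rule eval_form_wedge[symmetric]) (auto simp: cs_def c(1))
  ultimately show False unfolding 0 by (simp add: eval_form_def)
qed

section \<open>Sums of decomposable vectors\<close>

definition decomposable :: "nat \<Rightarrow> (('v list \<Rightarrow> 'a) \<Rightarrow> 'a) set"
  where "decomposable k = {wedge scale k vs | vs. length vs = k}"

text \<open>
  For \<open>k \<ge> 1\<close>, where \<open>0\<close> and the multiples of decomposable vectors are decomposable, this is the
  affine cone over the union of the linear spaces spanned by at most \<open>s\<close> points of the Grassmannian.
\<close>

definition wedge_sums :: "nat \<Rightarrow> nat \<Rightarrow> (('v list \<Rightarrow> 'a) \<Rightarrow> 'a) set"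
  where "wedge_sums k s = {\<Sum>i<s. f i | f. \<forall>i<s. f i \<in> decomposable k}"

lemma decomposable_scale:
  assumes "1 \<le> k" "T \<in> decomposable k" shows "fscale c T \<in> decomposable k"
proof -
  obtain vs where vs: "T = wedge scale k vs" "length vs = k" using assms(2) by (auto simp: decomposable_def)
  then obtain x ys where xy: "vs = x # ys" using assms(1) by (cases vs) auto
  have "fscale c T = wedge scale k ([] @ scale c x # ys)"
    using wedge_scale[of "[]" ys k c x] vs xy by simp
  then show ?thesis unfolding decomposable_def using vs(2) xy by (intro CollectI exI[of _ "scale c x # ys"]) simp
qed

lemma decomposable_0: "1 \<le> k \<Longrightarrow> 0 \<in> decomposable k"
  using wedge_zero[of "[]" "replicate (k - 1) 0" k] unfolding decomposable_def
  by (intro CollectI exI[of _ "0 # replicate (k - 1) 0"]) simp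

lemma wedge_sums_sum:
  assumes "finite A" "card A = s" "\<And>a. a \<in> A \<Longrightarrow> f a \<in> decomposable k"
  shows "(\<Sum>a\<in>A. f a) \<in> wedge_sums k s"
proof -
  obtain h where h: "bij_betw h {..<s} A"
    using ex_bij_betw_nat_finite[OF assms(1)] assms(2) unfolding lessThan_atLeast0[symmetric] by blast
  have "(\<Sum>a\<in>A. f a) = (\<Sum>i<s. f (h i))" by (rule sum.reindex_bij_betw[OF h, symmetric])
  moreover have "\<forall>i<s. f (h i) \<in> decomposable k" using h assms(3) by (auto simp: bij_betw_def)
  ultimately show ?thesis unfolding wedge_sums_def by (intro CollectI exI[of _ "\<lambda>i. f (h i)"] conjI)
qed

lemma wedge_sums_mono:
  assumes "1 \<le> k" "r \<le> s" shows "wedge_sums k r \<subseteq> wedge_sums k s"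
proof
  fix T assume "T \<in> wedge_sums k r"
  then obtain f where f: "T = (\<Sum>i<r. f i)" "\<And>i. i < r \<Longrightarrow> f i \<in> decomposable k"
    unfolding wedge_sums_def by blast
  have "T = (\<Sum>i<s. if i \<in> {..<r} then f i else 0)"
    unfolding f(1) by (rule sum.mono_neutral_cong_left) (use assms in auto)
  moreover have "\<forall>i<s. (if i \<in> {..<r} then f i else 0) \<in> decomposable k"
    using f(2) decomposable_0[OF assms(1)] by auto
  ultimately show "T \<in> wedge_sums k s" unfolding wedge_sums_def by blast
qed

lemma decomposable_in_exterior_power: "decomposable k \<subseteq> exterior_power scale k"
proof
  fix T assume "T \<in> decomposable k"
  then have "T \<in> wedge scale k ` {vs. length vs = k}" unfolding decomposable_def by blast
  then show "T \<in> exterior_power scale k" unfolding exterior_power_def by (rule fun_space.span_base)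
qed

lemma wedge_sums_in_exterior_power: "wedge_sums k s \<subseteq> exterior_power scale k"
proof
  fix T assume "T \<in> wedge_sums k s"
  then obtain f where f: "T = (\<Sum>i<s. f i)" "\<And>i. i < s \<Longrightarrow> f i \<in> decomposable k"
    unfolding wedge_sums_def by blast
  then have "f i \<in> exterior_power scale k" if "i < s" for i
    using decomposable_in_exterior_power that by blast
  then show "T \<in> exterior_power scale k"
    unfolding f(1) exterior_power_def by (intro fun_space.span_sum) auto
qed

lemma wedge_sums_1: "wedge_sums k 1 = decomposable k"
  unfolding wedge_sums_def
proof safe
  fix T assume T: "T \<in> decomposable k"
  show "\<exists>f. T = (\<Sum>i<1::nat. f i) \<and> (\<forall>i<1. f i \<in> decomposable k)"
  proof (intro exI conjI)
    show "T = (\<Sum>i<1::nat. T)"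
      by (simp only: One_nat_def sum.lessThan_Suc lessThan_0 sum.empty add_0_left)
  qed (use T in simp)
qed simp

section \<open>Plucker images and secants\<close>

lemma plucker_eq:
  assumes "length vs = k" "wedge scale k vs \<noteq> 0"
  shows "plucker scale k (span (set vs)) = fun_space.span {wedge scale k vs}"
  unfolding plucker_def
proof (rule antisym)
  show "fun_space.span {wedge scale k ws | ws. length ws = k \<and> span (set ws) = span (set vs)}
      \<subseteq> fun_space.span {wedge scale k vs}"
  proof (rule fun_space.span_minimal[OF _ fun_space.subspace_span], rule subsetI)
    fix T assume "T \<in> {wedge scale k ws | ws. length ws = k \<and> span (set ws) = span (set vs)}"
    then obtain ws where T: "T = wedge scale k ws" and "length ws = k" "span (set ws) = span (set vs)"
      by blast
    then show "T \<in> fun_space.span {wedge scale k vs}"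
      unfolding T using span_superset[of "set ws"] assms(1) by (intro wedge_in_span) auto
  qed
  show "fun_space.span {wedge scale k vs}
      \<subseteq> fun_space.span {wedge scale k ws | ws. length ws = k \<and> span (set ws) = span (set vs)}"
    using assms(1) by (intro fun_space.span_mono) auto
qed

lemma plucker_grassmannian:
  assumes "1 \<le> k"
  shows "plucker scale k ` grassmannian scale k = proj_space fscale (decomposable k)"
proof
  show "plucker scale k ` grassmannian scale k \<subseteq> proj_space fscale (decomposable k)"
  proof
    fix L assume "L \<in> plucker scale k ` grassmannian scale k"
    then obtain U where U: "L = plucker scale k U" "subspace U" "dim U = k"
      unfolding grassmannian_def by blast
    obtain B where B: "B \<subseteq> U" "independent B" "U \<subseteq> span B" "card B = k"
      using basis_exists[of U] U(3) by metis
    have "finite B" using B(4) assms by (intro card_ge_0_finite) simp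
    then obtain vs where vs: "set vs = B" "distinct vs" using finite_distinct_list by blast
    have len: "length vs = k" using vs B(4) distinct_card by fastforce
    have nz: "wedge scale k vs \<noteq> 0" using vs B(2) len by (intro wedge_nonzeroI) auto
    have "span (set vs) = U" using vs(1) B U(2) span_minimal by blast
    then have "L = fun_space.span {wedge scale k vs}" using U(1) plucker_eq[OF len nz] by simp
    then show "L \<in> proj_space fscale (decomposable k)"
      using nz len unfolding proj_space_def decomposable_def by blast
  qed
  show "proj_space fscale (decomposable k) \<subseteq> plucker scale k ` grassmannian scale k"
  proof
    fix L assume "L \<in> proj_space fscale (decomposable k)"
    then obtain vs where vs: "L = fun_space.span {wedge scale k vs}" "length vs = k" "wedge scale k vs \<noteq> 0"
      unfolding proj_space_def decomposable_def by blast
    have "dim (span (set vs)) = card (set vs)"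
      using wedge_nonzeroD[OF vs(3,2)] by (intro dim_span_eq_card_independent)
    also have "\<dots> = k" using wedge_nonzeroD(1)[OF vs(3,2)] vs(2) by (simp add: distinct_card)
    finally have "span (set vs) \<in> grassmannian scale k" unfolding grassmannian_def by (simp add: subspace_span)
    then show "L \<in> plucker scale k ` grassmannian scale k"
      using plucker_eq[OF vs(2,3)] vs(1) by blast
  qed
qed

text \<open>
  The nonzero summands of a vector may be proportional to each other, so that they give less than \<open>s\<close>
  points; the points of \<open>Q\<close> fill up their set to exactly \<open>s\<close> elements.
\<close>

lemma secant_points:
  assumes k: "1 \<le> k" and Q: "Q \<subseteq> proj_space fscale (decomposable k)" "finite Q" "card Q = s"
  shows "(\<Union>P\<in>{P. P \<subseteq> proj_space fscale (decomposable k) \<and> finite P \<and> card P = s}.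
      {L \<in> proj_space fscale (exterior_power scale k). L \<subseteq> fun_space.span (\<Union>P)})
    = proj_space fscale (wedge_sums k s)" (is "?L = ?R")
proof
  show "?L \<subseteq> ?R"
  proof
    fix L assume "L \<in> ?L"
    then obtain P where P: "P \<subseteq> proj_space fscale (decomposable k)" "finite P" "card P = s"
      and L: "L \<in> proj_space fscale (exterior_power scale k)" "L \<subseteq> fun_space.span (\<Union>P)" by blast
    obtain T where T: "L = fun_space.span {T}" "T \<noteq> 0" using L(1) unfolding proj_space_def by blast
    have "\<forall>p\<in>P. \<exists>v. v \<in> decomposable k \<and> p = fun_space.span {v}"
      using P(1) unfolding proj_space_def by blast
    then obtain v where v: "\<And>p. p \<in> P \<Longrightarrow> v p \<in> decomposable k" "\<And>p. p \<in> P \<Longrightarrow> p = fun_space.span {v p}"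
      by metis
    have inj: "inj_on v P" using v(2) by (intro inj_onI) metis
    have "T \<in> fun_space.span (\<Union>P)" using L(2) T(1) fun_space.span_base[of T "{T}"] by blast
    also have "\<dots> \<subseteq> fun_space.span (v ` P)"
    proof (rule fun_space.span_minimal[OF _ fun_space.subspace_span], clarify)
      fix w p assume "w \<in> p" "p \<in> P"
      then have "w \<in> fun_space.span {v p}" using v(2) by blast
      then show "w \<in> fun_space.span (v ` P)" using fun_space.span_mono[of "{v p}" "v ` P"] \<open>p \<in> P\<close> by blast
    qed
    finally obtain r where "T = (\<Sum>w\<in>v ` P. fscale (r w) w)"
      using fun_space.span_finite[of "v ` P"] P(2) by auto
    then have "T = (\<Sum>p\<in>P. fscale (r (v p)) (v p))" by (simp add: sum.reindex[OF inj])
    moreover have "(\<Sum>p\<in>P. fscale (r (v p)) (v p)) \<in> wedge_sums k s"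
      using v(1) decomposable_scale[OF k] by (intro wedge_sums_sum P(2,3)) blast
    ultimately show "L \<in> ?R" unfolding proj_space_def using T by blast
  qed
  show "?R \<subseteq> ?L"
  proof
    fix L assume "L \<in> ?R"
    then obtain f where f: "L = fun_space.span {\<Sum>i<s. f i}" "(\<Sum>i<s. f i) \<noteq> 0"
        "\<And>i. i < s \<Longrightarrow> f i \<in> decomposable k"
      unfolding proj_space_def wedge_sums_def by blast
    define P0 where "P0 = (\<lambda>i. fun_space.span {f i}) ` {i. i < s \<and> f i \<noteq> 0}"
    have P0: "P0 \<subseteq> proj_space fscale (decomposable k)"
      unfolding P0_def proj_space_def using f(3) by blast
    have finP0: "finite P0" unfolding P0_def by simp
    have "card P0 \<le> card {i. i < s \<and> f i \<noteq> 0}" unfolding P0_def by (rule card_image_le) simp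
    also have "\<dots> \<le> card {..<s}" by (intro card_mono) auto
    finally have "card P0 \<le> s" by simp
    moreover have "s \<le> card (P0 \<union> Q)" using Q finP0 by (metis card_mono finite_UnI sup_ge2)
    ultimately obtain P where P: "P0 \<subseteq> P" "P \<subseteq> P0 \<union> Q" "card P = s"
      using exists_subset_between[of P0 s "P0 \<union> Q"] finP0 Q(2) by auto
    have "f i \<in> fun_space.span (\<Union>P)" if "i < s" for i
    proof (cases "f i = 0")
      case False
      then have "fun_space.span {f i} \<in> P" using P(1) that unfolding P0_def by blast
      then have "f i \<in> \<Union>P" using fun_space.span_base[of "f i" "{f i}"] by blast
      then show ?thesis by (rule fun_space.span_base)
    qed (simp only: fun_space.span_zero)
    then have "(\<Sum>i<s. f i) \<in> fun_space.span (\<Union>P)" by (intro fun_space.span_sum) auto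
    then have "L \<subseteq> fun_space.span (\<Union>P)"
      unfolding f(1) by (intro fun_space.span_minimal fun_space.subspace_span) simp
    moreover have "(\<Sum>i<s. f i) \<in> exterior_power scale k"
      using wedge_sums_in_exterior_power[of k s] f(3) unfolding wedge_sums_def by blast
    then have "L \<in> proj_space fscale (exterior_power scale k)"
      unfolding proj_space_def using f(1,2) by blast
    moreover have "finite P" using P(2) finP0 Q(2) by (meson finite_UnI finite_subset)
    moreover have "P \<subseteq> proj_space fscale (decomposable k)" using P(2) P0 Q(1) by blast
    ultimately show "L \<in> ?L" using P(3) by blast
  qed
qed

lemma exterior_power_finite_span:
  assumes "finite E" "span E = UNIV"
  shows "\<exists>B. finite B \<and> exterior_power scale k \<subseteq> fun_space.span B"
proof (intro exI conjI)
  let ?B = "wedge scale k ` {ws. set ws \<subseteq> E \<and> length ws = k}"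
  show "finite ?B" by (intro finite_imageI finite_lists_length_eq assms(1))
  show "exterior_power scale k \<subseteq> fun_space.span ?B"
    unfolding exterior_power_def
  proof (rule fun_space.span_minimal[OF _ fun_space.subspace_span], clarify)
    fix vs :: "'v list" assume k: "k = length vs"
    have "wedge scale k ([] @ vs)
        \<in> fun_space.span {wedge scale k ([] @ ws) | ws. length ws = length vs \<and> set ws \<subseteq> E}"
      by (rule wedge_expand) (auto simp: assms(2) k)
    also have "{wedge scale k ([] @ ws) | ws. length ws = length vs \<and> set ws \<subseteq> E} = ?B"
      using k by auto
    finally show "wedge scale (length vs) vs \<in> fun_space.span (wedge scale (length vs) ` {ws. set ws \<subseteq> E \<and> length ws = length vs})"
      by (simp add: k)
  qed
qed

end

section \<open>Bivectors\<close>

context char0_space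
begin

lemma wedge2_add_left: "wedge scale 2 [x + y, z] = wedge scale 2 [x, z] + wedge scale 2 [y, z]"
  using wedge_add[of "[]" "[z]" 2 x y] by simp

lemma wedge2_add_right: "wedge scale 2 [z, x + y] = wedge scale 2 [z, x] + wedge scale 2 [z, y]"
  using wedge_add[of "[z]" "[]" 2 x y] by simp

lemma wedge2_scale_left: "wedge scale 2 [scale c x, z] = fscale c (wedge scale 2 [x, z])"
  using wedge_scale[of "[]" "[z]" 2 c x] by simp

lemma wedge2_scale_right: "wedge scale 2 [z, scale c x] = fscale c (wedge scale 2 [z, x])"
  using wedge_scale[of "[z]" "[]" 2 c x] by simp

lemma wedge2_self: "wedge scale 2 [x, x] = 0"
  by (rule wedge_not_distinct) auto

lemma wedge2_swap: "wedge scale 2 [x, y] = - wedge scale 2 [y, x]"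
  using wedge_swap[of "[]" "[]" "[]" 2 x y] by simp

lemma wedge2_diff_left: "wedge scale 2 [x - y, z] = wedge scale 2 [x, z] - wedge scale 2 [y, z]"
  using wedge2_add_left[of "x - y" y z] by (simp add: algebra_simps del: plus_fun_apply)

definition bivectors :: "'v set \<Rightarrow> (('v list \<Rightarrow> 'a) \<Rightarrow> 'a) set"
  where "bivectors E = fun_space.span {wedge scale 2 [x, y] | x y. x \<in> span E \<and> y \<in> span E}"

lemma bivectors_mono: "span E \<subseteq> span F \<Longrightarrow> bivectors E \<subseteq> bivectors F"
  unfolding bivectors_def by (intro fun_space.span_mono) blast

lemma wedge2_in_bivectors: "x \<in> span E \<Longrightarrow> y \<in> span E \<Longrightarrow> wedge scale 2 [x, y] \<in> bivectors E"
  unfolding bivectors_def by (intro fun_space.span_base) blast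

text \<open>
  Collect the multiples of \<open>e\<close>: \<open>(\<alpha> e + a') \<and> (\<beta> e + b') = e \<and> (\<alpha> b' - \<beta> a') + a' \<and> b'\<close>.
\<close>

lemma bivectors_insert:
  assumes "T \<in> bivectors (insert e E)"
  shows "\<exists>u\<in>span E. \<exists>T'\<in>bivectors E. T = wedge scale 2 [e, u] + T'"
  using assms unfolding bivectors_def[of "insert e E"]
proof (induction rule: fun_space.span_induct_alt)
  case base
  have "wedge scale 2 [e, 0] = 0" using wedge_zero[of "[e]" "[]" 2] by simp
  moreover have "0 \<in> bivectors E" unfolding bivectors_def by (rule fun_space.span_zero)
  ultimately show ?case using span_zero by (intro bexI[of _ 0]) (simp_all del: zero_fun_apply)
next
  case (step c x y)
  then obtain u T' where u: "u \<in> span E" "T' \<in> bivectors E" "y = wedge scale 2 [e, u] + T'" by blast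
  obtain a b where ab: "x = wedge scale 2 [a, b]" "a \<in> span (insert e E)" "b \<in> span (insert e E)"
    using step(1) by blast
  obtain \<alpha> \<beta> where "a - scale \<alpha> e \<in> span E" "b - scale \<beta> e \<in> span E"
    using ab(2,3) unfolding span_breakdown_eq by blast
  then obtain a' b' where a': "a' \<in> span E" "b' \<in> span E" "a = scale \<alpha> e + a'" "b = scale \<beta> e + b'"
    by (metis add.commute diff_add_cancel)
  have flip: "wedge scale 2 [a', e] = - wedge scale 2 [e, a']" by (rule wedge2_swap)
  have "fscale c x + y = wedge scale 2 [e, scale c (scale \<alpha> b' + scale (- \<beta>) a') + u]
      + (fscale c (wedge scale 2 [a', b']) + T')"
  proof
    fix \<phi>
    have fs: "fscale r T \<phi> = r * T \<phi>" for r and T :: "('v list \<Rightarrow> 'a) \<Rightarrow> 'a" by (simp add: fscale_def)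
    show "(fscale c x + y) \<phi> = (wedge scale 2 [e, scale c (scale \<alpha> b' + scale (- \<beta>) a') + u]
      + (fscale c (wedge scale 2 [a', b']) + T')) \<phi>"
      unfolding ab(1) a'(3,4) u(3) wedge2_add_left wedge2_add_right wedge2_scale_left
        wedge2_scale_right wedge2_self flip plus_fun_apply fs uminus_apply zero_fun_apply
      by (simp only: algebra_simps) simp
  qed
  moreover have "scale c (scale \<alpha> b' + scale (- \<beta>) a') + u \<in> span E"
    using a' u by (intro span_add span_scale)
  moreover have "fscale c (wedge scale 2 [a', b']) + T' \<in> bivectors E"
    using wedge2_in_bivectors[OF a'(1,2)] u(2) unfolding bivectors_def
    by (intro fun_space.span_add fun_space.span_scale)
  ultimately show ?case by blast
qed

lemma exchange_basis_vector:
  assumes "finite E" "u \<in> span E" "u \<noteq> 0"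
  shows "\<exists>b\<in>E. span E \<subseteq> span (insert u (E - {b}))"
proof -
  \<comment> \<open>In a smallest subset whose span contains \<open>u\<close>, every vector can be exchanged for \<open>u\<close>.\<close>
  obtain F where F: "F \<subseteq> E" "u \<in> span F" and min: "\<And>G. G \<subseteq> E \<and> u \<in> span G \<Longrightarrow> card F \<le> card G"
    using ex_has_least_nat[of "\<lambda>F. F \<subseteq> E \<and> u \<in> span F" E card] assms(2) by blast
  have finF: "finite F" using F(1) assms(1) by (rule finite_subset)
  have "F \<noteq> {}" using F(2) assms(3) by auto
  then obtain b where b: "b \<in> F" by blast
  have "u \<notin> span (F - {b})"
  proof
    assume "u \<in> span (F - {b})"
    then have "card F \<le> card (F - {b})" using F(1) by (intro min) auto
    then show False using card_Diff1_less[OF finF b] by simp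
  qed
  then have "b \<in> span (insert u (F - {b}))" by (rule in_span_delete[OF F(2)])
  then have "b \<in> span (insert u (E - {b}))"
    using span_mono[of "insert u (F - {b})" "insert u (E - {b})"] F(1) by blast
  then have "E \<subseteq> span (insert u (E - {b}))" by (auto intro: span_base)
  then show ?thesis using span_minimal subspace_span b F(1) by blast
qed

lemma wedge_sums_add:
  assumes "D \<in> decomposable k" "T \<in> wedge_sums k s" shows "D + T \<in> wedge_sums k (Suc s)"
proof -
  obtain f where f: "T = (\<Sum>i<s. f i)" "\<And>i. i < s \<Longrightarrow> f i \<in> decomposable k"
    using assms(2) unfolding wedge_sums_def by blast
  have "(\<Sum>i<Suc s. (f(s := D)) i) = T + D" unfolding f(1) by simp
  moreover have "\<forall>i<Suc s. (f(s := D)) i \<in> decomposable k" using f(2) assms(1) by (auto simp: less_Suc_eq)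
  ultimately show ?thesis unfolding wedge_sums_def
    by (intro CollectI exI[of _ "f(s := D)"] conjI) (simp_all only: add.commute)
qed

text \<open>
  One decomposable summand eliminates two vectors from the spanning set.  Write \<open>T = e \<and> u + T'\<close>, where
  \<open>T'\<close> does not involve \<open>e\<close>; if \<open>u \<noteq> 0\<close>, exchange a spanning vector for \<open>u\<close> and write \<open>T' = u \<and> u' + T''\<close>.
  Then \<open>T = (e - u') \<and> u + T''\<close>.
\<close>

lemma bivectors_wedge_sums:
  assumes "finite E" shows "bivectors E \<subseteq> wedge_sums 2 (card E div 2)"
  using assms
proof (induction "card E" arbitrary: E rule: less_induct)
  case less
  show ?case
  proof
    fix T assume T: "T \<in> bivectors E"
    show "T \<in> wedge_sums 2 (card E div 2)"
    proof (cases "E = {}")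
      case True
      have "{wedge scale 2 [x, y] | x y. x \<in> span E \<and> y \<in> span E} \<subseteq> {0}"
        using True wedge2_self[of 0] by auto
      then have "T \<in> fun_space.span {0}" using T fun_space.span_mono unfolding bivectors_def by blast
      then have "T = 0" by (auto simp: fun_space.span_singleton)
      then show ?thesis using True by (auto simp: wedge_sums_def)
    next
      case False
      then obtain e E' where E: "E = insert e E'" "e \<notin> E'" by (meson mk_disjoint_insert equals0I)
      have finE': "finite E'" and cE: "card E = Suc (card E')" using E less.prems by auto
      obtain u T' where u: "u \<in> span E'" "T' \<in> bivectors E'" "T = wedge scale 2 [e, u] + T'"
        using bivectors_insert T unfolding E(1) by blast
      show ?thesis
      proof (cases "u = 0")
        case True
        have "wedge scale 2 [e, 0] = 0" using wedge_zero[of "[e]" "[]" 2] by simp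
        then have "T = T'" using u(3) True by (simp only: add_0_left)
        then have "T \<in> wedge_sums 2 (card E' div 2)" using less.hyps[of E'] finE' cE u(2) by auto
        then show ?thesis using wedge_sums_mono[of 2 "card E' div 2" "card E div 2"] cE
          by (auto simp: div_le_mono)
      next
        case False
        obtain b where b: "b \<in> E'" "span E' \<subseteq> span (insert u (E' - {b}))"
          using exchange_basis_vector[OF finE' u(1) False] by blast
        then have "T' \<in> bivectors (insert u (E' - {b}))" using u(2) bivectors_mono by blast
        then obtain u' T'' where u': "T'' \<in> bivectors (E' - {b})" "T' = wedge scale 2 [u, u'] + T''"
          using bivectors_insert by blast
        have c: "card E = Suc (Suc (card (E' - {b})))" using cE b(1) finE' by (metis card_Suc_Diff1)
        then have "T'' \<in> wedge_sums 2 (card (E' - {b}) div 2)"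
          using less.hyps[of "E' - {b}"] finE' u'(1) by auto
        then have "wedge scale 2 [e - u', u] + T'' \<in> wedge_sums 2 (Suc (card (E' - {b}) div 2))"
          by (rule wedge_sums_add[rotated]) (auto simp: decomposable_def intro!: exI[of _ "[e - u', u]"])
        moreover have "wedge scale 2 [e - u', u] + T'' = T"
          unfolding u(3) u'(2) wedge2_diff_left wedge2_swap[of u u']
          by (simp add: algebra_simps del: plus_fun_apply)
        ultimately show ?thesis using c by simp
      qed
    qed
  qed
qed

lemma exterior_square_wedge_sums:
  assumes "finite E" "span E = UNIV"
  shows "exterior_power scale 2 = wedge_sums 2 (card E div 2)"
proof
  have "exterior_power scale 2 \<subseteq> bivectors E"
    unfolding exterior_power_def bivectors_def
  proof (rule fun_space.span_mono, rule subsetI)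
    fix T assume "T \<in> wedge scale 2 ` {vs. length vs = 2}"
    then obtain vs where "T = wedge scale 2 vs" "length vs = 2" by blast
    then show "T \<in> {wedge scale 2 [x, y] | x y. x \<in> span E \<and> y \<in> span E}"
      using assms(2) by (auto simp: numeral_2_eq_2 length_Suc_conv)
  qed
  then show "exterior_power scale 2 \<subseteq> wedge_sums 2 (card E div 2)"
    using bivectors_wedge_sums[OF assms(1)] by blast
qed (rule wedge_sums_in_exterior_power)

end

section \<open>Coordinates\<close>

locale based_space = char0_space scale
  for scale :: "'a::field_char_0 \<Rightarrow> 'v::ab_group_add \<Rightarrow> 'v" +
  fixes e :: "nat \<Rightarrow> 'v" and cd :: "nat \<Rightarrow> 'v \<Rightarrow> 'a" and m :: nat
  assumes cd_linear: "i < m \<Longrightarrow> Vector_Spaces.linear scale (*) (cd i)"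
    and cd_e: "i < m \<Longrightarrow> j < m \<Longrightarrow> cd i (e j) = (if i = j then 1 else 0)"
    and expand: "v = (\<Sum>i<m. scale (cd i v) (e i))"
begin

lemma cd_add: "i < m \<Longrightarrow> cd i (v + w) = cd i v + cd i w"
  by (rule form.linear_add[OF cd_linear])

lemma cd_scale: "i < m \<Longrightarrow> cd i (scale c v) = c * cd i v"
  by (rule form.linear_scale[OF cd_linear])

lemma cd_sum: "i < m \<Longrightarrow> cd i (\<Sum>j\<in>A. f j) = (\<Sum>j\<in>A. cd i (f j))"
  by (rule form.linear_sum[OF cd_linear])

abbreviation coord :: "nat list \<Rightarrow> (('v list \<Rightarrow> 'a) \<Rightarrow> 'a) \<Rightarrow> 'a"
  where "coord J \<equiv> eval_form (map cd J)"

lemma coord_wedge: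
  assumes "set J \<subseteq> {..<m}" "length J = k"
  shows "coord J (wedge scale k vs) = detform (map cd J) vs"
  using assms by (intro eval_form_wedge) (auto intro: cd_linear)

lemma coord_wedge_dual:
  assumes "set J \<subseteq> {..<m}" "length J = k"
    and "\<And>i j. i < k \<Longrightarrow> j < k \<Longrightarrow> cd (J ! i) (vs ! j) = (if i = j then 1 else 0)"
  shows "coord J (wedge scale k vs) = 1"
  unfolding coord_wedge[OF assms(1,2)] using assms(2,3) by (intro detform_dual) simp

lemma coord_wedge_basis:
  assumes "set J \<subseteq> {..<m}" "length J = k" "distinct J"
  shows "coord J (wedge scale k (map e J)) = 1"
proof (rule coord_wedge_dual[OF assms(1,2)])
  fix i j assume "i < k" "j < k"
  moreover have "J ! i < m" "J ! j < m" using assms(1,2) calculation nth_mem by blast+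
  ultimately show "cd (J ! i) (map e J ! j) = (if i = j then 1 else 0)"
    using assms(2,3) by (simp add: cd_e nth_eq_iff_index_eq)
qed

lemma coord_wedge_other:
  assumes "set J \<subseteq> {..<m}" "length J = k" "set L \<subseteq> {..<m}" "length L = k" "x \<in> set L" "x \<notin> set J"
  shows "coord J (wedge scale k (map e L)) = 0"
proof -
  obtain j where j: "j < k" "L ! j = x" using assms(4,5) by (auto simp: in_set_conv_nth)
  have "(map cd J ! i) (map e L ! j) = 0" if "i < length (map cd J)" for i
  proof -
    have "J ! i \<in> set J" using that by simp
    then have "J ! i < m" "J ! i \<noteq> x" using assms(1,6) by auto
    moreover have "x < m" using assms(3,5) by blast
    ultimately show ?thesis using that j assms(2,4) by (simp add: cd_e)
  qed
  then show ?thesis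
    unfolding coord_wedge[OF assms(1,2)] using j assms(2) by (intro detform_zero_column[of j]) auto
qed

lemma independent_spans:
  assumes "independent A" "finite C" "card A = card C" "A \<subseteq> span C"
  shows "C \<subseteq> span A"
proof
  fix c assume c: "c \<in> C"
  show "c \<in> span A"
  proof (rule ccontr)
    assume not: "c \<notin> span A"
    have finA: "finite A" using independent_span_bound[OF assms(2,1,4)] by blast
    have "independent (insert c A)" using not assms(1) by (simp add: independent_insert)
    then have "card (insert c A) \<le> card C"
      using independent_span_bound[OF assms(2), of "insert c A"] assms(4) c span_base[of c C] by auto
    moreover have "c \<notin> A" using not span_base by blast
    ultimately show False using finA assms(3) by simp
  qed
qed

text \<open>
  If a minor of \<open>vs\<close> is nonzero, the projection to the corresponding coordinates is injective on the
  span of \<open>vs\<close>.  The preimages \<open>us\<close> of the basis vectors are a basis in reduced echelon form.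
\<close>

lemma chart_vectors:
  assumes B: "set B \<subseteq> {..<m}" "length B = r" "distinct B" and vs: "length vs = r"
    and nz: "detform (map cd B) vs \<noteq> 0"
  shows "\<exists>us. length us = r \<and> (\<forall>i<r. \<forall>j<r. cd (B ! i) (us ! j) = (if i = j then 1 else 0)) \<and>
    (\<forall>v\<in>set vs. v = (\<Sum>i<r. scale (cd (B ! i) v) (us ! i)))"
proof -
  have Bm: "B ! i < m" if "i < r" for i using that B(1,2) nth_mem by blast
  define \<pi> where "\<pi> v = (\<Sum>i<r. scale (cd (B ! i) v) (e (B ! i)))" for v
  have lin: "Vector_Spaces.linear scale scale \<pi>"
    unfolding Vector_Spaces.linear_iff \<pi>_def
    by (auto simp: vector_space_axioms cd_add[OF Bm] cd_scale[OF Bm] scale_left_distrib sum.distrib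
        scale_sum_right)
  have cd\<pi>: "cd (B ! i) (\<pi> v) = cd (B ! i) v" if i: "i < r" for i v
  proof -
    have "cd (B ! i) (\<pi> v) = (\<Sum>j<r. if j = i then cd (B ! j) v else 0)"
      unfolding \<pi>_def cd_sum[OF Bm[OF i]]
      by (intro sum.cong refl) (use i B in \<open>simp add: cd_scale[OF Bm[OF i]] cd_e Bm nth_eq_iff_index_eq\<close>)
    then show ?thesis using i by simp
  qed
  \<comment> \<open>The determinant sees only the projections, which are therefore independent.\<close>
  have coord_eq: "detform (map cd B) (map \<pi> vs) = detform (map cd B) vs"
    unfolding detform_def
  proof (intro sum.cong refl, rule arg_cong[where f = "(*) _"], rule prod.cong[OF refl])
    fix \<sigma> j assume "\<sigma> \<in> {\<sigma>. \<sigma> permutes {..<length (map cd B)}}" "j \<in> {..<length (map cd B)}"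
    then have "\<sigma> j < r" "j < r" using permutes_in_image[of \<sigma> "{..<r}" j] B(2) by auto
    then show "(map cd B ! \<sigma> j) (map \<pi> vs ! j) = (map cd B ! \<sigma> j) (vs ! j)"
      using B(2) vs by (simp add: cd\<pi>)
  qed
  have "coord B (wedge scale r (map \<pi> vs)) \<noteq> 0"
    unfolding coord_wedge[OF B(1,2)] coord_eq by (rule nz)
  then have "wedge scale r (map \<pi> vs) \<noteq> 0" by (auto simp: eval_form_def)
  then have \<pi>vs: "distinct (map \<pi> vs)" "independent (set (map \<pi> vs))"
    using wedge_nonzeroD vs by (metis length_map)+
  have "e ` set B \<subseteq> span (set (map \<pi> vs))"
  proof (rule independent_spans[OF \<pi>vs(2)])
    show "finite (e ` set B)" by simp
    have "inj_on e (set B)"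
      using B(1) cd_e by (intro inj_onI) (metis lessThan_iff subsetD zero_neq_one)
    then have "card (e ` set B) = r" using B(2,3) by (simp add: card_image distinct_card)
    moreover have "card (set (map \<pi> vs)) = r" using distinct_card[OF \<pi>vs(1)] vs by simp
    ultimately show "card (set (map \<pi> vs)) = card (e ` set B)" by simp
    show "set (map \<pi> vs) \<subseteq> span (e ` set B)"
    proof
      fix w assume "w \<in> set (map \<pi> vs)"
      then obtain v where "w = \<pi> v" by auto
      moreover have "e (B ! i) \<in> span (e ` set B)" if "i < r" for i
        using that B(2) by (intro span_base imageI nth_mem) simp
      ultimately show "w \<in> span (e ` set B)" unfolding \<pi>_def by (auto intro: span_sum span_scale)
    qed
  qed
  also have "span (set (map \<pi> vs)) = \<pi> ` span (set vs)"
    using module_hom.span_image[of scale scale \<pi> "set vs"] lin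
    by (simp add: Vector_Spaces.linear_def)
  finally have "\<forall>i<r. \<exists>u. u \<in> span (set vs) \<and> \<pi> u = e (B ! i)"
    using B(2) nth_mem by (metis (no_types, lifting) image_iff subset_iff)
  then obtain u where u: "\<And>i. i < r \<Longrightarrow> u i \<in> span (set vs)" "\<And>i. i < r \<Longrightarrow> \<pi> (u i) = e (B ! i)" by metis
  define us where "us = map u [0..<r]"
  have dual: "cd (B ! i) (us ! j) = (if i = j then 1 else 0)" if "i < r" "j < r" for i j
  proof -
    have "cd (B ! i) (us ! j) = cd (B ! i) (\<pi> (u j))" using that by (simp add: us_def cd\<pi>)
    then show ?thesis using that u(2) B(2,3) by (simp add: cd_e Bm nth_eq_iff_index_eq)
  qed
  have len: "length us = r" by (simp add: us_def)
  have "coord B (wedge scale r us) = 1" by (rule coord_wedge_dual[OF B(1,2) dual])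
  then have "wedge scale r us \<noteq> 0" by (auto simp: eval_form_def)
  then have us: "distinct us" "independent (set us)" using wedge_nonzeroD len by blast+
  have wvs: "wedge scale r vs \<noteq> 0"
    using nz unfolding coord_wedge[OF B(1,2), symmetric] by (auto simp: eval_form_def)
  have "set vs \<subseteq> span (set us)"
  proof (rule independent_spans[OF us(2)])
    show "card (set us) = card (set vs)"
      using distinct_card[OF us(1)] distinct_card[OF wedge_nonzeroD(1)[OF wvs vs]] len vs by simp
    show "set us \<subseteq> span (set vs)" using u(1) by (auto simp: us_def)
  qed simp
  have "v = (\<Sum>i<r. scale (cd (B ! i) v) (us ! i))" if "v \<in> set vs" for v
  proof -
    have "v \<in> span (set us)" using \<open>set vs \<subseteq> span (set us)\<close> that by blast
    then obtain q where q: "v = (\<Sum>w\<in>set us. scale (q w) w)" using span_finite[of "set us"] by auto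
    have bij: "bij_betw (\<lambda>i. us ! i) {..<r} (set us)"
      using bij_betw_nth[OF us(1)] len by auto
    have v: "v = (\<Sum>i<r. scale (q (us ! i)) (us ! i))"
      unfolding q by (rule sum.reindex_bij_betw[OF bij, symmetric])
    have "cd (B ! i) v = q (us ! i)" if i: "i < r" for i
    proof -
      have "cd (B ! i) v = (\<Sum>j<r. if j = i then q (us ! j) else 0)"
        by (subst v, subst cd_sum[OF Bm[OF i]], intro sum.cong refl)
          (use i in \<open>simp add: cd_scale[OF Bm[OF i]] dual\<close>)
      then show ?thesis using i by simp
    qed
    then show ?thesis using v by simp
  qed
  then show ?thesis using len dual by blast
qed

lemma poly_upto_wedge:
  assumes l: "Vector_Spaces.linear fscale (*) l"
    and "\<And>u i. u \<in> set us \<Longrightarrow> i < m \<Longrightarrow> poly_upto I 1 (\<lambda>t. cd i (u t))"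
    and "length ps + length us = k"
  shows "poly_upto I (length us) (\<lambda>t. l (wedge scale k (ps @ map (\<lambda>u. u t) us)))"
  using assms(2,3)
proof (induction us arbitrary: ps)
  case Nil
  then show ?case by (simp add: poly_upto.const)
next
  case (Cons u us)
  have "l (wedge scale k (ps @ map (\<lambda>u. u t) (u # us)))
      = (\<Sum>i<m. cd i (u t) * l (wedge scale k ((ps @ [e i]) @ map (\<lambda>u. u t) us)))" for t
  proof -
    have "wedge scale k (ps @ u t # map (\<lambda>u. u t) us)
        = wedge scale k (ps @ (\<Sum>i<m. scale (cd i (u t)) (e i)) # map (\<lambda>u. u t) us)"
      using expand[of "u t"] by simp
    also have "\<dots> = (\<Sum>i<m. fscale (cd i (u t)) (wedge scale k (ps @ e i # map (\<lambda>u. u t) us)))"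
      using Cons.prems(2) by (simp only: wedge_sum wedge_scale length_map list.size)
    finally show ?thesis by (simp add: functional_sum[OF l] functional_scale[OF l])
  qed
  moreover have "poly_upto I (1 + length us)
      (\<lambda>t. \<Sum>i<m. cd i (u t) * l (wedge scale k ((ps @ [e i]) @ map (\<lambda>u. u t) us)))"
    using Cons.prems by (intro poly_upto_sum poly_upto.mult Cons.IH) auto
  ultimately show ?case by simp
qed

text \<open>
  The product rule for the wedge product.
\<close>

lemma jet_wedge_list:
  assumes l: "Vector_Spaces.linear fscale (*) l" and "length ps + length ls = k"
  shows "jet (\<lambda>x. l (wedge scale k (ps @ map (\<lambda>(a, y). a + scale x y) ls)))
    (l (wedge scale k (ps @ map fst ls)))
    (\<Sum>i<length ls. l (wedge scale k (ps @ (map fst ls)[i := snd (ls ! i)])))"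
  using assms(2)
proof (induction ls arbitrary: ps)
  case Nil
  show ?case using jet_const by simp
next
  case (Cons ay ls)
  obtain a y where ay: "ay = (a, y)" by (cases ay)
  let ?r = "\<lambda>x. map (\<lambda>(a, y). a + scale x y) ls"
  have "l (wedge scale k (ps @ map (\<lambda>(a, y). a + scale x y) (ay # ls)))
      = l (wedge scale k ((ps @ [a]) @ ?r x)) + x * l (wedge scale k ((ps @ [y]) @ ?r x))" for x
  proof -
    have "wedge scale k (ps @ (a + scale x y) # ?r x)
        = wedge scale k (ps @ a # ?r x) + fscale x (wedge scale k (ps @ y # ?r x))"
      using Cons.prems by (simp only: wedge_add wedge_scale length_map list.size)
    then show ?thesis by (simp add: ay functional_add[OF l] functional_scale[OF l] del: plus_fun_apply)
  qed
  moreover have "jet (\<lambda>x. x) 0 1" using jet_affine[of 0 1] by simp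
  then have "jet (\<lambda>x. l (wedge scale k ((ps @ [a]) @ ?r x)) + x * l (wedge scale k ((ps @ [y]) @ ?r x)))
      (l (wedge scale k ((ps @ [a]) @ map fst ls)) + 0 * l (wedge scale k ((ps @ [y]) @ map fst ls)))
      ((\<Sum>i<length ls. l (wedge scale k ((ps @ [a]) @ (map fst ls)[i := snd (ls ! i)]))) +
       (0 * (\<Sum>i<length ls. l (wedge scale k ((ps @ [y]) @ (map fst ls)[i := snd (ls ! i)])))
        + 1 * l (wedge scale k ((ps @ [y]) @ map fst ls))))"
    using Cons.prems by (intro jet_add jet_mult Cons.IH) auto
  ultimately show ?case
    unfolding list.size add_0_right Suc_eq_plus1[symmetric]
    by (simp add: ay sum.lessThan_Suc_shift add.commute del: sum.lessThan_Suc)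
qed

lemma jet_wedge:
  assumes "Vector_Spaces.linear fscale (*) l"
  shows "jet (\<lambda>x. l (wedge scale k (map (\<lambda>i. a i + scale x (y i)) [0..<k])))
    (l (wedge scale k (map a [0..<k])))
    (\<Sum>i<k. l (wedge scale k ((map a [0..<k])[i := y i])))"
proof -
  have "(\<Sum>i<k. l (wedge scale k ((map a [0..<k])[i := snd (map (\<lambda>i. (a i, y i)) [0..<k] ! i)])))
      = (\<Sum>i<k. l (wedge scale k ((map a [0..<k])[i := y i])))"
    by (intro sum.cong) auto
  then show ?thesis
    using jet_wedge_list[OF assms, of "[]" "map (\<lambda>i. (a i, y i)) [0..<k]" k]
    by (simp add: o_def case_prod_beta)
qed

end

section \<open>Secants spanned by disjoint blocks\<close>

context char0_space
begin

lemma wedge_update_sum: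
  assumes "length xs = k" "i < k"
  shows "wedge scale k (xs[i := \<Sum>j\<in>A. scale (c j) (f j)]) = (\<Sum>j\<in>A. fscale (c j) (wedge scale k (xs[i := f j])))"
  using assms by (simp add: upd_conv_take_nth_drop wedge_sum wedge_scale)

end

lemma mem_block_iff: "0 < k \<Longrightarrow> x \<in> {b * k..<b * k + k} \<longleftrightarrow> x div k = (b::nat)"
proof
  assume "0 < k" "x \<in> {b * k..<b * k + k}"
  then show "x div k = b" by (intro div_nat_eqI) (auto simp: algebra_simps)
next
  assume k: "0 < k" and "x div k = b"
  then have "x = b * k + x mod k" using div_mult_mod_eq[of x k] by simp
  moreover have "x mod k < k" using k by simp
  ultimately show "x \<in> {b * k..<b * k + k}" by simp
qed

lemma blocks_disjoint:
  fixes k :: nat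
  assumes "0 < k" "x \<in> {b * k..<b * k + k}" "b \<noteq> b'" shows "x \<notin> {b' * k..<b' * k + k}"
  using assms mem_block_iff[OF assms(1), of x b] mem_block_iff[OF assms(1), of x b'] by metis

context based_space
begin

definition block :: "nat \<Rightarrow> nat \<Rightarrow> nat list"
  where "block k b = [b * k..<b * k + k]"

definition outside :: "nat \<Rightarrow> nat \<Rightarrow> nat set"
  where "outside k b = {..<m} - {b * k..<b * k + k}"

text \<open>
  The affine chart of the Grassmannian around the \<open>b\<close>-th block: the basis vector of index \<open>b k + i\<close> is
  moved by multiples of the basis vectors outside the block, with the parameters \<open>(b, Some (i, j))\<close>.
\<close>

definition chart_vec :: "nat \<Rightarrow> (nat \<times> (nat \<times> nat) option \<Rightarrow> 'a) \<Rightarrow> nat \<Rightarrow> nat \<Rightarrow> 'v"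
  where "chart_vec k t b i = e (b * k + i) + (\<Sum>j\<in>outside k b. scale (t (b, Some (i, j))) (e j))"

text \<open>
  The weight of a block has the parameter \<open>(b, None)\<close> and is centred at \<open>1\<close>.  As only the point in
  projective space matters, the weight of the block \<open>0\<close> is fixed.
\<close>

definition chart_coeff :: "(nat \<times> (nat \<times> nat) option \<Rightarrow> 'a) \<Rightarrow> nat \<Rightarrow> 'a"
  where "chart_coeff t b = (if b = 0 then 1 else 1 + t (b, None))"

definition secant_chart ::
  "nat \<Rightarrow> nat \<Rightarrow> (nat \<times> (nat \<times> nat) option \<Rightarrow> 'a) \<Rightarrow> (('v list \<Rightarrow> 'a) \<Rightarrow> 'a)"
  where "secant_chart k s t =
    (\<Sum>b<s. fscale (chart_coeff t b) (wedge scale k (map (chart_vec k t b) [0..<k])))"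

definition secant_index :: "nat \<Rightarrow> nat \<Rightarrow> (nat \<times> (nat \<times> nat) option) set"
  where "secant_index k s = (\<lambda>b. (b, None)) ` {1..<s} \<union>
    (\<lambda>(b, i, j). (b, Some (i, j))) ` (SIGMA b:{..<s}. {..<k} \<times> outside k b)"

lemma length_block [simp]: "length (block k b) = k"
  by (simp add: block_def)

lemma set_block [simp]: "set (block k b) = {b * k..<b * k + k}"
  by (simp add: block_def)

lemma distinct_block [simp]: "distinct (block k b)"
  by (simp add: block_def)

lemma nth_block [simp]: "i < k \<Longrightarrow> block k b ! i = b * k + i"
  by (simp add: block_def)

lemma map_block: "map (\<lambda>i. f (b * k + i)) [0..<k] = map f (block k b)"
  by (rule nth_equalityI) simp_all

lemma finite_outside [simp]: "finite (outside k b)"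
  by (simp add: outside_def)

lemma block_bound:
  assumes "k * s \<le> m" "b < s" shows "{b * k..<b * k + k} \<subseteq> {..<m}"
proof -
  have "b * k + k \<le> s * k" using mult_le_mono1[of "Suc b" s k] assms(2) by simp
  then show ?thesis using assms(1) by (auto simp: mult.commute)
qed

lemma set_block_update:
  "i < k \<Longrightarrow> set ((block k b)[i := j]) = insert j ({b * k..<b * k + k} - {b * k + i})"
  by (simp add: set_update_distinct)

lemma card_secant_index:
  assumes "k * s \<le> m" "1 \<le> s"
  shows "finite (secant_index k s)" "card (secant_index k s) = s * (k * (m - k)) + (s - 1)"
proof -
  let ?A = "(\<lambda>b. (b, None)) ` {1..<s} :: (nat \<times> (nat \<times> nat) option) set"
  let ?B = "(\<lambda>(b, i, j). (b, Some (i, j))) ` (SIGMA b:{..<s}. {..<k} \<times> outside k b)"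
  have fin: "finite ?A" "finite ?B" by auto
  show "finite (secant_index k s)" unfolding secant_index_def using fin by blast
  have "card ?A = s - 1" by (subst card_image) (auto simp: inj_on_def)
  moreover have "card ?B = s * (k * (m - k))"
  proof -
    have out: "card (outside k b) = m - k" if "b < s" for b
      unfolding outside_def using block_bound[OF assms(1) that] by (subst card_Diff_subset) auto
    have "card ?B = card (SIGMA b:{..<s}. {..<k} \<times> outside k b)"
      by (rule card_image) (auto simp: inj_on_def)
    also have "\<dots> = (\<Sum>b<s. card ({..<k} \<times> outside k b))" by (rule card_SigmaI) auto
    also have "\<dots> = (\<Sum>b<s. k * (m - k))"
      by (intro sum.cong refl) (simp add: card_cartesian_product out)
    finally show ?thesis by simp
  qed
  moreover have "?A \<inter> ?B = {}" by auto
  ultimately show "card (secant_index k s) = s * (k * (m - k)) + (s - 1)"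
    unfolding secant_index_def using fin by (simp add: card_Un_disjoint)
qed

lemma secant_chart_polynomial: "polynomial_map (secant_index k s) (1 + k) (secant_chart k s)"
  unfolding polynomial_map_def
proof (intro allI impI)
  fix l :: "(('v list \<Rightarrow> 'a) \<Rightarrow> 'a) \<Rightarrow> 'a"
  assume l: "Vector_Spaces.linear fscale (*) l"
  let ?I = "secant_index k s"
  have coeff: "poly_upto ?I 1 (\<lambda>t. chart_coeff t b)" if "b < s" for b
  proof (cases "b = 0")
    case True
    then show ?thesis by (simp add: chart_coeff_def poly_upto.const)
  next
    case False
    then have "(b, None) \<in> ?I" using that by (auto simp: secant_index_def)
    then show ?thesis using False poly_upto.add[OF poly_upto.const poly_upto.var] by (simp add: chart_coeff_def)
  qed
  have vec: "poly_upto ?I 1 (\<lambda>t. cd x (chart_vec k t b i))" if "b < s" "i < k" "x < m" for b i x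
  proof -
    have "poly_upto ?I (1 + 0) (\<lambda>t. t (b, Some (i, j)) * cd x (e j))" if "j \<in> outside k b" for j
    proof -
      have "(b, Some (i, j)) \<in> ?I" using that \<open>b < s\<close> \<open>i < k\<close> by (force simp: secant_index_def)
      then show ?thesis
        unfolding One_nat_def by (intro poly_upto.mult poly_upto.var poly_upto.const)
    qed
    then have "poly_upto ?I 1 (\<lambda>t. cd x (e (b * k + i)) + (\<Sum>j\<in>outside k b. t (b, Some (i, j)) * cd x (e j)))"
      by (intro poly_upto.add poly_upto.const poly_upto_sum) simp
    then show ?thesis using \<open>x < m\<close> by (simp add: chart_vec_def cd_add cd_sum cd_scale)
  qed
  have wed: "poly_upto ?I k (\<lambda>t. l (wedge scale k (map (chart_vec k t b) [0..<k])))" if "b < s" for b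
  proof -
    have "poly_upto ?I (length (map (\<lambda>i t. chart_vec k t b i) [0..<k]))
        (\<lambda>t. l (wedge scale k ([] @ map (\<lambda>u. u t) (map (\<lambda>i t. chart_vec k t b i) [0..<k]))))"
      by (rule poly_upto_wedge[OF l]) (use vec[OF that] in auto)
    then show ?thesis by (simp add: o_def)
  qed
  have "l (secant_chart k s t)
      = (\<Sum>b<s. chart_coeff t b * l (wedge scale k (map (chart_vec k t b) [0..<k])))" for t
    by (simp add: secant_chart_def functional_sum[OF l] functional_scale[OF l])
  moreover have "poly_upto ?I (1 + k)
      (\<lambda>t. \<Sum>b<s. chart_coeff t b * l (wedge scale k (map (chart_vec k t b) [0..<k])))"
    by (intro poly_upto_sum poly_upto.mult coeff wed) auto
  ultimately show "poly_upto ?I (1 + k) (\<lambda>t. l (secant_chart k s t))" by simp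
qed

lemma secant_chart_jet:
  assumes l: "Vector_Spaces.linear fscale (*) l"
  shows "jet (\<lambda>x. l (secant_chart k s (\<lambda>v. x * t v)))
    (\<Sum>b<s. l (wedge scale k (map e (block k b))))
    (\<Sum>b<s. (\<Sum>i<k. \<Sum>j\<in>outside k b. t (b, Some (i, j)) * l (wedge scale k (map e ((block k b)[i := j]))))
      + (if b = 0 then 0 else t (b, None)) * l (wedge scale k (map e (block k b))))"
proof -
  define y where "y b i = (\<Sum>j\<in>outside k b. scale (t (b, Some (i, j))) (e j))" for b i
  have cv: "chart_vec k (\<lambda>v. x * t v) b = (\<lambda>i. e (b * k + i) + scale x (y b i))" for x b
    by (rule ext) (simp add: chart_vec_def y_def scale_sum_right)
  have coeff: "jet (\<lambda>x. chart_coeff (\<lambda>v. x * t v) b) 1 (if b = 0 then 0 else t (b, None))" for b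
    using jet_affine[of 1 "t (b, None)"] jet_const[of "1 :: 'a"] by (simp add: chart_coeff_def)
  have D: "l (wedge scale k ((map e (block k b))[i := y b i]))
      = (\<Sum>j\<in>outside k b. t (b, Some (i, j)) * l (wedge scale k (map e ((block k b)[i := j]))))"
    if "i < k" for b i
  proof -
    have "wedge scale k ((map e (block k b))[i := y b i])
        = (\<Sum>j\<in>outside k b. fscale (t (b, Some (i, j))) (wedge scale k (map e ((block k b)[i := j]))))"
      unfolding y_def map_update using that by (intro wedge_update_sum) simp_all
    then show ?thesis by (simp add: functional_sum[OF l] functional_scale[OF l])
  qed
  have "jet (\<lambda>x. \<Sum>b<s. chart_coeff (\<lambda>v. x * t v) b
        * l (wedge scale k (map (\<lambda>i. e (b * k + i) + scale x (y b i)) [0..<k])))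
     (\<Sum>b<s. 1 * l (wedge scale k (map (\<lambda>i. e (b * k + i)) [0..<k])))
     (\<Sum>b<s. 1 * (\<Sum>i<k. l (wedge scale k ((map (\<lambda>i. e (b * k + i)) [0..<k])[i := y b i])))
       + (if b = 0 then 0 else t (b, None)) * l (wedge scale k (map (\<lambda>i. e (b * k + i)) [0..<k])))"
    by (intro jet_sum jet_mult coeff jet_wedge[OF l])
  moreover have "l (secant_chart k s (\<lambda>v. x * t v))
      = (\<Sum>b<s. chart_coeff (\<lambda>v. x * t v) b
        * l (wedge scale k (map (\<lambda>i. e (b * k + i) + scale x (y b i)) [0..<k])))" for x
    by (simp add: secant_chart_def cv functional_sum[OF l] functional_scale[OF l])
  moreover have "(\<Sum>b<s. 1 * (\<Sum>i<k. l (wedge scale k ((map (\<lambda>i. e (b * k + i)) [0..<k])[i := y b i])))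
       + (if b = 0 then 0 else t (b, None)) * l (wedge scale k (map (\<lambda>i. e (b * k + i)) [0..<k])))
    = (\<Sum>b<s. (\<Sum>i<k. \<Sum>j\<in>outside k b. t (b, Some (i, j)) * l (wedge scale k (map e ((block k b)[i := j]))))
      + (if b = 0 then 0 else t (b, None)) * l (wedge scale k (map e (block k b))))"
    by (intro sum.cong refl) (simp add: D map_block[of e])
  ultimately show ?thesis by (simp add: map_block[of e])
qed

lemma coord_block_block:
  assumes "k * s \<le> m" "1 \<le> k" "b < s" "b' < s"
  shows "coord (block k b') (wedge scale k (map e (block k b))) = (if b = b' then 1 else 0)"
proof (cases "b = b'")
  case True
  then show ?thesis using block_bound[OF assms(1)] assms by (simp add: coord_wedge_basis)
next
  case False
  have "b * k \<in> {b * k..<b * k + k}" using assms(2) by simp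
  moreover have "b * k \<notin> {b' * k..<b' * k + k}" using False assms(2) mem_block_iff[of k "b * k"] by simp
  ultimately show ?thesis
    using False block_bound[OF assms(1)] assms by (simp add: coord_wedge_other[of _ k _ "b * k"])
qed

lemma outside_subset: "outside k b \<subseteq> {..<m}"
  by (auto simp: outside_def)

lemma block_update_subset:
  assumes "k * s \<le> m" "b < s" "i < k" "j \<in> outside k b"
  shows "set ((block k b)[i := j]) \<subseteq> {..<m}"
  using block_bound[OF assms(1,2)] outside_subset assms(3,4) by (auto simp: set_block_update)

lemma coord_block_update:
  assumes "k * s \<le> m" "2 \<le> k" "b < s" "b' < s" "i < k" "j \<in> outside k b"
  shows "coord (block k b') (wedge scale k (map e ((block k b)[i := j]))) = 0"
proof -
  have k: "0 < k" using assms(2) by simp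
  have "\<exists>x. x \<in> set ((block k b)[i := j]) \<and> x \<notin> set (block k b')"
  proof (cases "b = b'")
    case True
    then show ?thesis using assms(5,6) by (intro exI[of _ j]) (auto simp: set_block_update outside_def)
  next
    case False
    obtain y where y: "y < k" "y \<noteq> i" using assms(2) by (metis One_nat_def Suc_1 Suc_le_lessD less_le_trans not_less_eq zero_less_Suc zero_less_one)
    then have "b * k + y \<in> {b * k..<b * k + k}" by simp
    moreover from this have "b * k + y \<notin> {b' * k..<b' * k + k}" using False by (intro blocks_disjoint[OF k])
    ultimately show ?thesis using y assms(5) by (intro exI[of _ "b * k + y"]) (auto simp: set_block_update)
  qed
  then obtain x where "x \<in> set ((block k b)[i := j])" "x \<notin> set (block k b')" by blast
  then show ?thesis
    using block_update_subset[OF assms(1,3,5,6)] block_bound[OF assms(1,4)]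
    by (intro coord_wedge_other) auto
qed

text \<open>
  Some index of the block \<open>b\<close> is missing from the exchanged block \<open>b'\<close>: the one that was removed, if
  \<open>b = b'\<close>, and otherwise one of the first two indices, as only \<open>j\<close> can be shared.
\<close>

lemma coord_update_block:
  assumes "k * s \<le> m" "2 \<le> k" "b < s" "b' < s" "i < k" "j \<in> outside k b'"
  shows "coord ((block k b')[i := j]) (wedge scale k (map e (block k b))) = 0"
proof -
  have k: "0 < k" using assms(2) by simp
  have "\<exists>x. x \<in> set (block k b) \<and> x \<notin> set ((block k b')[i := j])"
  proof (cases "b = b'")
    case True
    have "b * k + i \<noteq> j" using assms(5,6) True by (auto simp: outside_def)
    then show ?thesis using True assms(5) by (intro exI[of _ "b * k + i"]) (auto simp: set_block_update)
  next
    case False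
    have "b * k \<noteq> j \<or> b * k + 1 \<noteq> j" by auto
    then obtain y where y: "y < k" "b * k + y \<noteq> j" using assms(2)
      by (metis One_nat_def Suc_1 Suc_le_lessD add_0_right k)
    then have "b * k + y \<in> {b * k..<b * k + k}" by simp
    moreover from this have "b * k + y \<notin> {b' * k..<b' * k + k}" using False by (intro blocks_disjoint[OF k])
    ultimately show ?thesis using y assms(5) by (intro exI[of _ "b * k + y"]) (auto simp: set_block_update)
  qed
  then obtain x where "x \<in> set (block k b)" "x \<notin> set ((block k b')[i := j])" by blast
  then show ?thesis
    using block_update_subset[OF assms(1,4,5,6)] block_bound[OF assms(1,3)]
    by (intro coord_wedge_other) auto
qed

text \<open>
  This is where \<open>k \<ge> 3\<close> enters.  If two of the exchanged blocks come from different blocks, one of the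
  first three indices of the block \<open>b\<close> is neither the index \<open>i\<close> that was removed nor the single index
  \<open>j'\<close> that the other may share with it.
\<close>

lemma coord_update_update:
  assumes "k * s \<le> m" "3 \<le> k" "b < s" "b' < s" "i < k" "j \<in> outside k b" "i' < k" "j' \<in> outside k b'"
  shows "coord ((block k b')[i' := j']) (wedge scale k (map e ((block k b)[i := j])))
    = (if (b, i, j) = (b', i', j') then 1 else 0)"
proof (cases "(b, i, j) = (b', i', j')")
  case True
  have "distinct ((block k b)[i := j])"
    using assms(6) by (intro distinct_list_update) (auto simp: outside_def)
  then show ?thesis
    using True block_update_subset[OF assms(1,3,5,6)] by (simp add: coord_wedge_basis)
next
  case False
  have k: "0 < k" using assms(2) by simp
  have "\<exists>x. x \<in> set ((block k b)[i := j]) \<and> x \<notin> set ((block k b')[i' := j'])"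
  proof (cases "b = b'")
    case True
    show ?thesis
    proof (cases "j = j'")
      case jj: True
      then have "i \<noteq> i'" using False True by simp
      moreover have "b * k + i' \<noteq> j'" using assms(7,8) True by (auto simp: outside_def)
      ultimately show ?thesis using assms(5,7) True
        by (intro exI[of _ "b * k + i'"]) (auto simp: set_block_update)
    next
      case jj: False
      then show ?thesis using assms(5-8) True
        by (intro exI[of _ j]) (auto simp: set_block_update outside_def)
    qed
  next
    case bb: False
    have "\<exists>y<3. y \<noteq> i \<and> b * k + y \<noteq> j'"
    proof (rule ccontr)
      assume "\<not> ?thesis"
      then have "0 = i \<or> b * k + 0 = j'" "1 = i \<or> b * k + 1 = j'" "2 = i \<or> b * k + 2 = j'"
        by (metis zero_less_numeral, metis one_less_numeral_iff semiring_norm(77),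
            metis lessI numeral_2_eq_2 numeral_3_eq_3)
      then show False by auto
    qed
    then obtain y where y: "y < k" "y \<noteq> i" "b * k + y \<noteq> j'" using assms(2) by (meson less_le_trans)
    then have "b * k + y \<in> {b * k..<b * k + k}" by simp
    moreover from this have "b * k + y \<notin> {b' * k..<b' * k + k}" using bb by (intro blocks_disjoint[OF k])
    ultimately show ?thesis using y assms(5,7) by (intro exI[of _ "b * k + y"]) (auto simp: set_block_update)
  qed
  then obtain x where "x \<in> set ((block k b)[i := j])" "x \<notin> set ((block k b')[i' := j'])" by blast
  then have "coord ((block k b')[i' := j']) (wedge scale k (map e ((block k b)[i := j]))) = 0"
    using block_update_subset[OF assms(1,3,5,6)] block_update_subset[OF assms(1,4,7,8)]
    by (intro coord_wedge_other) auto
  then show ?thesis using False by simp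
qed

text \<open>
  A weight is read off from the coordinate of its block, from which the coordinate of the block \<open>0\<close> is
  subtracted to cancel the constant term, and the other parameters from the coordinates of the
  exchanged blocks.
\<close>

lemma secant_chart_local_parameters:
  assumes m: "k * s \<le> m" and k: "3 \<le> k" and s: "1 \<le> s"
  shows "local_parameters (secant_index k s) (secant_chart k s)"
proof -
  define l where "l v = (case snd v of
      None \<Rightarrow> (\<lambda>T. coord (block k (fst v)) T - coord (block k 0) T)
    | Some (i, j) \<Rightarrow> coord ((block k (fst v))[i := j]))" for v :: "nat \<times> (nat \<times> nat) option"
  have lin: "Vector_Spaces.linear fscale (*) (l v)" for v
    unfolding l_def
    by (auto intro: linear_eval_form linear_functional_diff split: option.split)
  have jblock: "jet (\<lambda>x. coord (block k b') (secant_chart k s (\<lambda>v. x * t v))) 1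
      (if b' = 0 then 0 else t (b', None))" if b': "b' < s" for b' t
  proof -
    have "(\<Sum>b<s. coord (block k b') (wedge scale k (map e (block k b)))) = (\<Sum>b<s. if b = b' then 1 else 0)"
      by (intro sum.cong refl) (use coord_block_block[OF m _ _ b'] k in auto)
    moreover have "(\<Sum>b<s. (\<Sum>i<k. \<Sum>j\<in>outside k b. t (b, Some (i, j)) * coord (block k b') (wedge scale k (map e ((block k b)[i := j]))))
      + (if b = 0 then 0 else t (b, None)) * coord (block k b') (wedge scale k (map e (block k b))))
      = (\<Sum>b<s. if b = b' then (if b' = 0 then 0 else t (b', None)) else 0)"
      by (intro sum.cong refl)
        (use coord_block_block[OF m _ _ b'] coord_block_update[OF m _ _ b'] k in auto)
    ultimately show ?thesis using secant_chart_jet[OF linear_eval_form[of "map cd (block k b')"], of k s t] b' by simp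
  qed
  have jupd: "jet (\<lambda>x. coord ((block k b')[i' := j']) (secant_chart k s (\<lambda>v. x * t v))) 0 (t (b', Some (i', j')))"
    if b': "b' < s" "i' < k" "j' \<in> outside k b'" for b' i' j' t
  proof -
    let ?J = "(block k b')[i' := j']"
    have "(\<Sum>b<s. coord ?J (wedge scale k (map e (block k b)))) = 0"
      by (intro sum.neutral) (use coord_update_block[OF m _ _ b'] k in auto)
    moreover have "(\<Sum>b<s. (\<Sum>i<k. \<Sum>j\<in>outside k b. t (b, Some (i, j)) * coord ?J (wedge scale k (map e ((block k b)[i := j]))))
      + (if b = 0 then 0 else t (b, None)) * coord ?J (wedge scale k (map e (block k b))))
      = (\<Sum>b<s. if b = b' then (\<Sum>i<k. if i = i' then (\<Sum>j\<in>outside k b. if j = j' then t (b, Some (i, j)) else 0) else 0) else 0)"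
    proof (intro sum.cong refl)
      fix b assume b: "b \<in> {..<s}"
      have "(\<Sum>i<k. \<Sum>j\<in>outside k b. t (b, Some (i, j)) * coord ?J (wedge scale k (map e ((block k b)[i := j]))))
        = (\<Sum>i<k. \<Sum>j\<in>outside k b. if (b, i, j) = (b', i', j') then t (b, Some (i, j)) else 0)"
        by (intro sum.cong refl) (use b coord_update_update[OF m k _ b'(1) _ _ b'(2,3)] in auto)
      also have "\<dots> = (if b = b' then (\<Sum>i<k. if i = i' then (\<Sum>j\<in>outside k b. if j = j' then t (b, Some (i, j)) else 0) else 0) else 0)"
      proof (cases "b = b'")
        case True
        have "(\<Sum>j\<in>outside k b. if (b, i, j) = (b', i', j') then t (b, Some (i, j)) else 0)
            = (if i = i' then (\<Sum>j\<in>outside k b. if j = j' then t (b, Some (i, j)) else 0) else 0)" for i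
          by (cases "i = i'") (auto simp: True)
        then show ?thesis using True by simp
      qed simp
      finally show "(\<Sum>i<k. \<Sum>j\<in>outside k b. t (b, Some (i, j)) * coord ?J (wedge scale k (map e ((block k b)[i := j]))))
        + (if b = 0 then 0 else t (b, None)) * coord ?J (wedge scale k (map e (block k b)))
        = (if b = b' then (\<Sum>i<k. if i = i' then (\<Sum>j\<in>outside k b. if j = j' then t (b, Some (i, j)) else 0) else 0) else 0)"
        using coord_update_block[OF m _ _ b'] k b by simp
    qed
    ultimately show ?thesis using secant_chart_jet[OF linear_eval_form[of "map cd ?J"], of k s t] b' by simp
  qed
  have "jet (\<lambda>x. l v (secant_chart k s (\<lambda>v. x * t v))) 0 (t v)" if v: "v \<in> secant_index k s" for v t
  proof -
    from v consider b where "v = (b, None)" "1 \<le> b" "b < s"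
      | b i j where "v = (b, Some (i, j))" "b < s" "i < k" "j \<in> outside k b"
      unfolding secant_index_def by auto
    then show ?thesis
    proof cases
      case 1
      then show ?thesis using jet_diff[OF jblock[of b t] jblock[of 0 t]] s by (simp add: l_def)
    next
      case 2
      then show ?thesis using jupd[of b i j t] by (simp add: l_def)
    qed
  qed
  then show ?thesis
    unfolding local_parameters_def
    using jblock[of 0] s lin
    by (intro exI[of _ "coord (block k 0)"] exI[of _ l]) (auto intro: linear_eval_form)
qed

lemma secant_chart_in_wedge_sums:
  assumes "1 \<le> k" shows "secant_chart k s t \<in> wedge_sums k s"
proof -
  have "fscale (chart_coeff t b) (wedge scale k (map (chart_vec k t b) [0..<k])) \<in> decomposable k" for b
    by (intro decomposable_scale[OF assms]) (auto simp: decomposable_def)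
  then show ?thesis unfolding secant_chart_def wedge_sums_def by blast
qed

text \<open>
  A family of vectors whose coordinates are independent variables.
\<close>

definition generic_vec :: "('i \<times> nat \<Rightarrow> 'a) \<Rightarrow> 'i \<Rightarrow> 'v"
  where "generic_vec t i = (\<Sum>j<m. scale (t (i, j)) (e j))"

lemma generic_vec_coords: "generic_vec (\<lambda>(i, j). cd j (f i)) i = f i"
  using expand[of "f i"] by (simp add: generic_vec_def)

lemma poly_upto_generic_wedge:
  assumes l: "Vector_Spaces.linear fscale (*) l" and "length is = k"
  shows "poly_upto UNIV k (\<lambda>t. l (wedge scale k (map (generic_vec t) is)))"
proof -
  have "poly_upto UNIV 1 (\<lambda>t. cd x (generic_vec t i))" if "x < m" for x and i :: 'b
  proof -
    have "poly_upto UNIV (1 + 0) (\<lambda>t. t (i, j) * cd x (e j))" for j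
      unfolding One_nat_def by (intro poly_upto.mult poly_upto.var poly_upto.const) simp
    then have "poly_upto UNIV 1 (\<lambda>t. \<Sum>j<m. t (i, j) * cd x (e j))" by (intro poly_upto_sum) simp
    then show ?thesis using that by (simp add: generic_vec_def cd_sum cd_scale)
  qed
  then have "poly_upto UNIV (length (map (\<lambda>i t. generic_vec t i) is))
      (\<lambda>t. l (wedge scale k ([] @ map (\<lambda>u. u t) (map (\<lambda>i t. generic_vec t i) is))))"
    using assms(2) by (intro poly_upto_wedge[OF l]) auto
  then show ?thesis using assms(2) by (simp add: o_def)
qed

lemma dual_vector_expand:
  assumes "set B \<subseteq> {..<m}" "distinct B" "p < length B"
    and "\<And>i. i < length B \<Longrightarrow> cd (B ! i) u = (if i = p then 1 else 0)"
  shows "u = e (B ! p) + (\<Sum>j\<in>{..<m} - set B. scale (cd j u) (e j))"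
proof -
  have "u = (\<Sum>j<m. scale (cd j u) (e j))" by (rule expand)
  also have "\<dots> = (\<Sum>j\<in>set B. scale (cd j u) (e j)) + (\<Sum>j\<in>{..<m} - set B. scale (cd j u) (e j))"
    using sum.subset_diff[OF assms(1), of "\<lambda>j. scale (cd j u) (e j)"] by (simp add: add.commute)
  also have "(\<Sum>j\<in>set B. scale (cd j u) (e j)) = (\<Sum>j\<in>set B. if j = B ! p then e j else 0)"
  proof (intro sum.cong refl)
    fix j assume "j \<in> set B"
    then obtain i where "i < length B" "j = B ! i" by (auto simp: in_set_conv_nth)
    then show "scale (cd j u) (e j) = (if j = B ! p then e j else 0)"
      using assms by (auto simp: nth_eq_iff_index_eq)
  qed
  also have "\<dots> = e (B ! p)" using assms(3) by simp
  finally show ?thesis .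
qed

text \<open>
  The coordinate of the block \<open>b\<close> is the factor between \<open>vs\<close> and its reduced echelon form, which lies
  in the chart.
\<close>

lemma decomposable_chart:
  assumes m: "k * s \<le> m" and b: "b < s" and vs: "length vs = k"
    and nz: "coord (block k b) (wedge scale k vs) \<noteq> 0"
  shows "\<exists>r. \<forall>t. (\<forall>i j. t (b, Some (i, j)) = r i j) \<longrightarrow>
    wedge scale k vs = fscale (coord (block k b) (wedge scale k vs)) (wedge scale k (map (chart_vec k t b) [0..<k]))"
proof -
  have sub: "set (block k b) \<subseteq> {..<m}" using block_bound[OF m b] by simp
  have "detform (map cd (block k b)) vs \<noteq> 0"
    using nz unfolding coord_wedge[OF sub length_block] .
  from chart_vectors[OF sub length_block distinct_block vs this]
  obtain us where us': "length us = k"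
    "\<forall>i<k. \<forall>j<k. cd (block k b ! i) (us ! j) = (if i = j then 1 else 0)"
    "\<forall>v\<in>set vs. v = (\<Sum>i<k. scale (cd (block k b ! i) v) (us ! i))"
    by (elim exE conjE)
  note us = us'(1) us'(2)[rule_format] us'(3)[rule_format]
  have "wedge scale k vs \<in> fun_space.span {wedge scale k us}"
  proof (rule wedge_in_span[OF us(1) vs], rule subsetI)
    fix v assume "v \<in> set vs"
    have "(\<Sum>i<k. scale (cd (block k b ! i) v) (us ! i)) \<in> span (set us)"
      by (intro span_sum span_scale span_base nth_mem) (simp add: us(1))
    then show "v \<in> span (set us)" unfolding us(3)[OF \<open>v \<in> set vs\<close>, symmetric] .
  qed
  then obtain c where c: "wedge scale k vs = fscale c (wedge scale k us)"
    by (auto simp: fun_space.span_singleton)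
  have "coord (block k b) (wedge scale k us) = 1"
    by (rule coord_wedge_dual[OF sub length_block us(2)])
  then have c': "coord (block k b) (wedge scale k vs) = c"
    unfolding c functional_scale[OF linear_eval_form] by simp
  have "map (chart_vec k t b) [0..<k] = us" if t: "\<forall>i j. t (b, Some (i, j)) = cd j (us ! i)" for t
  proof (rule nth_equalityI)
    fix i assume "i < length (map (chart_vec k t b) [0..<k])"
    then have i: "i < k" by simp
    have "us ! i = e (block k b ! i) + (\<Sum>j\<in>{..<m} - set (block k b). scale (cd j (us ! i)) (e j))"
      by (rule dual_vector_expand[OF sub distinct_block]) (use i us(2) in auto)
    then show "map (chart_vec k t b) [0..<k] ! i = us ! i"
      using i t by (simp add: chart_vec_def outside_def)
  qed (simp add: us(1))
  then show ?thesis using c unfolding c' by (intro exI[of _ "\<lambda>i j. cd j (us ! i)"]) auto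
qed

text \<open>
  Let the vectors in all summands be generic.  Where the block coordinates \<open>g\<close> of the summands are
  nonzero, the sum is a multiple of a value of the chart, so that a form \<open>p\<close> vanishing on the chart
  satisfies \<open>p \<cdot> \<Prod> g = 0\<close> everywhere.  The second factor is not identically zero.
\<close>

lemma secant_chart_dominates:
  assumes m: "k * s \<le> m" and s: "1 \<le> s"
  shows "dominates (range (secant_chart k s)) (wedge_sums k s)"
proof -
  have "p T = 0" if p: "homogeneous fscale d p" "\<forall>w\<in>range (secant_chart k s). p w = 0"
    and T: "T \<in> wedge_sums k s" for d p T
  proof -
    define W where "W t b = wedge scale k (map (generic_vec t) (map (Pair b) [0..<k]))"
      for t :: "(nat \<times> nat) \<times> nat \<Rightarrow> 'a" and b :: nat
    define \<Phi> where "\<Phi> t = (\<Sum>b<s. W t b)" for t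
    define g where "g t b = coord (block k b) (W t b)" for t b
    have pm: "polynomial_map UNIV k \<Phi>"
      unfolding polynomial_map_def \<Phi>_def W_def
      by (auto simp: functional_sum simp del: map_map intro!: poly_upto_sum poly_upto_generic_wedge)
    have pp: "poly_upto UNIV (k * d) (\<lambda>t. p (\<Phi> t))" by (rule homogeneous_pullback[OF p(1) pm])
    have "\<exists>D. poly_upto UNIV D (\<lambda>t. \<Prod>b<s. g t b)"
      unfolding g_def W_def by (intro poly_upto_prod exI[of _ k] poly_upto_generic_wedge linear_eval_form) simp
    then obtain D where pg: "poly_upto UNIV D (\<lambda>t. \<Prod>b<s. g t b)" by blast
    have "p (\<Phi> t) * (\<Prod>b<s. g t b) = 0" for t
    proof (cases "\<exists>b<s. g t b = 0")
      case True
      then have "(\<Prod>b<s. g t b) = 0" by (intro prod_zero) auto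
      then show ?thesis by simp
    next
      case False
      then have "\<forall>b<s. \<exists>r. \<forall>u. (\<forall>i j. u (b, Some (i, j)) = r i j) \<longrightarrow>
          W t b = fscale (g t b) (wedge scale k (map (chart_vec k u b) [0..<k]))"
        unfolding g_def W_def using decomposable_chart[OF m] by simp
      then obtain r where r: "\<And>b u. b < s \<Longrightarrow> (\<forall>i j. u (b, Some (i, j)) = r b i j) \<Longrightarrow>
          W t b = fscale (g t b) (wedge scale k (map (chart_vec k u b) [0..<k]))" by metis
      \<comment> \<open>Dividing by the first weight brings the weights into the form used by the chart.\<close>
      define u where "u v = (case snd v of None \<Rightarrow> g t (fst v) / g t 0 - 1 | Some (i, j) \<Rightarrow> r (fst v) i j)" for v
      have g0: "g t 0 \<noteq> 0" using False s by simp
      have "\<Phi> t = fscale (g t 0) (secant_chart k s u)"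
        unfolding \<Phi>_def secant_chart_def fun_space.scale_sum_right
      proof (intro sum.cong refl)
        fix b assume "b \<in> {..<s}"
        then have "W t b = fscale (g t b) (wedge scale k (map (chart_vec k u b) [0..<k]))"
          by (intro r) (auto simp: u_def)
        moreover have "g t b = g t 0 * chart_coeff u b"
          using g0 by (simp add: chart_coeff_def u_def)
        ultimately show "W t b = fscale (g t 0) (fscale (chart_coeff u b) (wedge scale k (map (chart_vec k u b) [0..<k])))"
          by (simp only: fun_space.scale_scale)
      qed
      then have "p (\<Phi> t) = 0" using p by (simp add: homogeneous_def)
      then show ?thesis by simp
    qed
    then have "(\<forall>t. p (\<Phi> t) = 0) \<or> (\<forall>t. (\<Prod>b<s. g t b) = 0)"
      by (rule poly_upto_mult_eq_0[OF pp pg])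
    \<comment> \<open>At the blocks of basis vectors themselves all block coordinates are \<open>1\<close>.\<close>
    moreover have "(\<Prod>b<s. g (\<lambda>((b, i), j). cd j (e (b * k + i))) b) = 1"
    proof (intro prod.neutral ballI)
      fix b assume "b \<in> {..<s}"
      then have sub: "set (block k b) \<subseteq> {..<m}" using block_bound[OF m] by simp
      have gv: "generic_vec (\<lambda>((b, i), j). cd j (e (b * k + i))) (b, i) = e (b * k + i)" for i
        using generic_vec_coords[of "\<lambda>(b, i). e (b * k + i)" "(b, i)"] by (simp add: case_prod_unfold)
      show "g (\<lambda>((b, i), j). cd j (e (b * k + i))) b = 1"
        using coord_wedge_basis[OF sub length_block distinct_block]
        by (simp add: g_def W_def o_def gv map_block)
    qed
    ultimately have pz: "p (\<Phi> t) = 0" for t by (metis zero_neq_one)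
    obtain f where f: "T = (\<Sum>b<s. f b)" "\<And>b. b < s \<Longrightarrow> f b \<in> decomposable k"
      using T unfolding wedge_sums_def by blast
    have "\<forall>b<s. \<exists>vs. f b = wedge scale k vs \<and> length vs = k"
      using f(2) unfolding decomposable_def by blast
    then obtain vs where vs: "\<And>b. b < s \<Longrightarrow> f b = wedge scale k (vs b) \<and> length (vs b) = k" by metis
    have T\<Phi>: "T = \<Phi> (\<lambda>((b, i), j). cd j (vs b ! i))"
      unfolding f(1) \<Phi>_def
    proof (intro sum.cong refl)
      fix b assume "b \<in> {..<s}"
      have gv: "generic_vec (\<lambda>((b, i), j). cd j (vs b ! i)) (b, i) = vs b ! i" for i
        using generic_vec_coords[of "\<lambda>(b, i). vs b ! i" "(b, i)"] by (simp add: case_prod_unfold)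
      have b: "f b = wedge scale k (vs b)" "length (vs b) = k" using vs \<open>b \<in> {..<s}\<close> by auto
      have "map (generic_vec (\<lambda>((b, i), j). cd j (vs b ! i))) (map (Pair b) [0..<k]) = vs b"
        by (rule nth_equalityI) (simp_all add: b(2) gv)
      then show "f b = W (\<lambda>((b, i), j). cd j (vs b ! i)) b"
        unfolding W_def b(1) by (simp only:)
    qed
    show "p T = 0" unfolding T\<Phi> by (rule pz)
  qed
  then show ?thesis unfolding dominates_def by blast
qed

end

section \<open>Bivectors of bounded rank\<close>

lemma (in vector_space) span_finite_family:
  assumes "finite A" "T \<in> span (f ` A)"
  shows "\<exists>c. T = (\<Sum>a\<in>A. scale (c a) (f a))"
  using assms(2)
proof (induction rule: span_induct_alt)
  case base
  show ?case by (intro exI[of _ "\<lambda>_. 0"]) simp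
next
  case (step r x y)
  then obtain a c where a: "a \<in> A" "x = f a" and c: "y = (\<Sum>a\<in>A. scale (c a) (f a))" by blast
  have "(\<Sum>b\<in>A. scale ((if b = a then r else 0) + c b) (f b))
      = (\<Sum>b\<in>A. if b = a then scale r (f b) else 0) + y"
    unfolding c scale_left_distrib sum.distrib
    by (intro arg_cong2[of _ _ _ _ "(+)"] sum.cong refl) simp
  also have "(\<Sum>b\<in>A. if b = a then scale r (f b) else 0) = scale r x"
    using assms(1) a by simp
  finally show ?case by (intro exI[of _ "\<lambda>b. (if b = a then r else 0) + c b"]) simp
qed

context based_space
begin

definition pairs :: "nat \<Rightarrow> (nat \<times> nat) set"
  where "pairs s = {(i, j). i < j \<and> j < 2 * s}"

text \<open>
  A pair \<open>i < j\<close> is an entry of the bivector for \<open>j < 2 s\<close>, and otherwise an entry of the matrix whose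
  graph is the supporting subspace.  The entry \<open>(0, 1)\<close> is left out, because it is normalised to \<open>1\<close>.
\<close>

definition bivector_index :: "nat \<Rightarrow> (nat \<times> nat) set"
  where "bivector_index s = (SIGMA i:{..<2 * s}. {i<..<m}) - {(0, 1)}"

definition graph_vec :: "nat \<Rightarrow> (nat \<times> nat \<Rightarrow> 'a) \<Rightarrow> nat \<Rightarrow> 'v"
  where "graph_vec s t i = e i + (\<Sum>j\<in>{2 * s..<m}. scale (t (i, j)) (e j))"

text \<open>
  The coefficients of \<open>e\<^sub>0 \<and> e\<^sub>1 + e\<^sub>2 \<and> e\<^sub>3 + \<dots>\<close>, the bivector at the origin of the parameters.
\<close>

definition symplectic :: "nat \<times> nat \<Rightarrow> 'a"
  where "symplectic = (\<lambda>(i, j). if even i \<and> j = Suc i then 1 else 0)"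

definition bivector_coeff :: "(nat \<times> nat \<Rightarrow> 'a) \<Rightarrow> nat \<times> nat \<Rightarrow> 'a"
  where "bivector_coeff t v = symplectic v + (if v = (0, 1) then 0 else t v)"

definition bivector_chart :: "nat \<Rightarrow> (nat \<times> nat \<Rightarrow> 'a) \<Rightarrow> (('v list \<Rightarrow> 'a) \<Rightarrow> 'a)"
  where "bivector_chart s t = (\<Sum>v\<in>pairs s. fscale (bivector_coeff t v)
    (wedge scale 2 [graph_vec s t (fst v), graph_vec s t (snd v)]))"

lemma finite_pairs [simp]: "finite (pairs s)"
  by (rule finite_subset[of _ "{..<2 * s} \<times> {..<2 * s}"]) (auto simp: pairs_def)

lemma card_bivector_index:
  assumes "1 \<le> s" "2 * s \<le> m"
  shows "finite (bivector_index s)" "card (bivector_index s) = s * (2 * m - 2 * s - 1) - 1"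
proof -
  show "finite (bivector_index s)" by (simp add: bivector_index_def)
  have "(\<Sum>i<2 * s. m - Suc i) = s * (2 * m - 2 * s - 1)" if "2 * s \<le> m" for s
    using that
  proof (induction s)
    case (Suc s)
    then obtain r where r: "m = 2 * s + 2 + r" using le_Suc_ex by (metis add.assoc add_2_eq_Suc' mult_Suc_right add.commute)
    have "(\<Sum>i<2 * Suc s. m - Suc i) = s * (2 * m - 2 * s - 1) + (m - Suc (2 * s)) + (m - Suc (Suc (2 * s)))"
      using Suc by simp
    then show ?case unfolding r by (simp add: algebra_simps)
  qed simp
  then have "card (SIGMA i:{..<2 * s}. {i<..<m}) = s * (2 * m - 2 * s - 1)"
    using assms(2) by simp
  moreover have "(0, 1) \<in> (SIGMA i:{..<2 * s}. {i<..<m})" using assms by simp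
  ultimately show "card (bivector_index s) = s * (2 * m - 2 * s - 1) - 1"
    unfolding bivector_index_def by (subst card_Diff_singleton) auto
qed

lemma bivector_chart_polynomial:
  assumes "2 * s \<le> m"
  shows "polynomial_map (bivector_index s) (1 + 2) (bivector_chart s)"
  unfolding polynomial_map_def
proof (intro allI impI)
  fix l :: "(('v list \<Rightarrow> 'a) \<Rightarrow> 'a) \<Rightarrow> 'a"
  assume l: "Vector_Spaces.linear fscale (*) l"
  let ?I = "bivector_index s"
  have coeff: "poly_upto ?I 1 (\<lambda>t. bivector_coeff t v)" if "v \<in> pairs s" for v
  proof (cases "v = (0, 1)")
    case True
    then show ?thesis by (simp add: bivector_coeff_def poly_upto.const)
  next
    case False
    then have "v \<in> ?I" using that assms by (auto simp: bivector_index_def pairs_def)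
    then show ?thesis
      using False poly_upto.add[OF poly_upto.const poly_upto.var] by (simp add: bivector_coeff_def)
  qed
  have vec: "poly_upto ?I 1 (\<lambda>t. cd x (graph_vec s t i))" if "i < 2 * s" "x < m" for i x
  proof -
    have "poly_upto ?I (1 + 0) (\<lambda>t. t (i, j) * cd x (e j))" if "j \<in> {2 * s..<m}" for j
    proof -
      have "(i, j) \<in> ?I" using that \<open>i < 2 * s\<close> by (auto simp: bivector_index_def)
      then show ?thesis unfolding One_nat_def by (intro poly_upto.mult poly_upto.var poly_upto.const)
    qed
    then have "poly_upto ?I 1 (\<lambda>t. cd x (e i) + (\<Sum>j\<in>{2 * s..<m}. t (i, j) * cd x (e j)))"
      by (intro poly_upto.add poly_upto.const poly_upto_sum) simp
    then show ?thesis using \<open>x < m\<close> by (simp add: graph_vec_def cd_add cd_sum cd_scale)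
  qed
  have wed: "poly_upto ?I 2 (\<lambda>t. l (wedge scale 2 [graph_vec s t i, graph_vec s t j]))"
    if "i < 2 * s" "j < 2 * s" for i j
  proof -
    let ?us = "[\<lambda>t. graph_vec s t i, \<lambda>t. graph_vec s t j]"
    have "poly_upto ?I (length ?us) (\<lambda>t. l (wedge scale 2 ([] @ map (\<lambda>u. u t) ?us)))"
      by (rule poly_upto_wedge[OF l]) (use vec that in auto)
    then show ?thesis by (simp add: numeral_2_eq_2)
  qed
  have "l (bivector_chart s t) = (\<Sum>v\<in>pairs s. bivector_coeff t v *
      l (wedge scale 2 [graph_vec s t (fst v), graph_vec s t (snd v)]))" for t
    by (simp add: bivector_chart_def functional_sum[OF l] functional_scale[OF l])
  moreover have "poly_upto ?I (1 + 2) (\<lambda>t. \<Sum>v\<in>pairs s. bivector_coeff t v *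
      l (wedge scale 2 [graph_vec s t (fst v), graph_vec s t (snd v)]))"
    by (intro poly_upto_sum poly_upto.mult coeff wed) (auto simp: pairs_def)
  ultimately show "poly_upto ?I (1 + 2) (\<lambda>t. l (bivector_chart s t))" by simp
qed

lemma bivector_chart_jet:
  assumes l: "Vector_Spaces.linear fscale (*) l"
  shows "jet (\<lambda>x. l (bivector_chart s (\<lambda>v. x * t v)))
    (\<Sum>v\<in>pairs s. symplectic v * l (wedge scale 2 [e (fst v), e (snd v)]))
    (\<Sum>v\<in>pairs s. symplectic v *
        ((\<Sum>j\<in>{2 * s..<m}. t (fst v, j) * l (wedge scale 2 [e j, e (snd v)])) +
         (\<Sum>j\<in>{2 * s..<m}. t (snd v, j) * l (wedge scale 2 [e (fst v), e j])))
      + (if v = (0, 1) then 0 else t v) * l (wedge scale 2 [e (fst v), e (snd v)]))"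
proof -
  define y where "y i = (\<Sum>j\<in>{2 * s..<m}. scale (t (i, j)) (e j))" for i
  have gv: "graph_vec s (\<lambda>v. x * t v) i = e i + scale x (y i)" for x i
    by (simp add: graph_vec_def y_def scale_sum_right)
  have coeff: "jet (\<lambda>x. bivector_coeff (\<lambda>v. x * t v) v) (symplectic v) (if v = (0, 1) then 0 else t v)" for v
    using jet_affine[of "symplectic v" "t v"] jet_const[of "symplectic v"]
    by (cases "v = (0, 1)") (simp_all add: bivector_coeff_def)
  have left: "l (wedge scale 2 [y i, w]) = (\<Sum>j\<in>{2 * s..<m}. t (i, j) * l (wedge scale 2 [e j, w]))" for i w
    unfolding y_def using wedge_update_sum[of "[0, w]" 2 0 "\<lambda>j. t (i, j)" e "{2 * s..<m}"]
    by (simp add: functional_sum[OF l] functional_scale[OF l])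
  have right: "l (wedge scale 2 [w, y i]) = (\<Sum>j\<in>{2 * s..<m}. t (i, j) * l (wedge scale 2 [w, e j]))" for i w
    unfolding y_def using wedge_update_sum[of "[w, 0]" 2 1 "\<lambda>j. t (i, j)" e "{2 * s..<m}"]
    by (simp add: functional_sum[OF l] functional_scale[OF l])
  have wed: "jet (\<lambda>x. l (wedge scale 2 [e i + scale x (y i), e j + scale x (y j)]))
      (l (wedge scale 2 [e i, e j])) (l (wedge scale 2 [y i, e j]) + l (wedge scale 2 [e i, y j]))" for i j
    using jet_wedge_list[OF l, of "[]" "[(e i, y i), (e j, y j)]" 2]
    by (simp add: numeral_2_eq_2)
  have "jet (\<lambda>x. \<Sum>v\<in>pairs s. bivector_coeff (\<lambda>v. x * t v) v *
        l (wedge scale 2 [e (fst v) + scale x (y (fst v)), e (snd v) + scale x (y (snd v))]))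
     (\<Sum>v\<in>pairs s. symplectic v * l (wedge scale 2 [e (fst v), e (snd v)]))
     (\<Sum>v\<in>pairs s. symplectic v * (l (wedge scale 2 [y (fst v), e (snd v)]) + l (wedge scale 2 [e (fst v), y (snd v)]))
        + (if v = (0, 1) then 0 else t v) * l (wedge scale 2 [e (fst v), e (snd v)]))"
    by (intro jet_sum jet_mult coeff wed)
  then show ?thesis
    unfolding left right
    by (simp add: bivector_chart_def gv functional_sum[OF l] functional_scale[OF l])
qed

lemma coord_wedge2:
  assumes "p < m" "q < m" "p \<noteq> q" "a < m" "b < m" "a \<noteq> b"
  shows "coord [p, q] (wedge scale 2 [e a, e b])
    = (if a = p \<and> b = q then 1 else if a = q \<and> b = p then -1 else 0)"
proof -
  have same: "coord [p, q] (wedge scale 2 [e p, e q]) = 1"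
    using coord_wedge_basis[of "[p, q]" 2] assms(1-3) by simp
  have "coord [p, q] (wedge scale 2 [e q, e p]) = coord [p, q] (fscale (-1) (wedge scale 2 [e p, e q]))"
    unfolding wedge2_swap[of "e q" "e p"] by simp
  then have flip: "coord [p, q] (wedge scale 2 [e q, e p]) = -1"
    using same by (simp only: functional_scale[OF linear_eval_form] mult_1_right)
  consider "a = p" "b = q" | "a = q" "b = p" | "a \<notin> {p, q}" | "b \<notin> {p, q}" using assms(6) by auto
  then show ?thesis
  proof cases
    case 3
    then have "coord [p, q] (wedge scale 2 (map e [a, b])) = 0"
      using assms by (intro coord_wedge_other[of _ _ _ a]) auto
    then show ?thesis using 3 by auto
  next
    case 4
    then have "coord [p, q] (wedge scale 2 (map e [a, b])) = 0"
      using assms by (intro coord_wedge_other[of _ _ _ b]) auto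
    then show ?thesis using 4 by auto
  qed (use same flip assms(3) in auto)
qed

text \<open>
  The functionals for \<open>j < 2 s\<close> are coordinates, up to their constant terms.  Moving \<open>e\<^sub>i\<close> by \<open>e\<^sub>j\<close> with
  \<open>j \<ge> 2 s\<close> turns the summand with the symplectic partner of \<open>i\<close> into one with \<open>e\<^sub>j\<close> in place of \<open>e\<^sub>i\<close>, and
  this determines the coordinate to use; the partner of \<open>i\<close> is \<open>i + 1\<close> or \<open>i - 1\<close> according to parity.
\<close>

lemma bivector_chart_local_parameters:
  assumes s: "1 \<le> s" and m: "2 * s \<le> m"
  shows "local_parameters (bivector_index s) (bivector_chart s)"
proof -
  define l where "l = (\<lambda>(i, j). if j < 2 * s then (\<lambda>T. coord [i, j] T - symplectic (i, j) * coord [0, 1] T)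
    else if even i then coord [j, Suc i] else coord [i - 1, j])"
  have lin: "Vector_Spaces.linear fscale (*) (l v)" for v
  proof -
    have "Vector_Spaces.linear fscale (*) (\<lambda>T. c * coord [0, 1] T)" for c
      by (rule linear_functional_cmult[OF linear_eval_form])
    then show ?thesis
      by (auto simp: l_def simp del: list.map split: prod.split intro!: linear_eval_form linear_functional_diff)
  qed
  have low: "jet (\<lambda>x. coord [p, q] (bivector_chart s (\<lambda>v. x * t v))) (symplectic (p, q))
      (if (p, q) = (0, 1) then 0 else t (p, q))" if pq: "(p, q) \<in> pairs s" for p q t
  proof -
    have pq': "p < q" "q < 2 * s" "p < m" "q < m" using pq m by (auto simp: pairs_def)
    have 1: "coord [p, q] (wedge scale 2 [e (fst v), e (snd v)]) = (if v = (p, q) then 1 else 0)"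
      if "v \<in> pairs s" for v
      using that pq' m by (subst coord_wedge2) (auto simp: pairs_def)
    have 2: "coord [p, q] (wedge scale 2 [e j, e (snd v)]) = 0"
      if "v \<in> pairs s" "j \<in> {2 * s..<m}" for v j
      using that pq' m by (subst coord_wedge2) (auto simp: pairs_def)
    have 3: "coord [p, q] (wedge scale 2 [e (fst v), e j]) = 0"
      if "v \<in> pairs s" "j \<in> {2 * s..<m}" for v j
      using that pq' m by (subst coord_wedge2) (auto simp: pairs_def)
    have "(\<Sum>v\<in>pairs s. symplectic v * coord [p, q] (wedge scale 2 [e (fst v), e (snd v)]))
        = (\<Sum>v\<in>pairs s. if v = (p, q) then symplectic v else 0)"
      by (intro sum.cong refl) (simp add: 1 del: list.map)
    moreover have "(\<Sum>v\<in>pairs s. symplectic v *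
        ((\<Sum>j\<in>{2 * s..<m}. t (fst v, j) * coord [p, q] (wedge scale 2 [e j, e (snd v)])) +
         (\<Sum>j\<in>{2 * s..<m}. t (snd v, j) * coord [p, q] (wedge scale 2 [e (fst v), e j])))
      + (if v = (0, 1) then 0 else t v) * coord [p, q] (wedge scale 2 [e (fst v), e (snd v)]))
      = (\<Sum>v\<in>pairs s. if v = (p, q) then (if v = (0, 1) then 0 else t v) else 0)"
      by (intro sum.cong refl) (simp add: 1 2 3 del: list.map)
    ultimately show ?thesis
      using bivector_chart_jet[OF linear_eval_form[of "map cd [p, q]"], of s t] pq by simp
  qed
  have high: "jet (\<lambda>x. l (i, j) (bivector_chart s (\<lambda>v. x * t v))) 0 (t (i, j))"
    if ij: "i < 2 * s" "2 * s \<le> j" "j < m" for i j t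
  proof -
    have distinct: "j \<noteq> a" if "a < 2 * s" for a using that ij by simp
    \<comment> \<open>\<open>(p, Suc p)\<close> is the symplectic pair that contains \<open>i\<close>.\<close>
    define p where "p = (if even i then i else i - 1)"
    have p: "even p" "Suc p < 2 * s" using ij(1) unfolding p_def by presburger+
    have p_in: "(p, Suc p) \<in> pairs s" using p by (simp add: pairs_def)
    define J where "J = (if even i then [j, Suc i] else [i - 1, j])"
    have lJ: "l (i, j) = coord J" using ij by (simp add: l_def J_def)
    have J: "J = (if even i then [j, Suc p] else [p, j])" "i = (if even i then p else Suc p)"
      unfolding J_def p_def by presburger+
    have 1: "coord J (wedge scale 2 [e (fst v), e (snd v)]) = 0" if "v \<in> pairs s" for v
      unfolding J(1) using that p m ij by (auto simp: pairs_def coord_wedge2 simp del: list.map)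
    have 2: "coord J (wedge scale 2 [e q, e (snd v)]) = (if even i \<and> snd v = Suc p \<and> q = j then 1
        else if odd i \<and> snd v = p \<and> q = j then -1 else 0)"
      if "v \<in> pairs s" "q \<in> {2 * s..<m}" for v q
      unfolding J(1) using that p m ij by (auto simp: pairs_def coord_wedge2 simp del: list.map)
    have 3: "coord J (wedge scale 2 [e (fst v), e q]) = (if odd i \<and> fst v = p \<and> q = j then 1
        else if even i \<and> fst v = Suc p \<and> q = j then -1 else 0)"
      if "v \<in> pairs s" "q \<in> {2 * s..<m}" for v q
      unfolding J(1) using that p m ij by (auto simp: pairs_def coord_wedge2 simp del: list.map)
    have "(\<Sum>v\<in>pairs s. symplectic v * coord J (wedge scale 2 [e (fst v), e (snd v)])) = 0"
      by (intro sum.neutral) (simp add: 1)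
    moreover have "(\<Sum>v\<in>pairs s. symplectic v *
        ((\<Sum>q\<in>{2 * s..<m}. t (fst v, q) * coord J (wedge scale 2 [e q, e (snd v)])) +
         (\<Sum>q\<in>{2 * s..<m}. t (snd v, q) * coord J (wedge scale 2 [e (fst v), e q])))
      + (if v = (0, 1) then 0 else t v) * coord J (wedge scale 2 [e (fst v), e (snd v)]))
      = (\<Sum>v\<in>pairs s. if v = (p, Suc p) then t (i, j) else 0)"
    proof (intro sum.cong refl)
      fix v assume v: "v \<in> pairs s"
      have A: "(\<Sum>q\<in>{2 * s..<m}. t (fst v, q) * coord J (wedge scale 2 [e q, e (snd v)]))
          = (\<Sum>q\<in>{2 * s..<m}. if q = j then t (fst v, q) * (if even i \<and> snd v = Suc p then 1
            else if odd i \<and> snd v = p then -1 else 0) else 0)"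
        by (intro sum.cong refl) (simp add: 2 v)
      have B: "(\<Sum>q\<in>{2 * s..<m}. t (snd v, q) * coord J (wedge scale 2 [e (fst v), e q]))
          = (\<Sum>q\<in>{2 * s..<m}. if q = j then t (snd v, q) * (if odd i \<and> fst v = p then 1
            else if even i \<and> fst v = Suc p then -1 else 0) else 0)"
        by (intro sum.cong refl) (simp add: 3 v)
      obtain a b where ab: "v = (a, b)" by (cases v)
      show "symplectic v *
        ((\<Sum>q\<in>{2 * s..<m}. t (fst v, q) * coord J (wedge scale 2 [e q, e (snd v)])) +
         (\<Sum>q\<in>{2 * s..<m}. t (snd v, q) * coord J (wedge scale 2 [e (fst v), e q])))
        + (if v = (0, 1) then 0 else t v) * coord J (wedge scale 2 [e (fst v), e (snd v)])
        = (if v = (p, Suc p) then t (i, j) else 0)"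
        unfolding A B 1[OF v] using ij p(1) J(2)
        by (cases "even i") (auto simp: symplectic_def ab)
    qed
    ultimately show ?thesis
      unfolding lJ using bivector_chart_jet[OF linear_eval_form[of "map cd J"], of s t] p_in by simp
  qed
  have base: "jet (\<lambda>x. coord [0, 1] (bivector_chart s (\<lambda>v. x * t v))) 1 0" for t
    using low[of 0 1 t] s by (simp add: pairs_def symplectic_def)
  have "jet (\<lambda>x. l v (bivector_chart s (\<lambda>v. x * t v))) 0 (t v)" if v: "v \<in> bivector_index s" for v t
  proof -
    obtain i j where "v = (i, j)" by (cases v)
    then have ij: "v = (i, j)" "i < 2 * s" "i < j" "j < m" "(i, j) \<noteq> (0, 1)"
      using v by (simp_all add: bivector_index_def)
    show ?thesis
    proof (cases "j < 2 * s")
      case True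
      then have "(i, j) \<in> pairs s" using ij by (simp add: pairs_def)
      from low[OF this, of t]
      have "jet (\<lambda>x. coord [i, j] (bivector_chart s (\<lambda>v. x * t v))) (symplectic (i, j)) (t (i, j))"
        unfolding if_not_P[OF ij(5)] .
      from jet_diff[OF this jet_mult[OF jet_const[of "symplectic (i, j)"] base[of t]]]
      show ?thesis using ij True by (simp add: l_def)
    next
      case False
      then show ?thesis using high[of i j t] ij by simp
    qed
  qed
  then show ?thesis
    unfolding local_parameters_def using base lin
    by (intro exI[of _ "coord [0, 1]"] exI[of _ l]) (auto intro: linear_eval_form)
qed

lemma bivector_chart_in_wedge_sums: "bivector_chart s t \<in> wedge_sums 2 s"
proof -
  let ?E = "graph_vec s t ` {..<2 * s}"
  have "wedge scale 2 [graph_vec s t (fst v), graph_vec s t (snd v)] \<in> bivectors ?E" if "v \<in> pairs s" for v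
    using that by (intro wedge2_in_bivectors span_base imageI) (auto simp: pairs_def)
  then have "bivector_chart s t \<in> bivectors ?E"
    unfolding bivector_chart_def bivectors_def
    by (intro fun_space.span_sum fun_space.span_scale)
  then have "bivector_chart s t \<in> wedge_sums 2 (card ?E div 2)" using bivectors_wedge_sums[of ?E] by blast
  moreover have "card ?E \<le> 2 * s" using card_image_le[of "{..<2 * s}" "graph_vec s t"] by simp
  then have "card ?E div 2 \<le> s" by linarith
  ultimately show ?thesis using wedge_sums_mono[of 2 "card ?E div 2" s] by auto
qed

lemma wedge2_dual_expand:
  assumes "2 * s \<le> m" "1 \<le> s"
    and dual: "\<And>i j. i < 2 * s \<Longrightarrow> j < 2 * s \<Longrightarrow> cd i (u j) = (if i = j then 1 else 0)"
    and T: "T \<in> bivectors (u ` {..<2 * s})"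
  shows "\<exists>c. T = (\<Sum>v\<in>pairs s. fscale (c v) (wedge scale 2 [u (fst v), u (snd v)])) \<and> coord [0, 1] T = c (0, 1)"
proof -
  let ?f = "\<lambda>v. wedge scale 2 [u (fst v), u (snd v)]"
  have "bivectors (u ` {..<2 * s}) \<subseteq> fun_space.span (?f ` pairs s)"
    unfolding bivectors_def
  proof (rule fun_space.span_minimal[OF _ fun_space.subspace_span], rule subsetI)
    fix w assume "w \<in> {wedge scale 2 [x, y] | x y. x \<in> span (u ` {..<2 * s}) \<and> y \<in> span (u ` {..<2 * s})}"
    then obtain x y where w: "w = wedge scale 2 [x, y]"
      and xy: "x \<in> span (u ` {..<2 * s})" "y \<in> span (u ` {..<2 * s})" by blast
    have "wedge scale 2 ([] @ [x, y]) \<in> fun_space.span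
        {wedge scale 2 ([] @ ws) | ws. length ws = length [x, y] \<and> set ws \<subseteq> u ` {..<2 * s}}"
      by (rule wedge_expand) (use xy in auto)
    also have "\<dots> \<subseteq> fun_space.span (?f ` pairs s)"
    proof (rule fun_space.span_minimal[OF _ fun_space.subspace_span], rule subsetI)
      fix w assume "w \<in> {wedge scale 2 ([] @ ws) | ws. length ws = length [x, y] \<and> set ws \<subseteq> u ` {..<2 * s}}"
      then obtain a b where w: "w = wedge scale 2 [u a, u b]" "a < 2 * s" "b < 2 * s"
        by (auto simp: length_Suc_conv)
      consider "a = b" | "a < b" | "b < a" by linarith
      then show "w \<in> fun_space.span (?f ` pairs s)"
      proof cases
        case 1
        then show ?thesis unfolding w(1) by (simp only: wedge2_self fun_space.span_zero)
      next
        case 2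
        then have "?f (a, b) \<in> ?f ` pairs s" using w by (intro imageI) (simp add: pairs_def)
        then show ?thesis unfolding w(1) using fun_space.span_base by simp
      next
        case 3
        then have "?f (b, a) \<in> ?f ` pairs s" using w by (intro imageI) (simp add: pairs_def)
        then show ?thesis unfolding w(1) wedge2_swap[of "u a"]
            by (intro fun_space.span_neg fun_space.span_base) simp
      qed
    qed
    finally show "w \<in> fun_space.span (?f ` pairs s)" using w by simp
  qed
  then obtain c where c: "T = (\<Sum>v\<in>pairs s. fscale (c v) (?f v))"
    using fun_space.span_finite_family[of "pairs s" T ?f] T by auto
  have sub: "set [0, 1] \<subseteq> {..<m}" using assms(1,2) by auto
  have "coord [0, 1] (?f v) = (if v = (0, 1) then 1 else 0)" if v: "v \<in> pairs s" for v
  proof (cases "v = (0, 1)")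
    case True
    have "coord [0, 1] (wedge scale 2 [u 0, u 1]) = 1"
      by (rule coord_wedge_dual[OF sub]) (use dual assms(2) in \<open>auto simp: less_2_cases_iff\<close>)
    then show ?thesis using True by simp
  next
    case False
    obtain a b where ab: "v = (a, b)" "a < b" "b < 2 * s" using v by (auto simp: pairs_def)
    then have "b \<noteq> 0" "b \<noteq> 1" using False by auto
    then have "detform (map cd [0, 1]) [u a, u b] = 0"
      using ab dual assms(2) by (intro detform_zero_column[of 1]) (auto simp: less_Suc_eq)
    then show ?thesis using False coord_wedge[OF sub, of 2 "[u a, u b]"] ab by simp
  qed
  then have "coord [0, 1] T = (\<Sum>v\<in>pairs s. if v = (0, 1) then c v else 0)"
    unfolding c functional_sum[OF linear_eval_form] functional_scale[OF linear_eval_form]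
    by (intro sum.cong refl) simp
  moreover have "(0, 1) \<in> pairs s" using assms(2) by (simp add: pairs_def)
  ultimately have "coord [0, 1] T = c (0, 1)" by simp
  then show ?thesis using c by blast
qed

text \<open>
  As for \<open>secant_chart_dominates\<close>: \<open>g\<close> is nonzero where the supporting subspace is a graph over the
  first \<open>2 s\<close> coordinates, and the coordinate \<open>[0, 1]\<close> is nonzero where the bivector can be normalised.
\<close>

lemma bivector_chart_dominates:
  assumes m: "2 * s \<le> m" and s: "1 \<le> s"
  shows "dominates (range (bivector_chart s)) (wedge_sums 2 s)"
proof -
  have "p T = 0" if p: "homogeneous fscale d p" "\<forall>w\<in>range (bivector_chart s). p w = 0"
    and T: "T \<in> wedge_sums 2 s" for d p T
  proof -
    define z where "z t = generic_vec t" for t :: "nat \<times> nat \<Rightarrow> 'a"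
    define \<Phi> where "\<Phi> t = (\<Sum>b<s. wedge scale 2 (map (z t) [2 * b, Suc (2 * b)]))" for t
    define g where "g t = coord [0..<2 * s] (wedge scale (2 * s) (map (z t) [0..<2 * s]))" for t
    have sub: "set [0..<2 * s] \<subseteq> {..<m}" using m by auto
    have pm: "polynomial_map UNIV 2 \<Phi>"
      unfolding polynomial_map_def \<Phi>_def z_def
      by (auto simp: functional_sum simp del: list.map intro!: poly_upto_sum poly_upto_generic_wedge)
    have pp: "poly_upto UNIV (2 * d) (\<lambda>t. p (\<Phi> t))" by (rule homogeneous_pullback[OF p(1) pm])
    have pg: "poly_upto UNIV (2 * s) g"
      unfolding g_def z_def by (intro poly_upto_generic_wedge linear_eval_form) simp
    have pa: "poly_upto UNIV 2 (\<lambda>t. coord [0, 1] (\<Phi> t))"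
      using pm linear_eval_form unfolding polynomial_map_def by blast
    have zero: "p (\<Phi> t) * (g t * coord [0, 1] (\<Phi> t)) = 0" for t
    proof (cases "g t = 0 \<or> coord [0, 1] (\<Phi> t) = 0")
      case True
      then show ?thesis by auto
    next
      case False
      then have "detform (map cd [0..<2 * s]) (map (z t) [0..<2 * s]) \<noteq> 0"
        unfolding g_def coord_wedge[OF sub, of "2 * s", simplified] by blast
      from chart_vectors[OF sub _ _ _ this, of "2 * s"]
      obtain us where us: "length us = 2 * s"
        "\<forall>i<2 * s. \<forall>j<2 * s. cd ([0..<2 * s] ! i) (us ! j) = (if i = j then 1 else 0)"
        "\<forall>v\<in>set (map (z t) [0..<2 * s]). v = (\<Sum>i<2 * s. scale (cd ([0..<2 * s] ! i) v) (us ! i))"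
        by auto
      define u where "u i = us ! i" for i
      have dual: "cd i (u j) = (if i = j then 1 else 0)" if "i < 2 * s" "j < 2 * s" for i j
        using us(2) that by (simp add: u_def)
      have zspan: "z t i \<in> span (u ` {..<2 * s})" if "i < 2 * s" for i
      proof -
        have "(\<Sum>q<2 * s. scale (cd ([0..<2 * s] ! q) (z t i)) (us ! q)) \<in> span (u ` {..<2 * s})"
          by (intro span_sum span_scale span_base) (auto simp: u_def)
        moreover have "z t i = (\<Sum>q<2 * s. scale (cd ([0..<2 * s] ! q) (z t i)) (us ! q))"
          using us(3) that by (intro bspec[OF us(3)]) auto
        ultimately show ?thesis by metis
      qed
      have "\<Phi> t \<in> bivectors (u ` {..<2 * s})"
        unfolding \<Phi>_def bivectors_def
      proof (intro fun_space.span_sum)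
        fix b assume "b \<in> {..<s}"
        then have "wedge scale 2 [z t (2 * b), z t (Suc (2 * b))] \<in> bivectors (u ` {..<2 * s})"
          by (intro wedge2_in_bivectors zspan) auto
        then show "wedge scale 2 (map (z t) [2 * b, Suc (2 * b)]) \<in> fun_space.span
            {wedge scale 2 [x, y] | x y. x \<in> span (u ` {..<2 * s}) \<and> y \<in> span (u ` {..<2 * s})}"
          unfolding bivectors_def by simp
      qed
      from wedge2_dual_expand[OF m s dual this]
      obtain c where c: "\<Phi> t = (\<Sum>v\<in>pairs s. fscale (c v) (wedge scale 2 [u (fst v), u (snd v)]))"
        "coord [0, 1] (\<Phi> t) = c (0, 1)" by blast
      define r where "r v = (if snd v < 2 * s then c v / c (0, 1) - symplectic v else cd (snd v) (u (fst v)))" for v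
      have c0: "c (0, 1) \<noteq> 0" using False c(2) by simp
      have gv: "graph_vec s r i = u i" if "i < 2 * s" for i
      proof -
        have "u i = e ([0..<2 * s] ! i) + (\<Sum>j\<in>{..<m} - set [0..<2 * s]. scale (cd j (u i)) (e j))"
          by (rule dual_vector_expand[OF sub]) (use that dual in auto)
        moreover have "{..<m} - set [0..<2 * s] = {2 * s..<m}" by auto
        ultimately show ?thesis using that by (simp add: graph_vec_def r_def)
      qed
      have "\<Phi> t = fscale (c (0, 1)) (bivector_chart s r)"
        unfolding c(1) bivector_chart_def fun_space.scale_sum_right
      proof (intro sum.cong refl)
        fix v assume v: "v \<in> pairs s"
        then have "c v = c (0, 1) * bivector_coeff r v"
          using c0 by (auto simp: bivector_coeff_def r_def pairs_def symplectic_def)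
        moreover have "graph_vec s r (fst v) = u (fst v)" "graph_vec s r (snd v) = u (snd v)"
          using v by (auto simp: pairs_def intro!: gv)
        ultimately show "fscale (c v) (wedge scale 2 [u (fst v), u (snd v)]) = fscale (c (0, 1))
            (fscale (bivector_coeff r v) (wedge scale 2 [graph_vec s r (fst v), graph_vec s r (snd v)]))"
          by (simp only: fun_space.scale_scale)
      qed
      then have "p (\<Phi> t) = 0" using p by (simp add: homogeneous_def)
      then show ?thesis by simp
    qed
    have "(\<forall>t. p (\<Phi> t) = 0) \<or> (\<forall>t. g t * coord [0, 1] (\<Phi> t) = 0)"
      by (rule poly_upto_mult_eq_0[OF pp poly_upto.mult[OF pg pa] zero])
    \<comment> \<open>Both factors are \<open>1\<close> at \<open>e\<^sub>0 \<and> e\<^sub>1 + e\<^sub>2 \<and> e\<^sub>3 + \<dots>\<close>.\<close>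
    moreover have "g t0 * coord [0, 1] (\<Phi> t0) = 1" if t0: "t0 = (\<lambda>(i, j). cd j (e i))" for t0
    proof -
      have z0: "z t0 i = e i" for i unfolding t0 z_def by (rule generic_vec_coords)
      have z0': "z t0 = e" by (rule ext) (rule z0)
      have "g t0 = 1" unfolding g_def z0' by (rule coord_wedge_basis[OF sub]) auto
      moreover have "coord [0, 1] (\<Phi> t0) = (\<Sum>b<s. coord [0, 1] (wedge scale 2 [e (2 * b), e (Suc (2 * b))]))"
        unfolding \<Phi>_def z0' functional_sum[OF linear_eval_form] by simp
      moreover have "\<dots> = (\<Sum>b<s. if b = 0 then 1 else 0)"
        by (intro sum.cong refl, subst coord_wedge2) (use m in auto)
      ultimately show ?thesis using s by simp
    qed
    ultimately have pz: "p (\<Phi> t) = 0" for t by (metis zero_neq_one)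
    obtain f where f: "T = (\<Sum>b<s. f b)" "\<And>b. b < s \<Longrightarrow> f b \<in> decomposable 2"
      using T unfolding wedge_sums_def by blast
    have "\<forall>b<s. \<exists>vs. f b = wedge scale 2 vs \<and> length vs = 2"
      using f(2) unfolding decomposable_def by blast
    then obtain vs where vs: "\<And>b. b < s \<Longrightarrow> f b = wedge scale 2 (vs b) \<and> length (vs b) = 2" by metis
    have T\<Phi>: "T = \<Phi> (\<lambda>(i, j). cd j (vs (i div 2) ! (i mod 2)))"
      unfolding f(1) \<Phi>_def
    proof (intro sum.cong refl)
      fix b assume "b \<in> {..<s}"
      then have b: "f b = wedge scale 2 (vs b)" "length (vs b) = 2" using vs by auto
      have gv: "z (\<lambda>(i, j). cd j (vs (i div 2) ! (i mod 2))) i = vs (i div 2) ! (i mod 2)" for i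
        unfolding z_def by (rule generic_vec_coords)
      have "map (z (\<lambda>(i, j). cd j (vs (i div 2) ! (i mod 2)))) [2 * b, Suc (2 * b)] = [vs b ! 0, vs b ! 1]"
        by (simp add: gv)
      also have "\<dots> = vs b" using b(2) by (auto simp: numeral_2_eq_2 length_Suc_conv)
      finally show "f b = wedge scale 2 (map (z (\<lambda>(i, j). cd j (vs (i div 2) ! (i mod 2)))) [2 * b, Suc (2 * b)])"
        unfolding b(1) by (simp only:)
    qed
    show "p T = 0" unfolding T\<Phi> by (rule pz)
  qed
  then show ?thesis unfolding dominates_def by blast
qed

end

section \<open>Dimensions of secant varieties\<close>

lemma closed_zero_locus_affine:
  fixes W :: "('c \<Rightarrow> 'a::field) set"
  assumes "poly_fun fscale p"
  shows "closedin (affine_zariski fscale W) {w \<in> W. p w = 0}"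
    and "topspace (affine_zariski fscale W) = W"
proof -
  have sub: "U \<subseteq> W" if "openin (affine_zariski fscale W) U" for U
    using that unfolding openin_affine_zariski by (elim exE conjE) simp
  have "openin (affine_zariski fscale W) {w \<in> W. \<exists>q\<in>{\<lambda>_ :: 'c \<Rightarrow> 'a. 1 :: 'a}. q w \<noteq> 0}"
    unfolding openin_affine_zariski
    by (rule exI[of _ "{\<lambda>_. 1}"]) (auto intro: poly_fun.const)
  then have W: "openin (affine_zariski fscale W) W" by simp
  show top: "topspace (affine_zariski fscale W) = W"
    using openin_subset[OF W] sub[OF openin_topspace] by blast
  have "openin (affine_zariski fscale W) {w \<in> W. \<exists>q\<in>{p}. q w \<noteq> 0}"
    unfolding openin_affine_zariski by (rule exI[of _ "{p}"]) (use assms in auto)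
  moreover have "W - {w \<in> W. p w = 0} = {w \<in> W. \<exists>q\<in>{p}. q w \<noteq> 0}" by auto
  ultimately show "closedin (affine_zariski fscale W) {w \<in> W. p w = 0}"
    unfolding closedin_def top by auto
qed

context char0_space
begin

text \<open>
  Allowing any set between the points of the cone and their closure covers the Grassmannian, which
  is taken without closure, as well as the secant varieties.
\<close>

lemma variety_dim_of_chart:
  fixes \<phi> :: "('i \<Rightarrow> 'a) \<Rightarrow> ('v list \<Rightarrow> 'a) \<Rightarrow> 'a" and k :: nat
  defines "W \<equiv> exterior_power scale k"
  assumes I: "finite I" and \<phi>: "polynomial_map I \<delta> \<phi>" "local_parameters I \<phi>"
    and range: "range \<phi> \<subseteq> wedge_sums k s" and dom: "dominates (range \<phi>) (wedge_sums k s)"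
    and Z: "proj_space fscale (wedge_sums k s) \<subseteq> Z"
      "Z \<subseteq> proj_zariski fscale W closure_of proj_space fscale (wedge_sums k s)"
  shows "variety_dim fscale W Z = enat (card I)"
proof -
  have ZW: "Z \<subseteq> proj_space fscale W"
    by (rule order_trans[OF Z(2) closure_of_subset_topspace, unfolded topspace_proj_zariski])
  have "p w = 0" if p: "homogeneous fscale d p" "\<forall>w\<in>range \<phi>. p w = 0" and w: "w \<in> \<Union>Z" for d p w
  proof -
    have 0: "p T = 0" if "T \<in> wedge_sums k s" for T
      using dom p that unfolding dominates_def by blast
    let ?V = "{L \<in> proj_space fscale W. \<forall>w\<in>L. p w = 0}"
    have "proj_space fscale (wedge_sums k s) \<subseteq> ?V"
    proof
      fix L assume L: "L \<in> proj_space fscale (wedge_sums k s)"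
      then obtain T where "T \<in> wedge_sums k s" "L = fun_space.span {T}" unfolding proj_space_def by blast
      then have "\<forall>w\<in>L. p w = 0" using homogeneous_zero_on_line[OF p(1) 0] by blast
      then show "L \<in> ?V" using L Z(1) ZW by blast
    qed
    then have "proj_zariski fscale W closure_of proj_space fscale (wedge_sums k s) \<subseteq> ?V"
      by (rule closure_of_minimal[OF _ closedin_zero_locus[OF p(1)]])
    then show ?thesis using w Z(2) by blast
  qed
  then have domZ: "dominates (range \<phi>) (\<Union>Z)" unfolding dominates_def by blast
  have "proj_space fscale (range \<phi>) \<subseteq> proj_space fscale (wedge_sums k s)"
    using range unfolding proj_space_def by blast
  then have "proj_space fscale (range \<phi>) \<subseteq> Z" using Z(1) by blast
  then show ?thesis
    unfolding variety_dim_def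
    using krull_dim_le_parameters[OF ZW I \<phi>(1) domZ] krull_dim_ge_parameters[OF ZW I \<phi>]
    by (intro antisym)
qed

lemma wedge_sums_list:
  "T \<in> wedge_sums k r \<longleftrightarrow>
    (\<exists>vss. length vss = r \<and> (\<forall>vs\<in>set vss. length vs = k) \<and> T = sum_list (map (wedge scale k) vss))"
proof
  assume "T \<in> wedge_sums k r"
  then obtain f where f: "T = (\<Sum>i<r. f i)" "\<And>i. i < r \<Longrightarrow> f i \<in> decomposable k"
    unfolding wedge_sums_def by blast
  then have "\<forall>i<r. \<exists>vs. f i = wedge scale k vs \<and> length vs = k" unfolding decomposable_def by blast
  then obtain v where v: "\<And>i. i < r \<Longrightarrow> f i = wedge scale k (v i)" "\<And>i. i < r \<Longrightarrow> length (v i) = k" by metis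
  have "sum_list (map (wedge scale k) (map v [0..<r])) = (\<Sum>i<r. wedge scale k (v i))"
    by (simp add: sum_list_sum_nth atLeast0LessThan)
  also have "\<dots> = T" unfolding f(1) using v(1) by (intro sum.cong) auto
  finally show "\<exists>vss. length vss = r \<and> (\<forall>vs\<in>set vss. length vs = k) \<and> T = sum_list (map (wedge scale k) vss)"
    using v(2) by (intro exI[of _ "map v [0..<r]"]) auto
next
  assume "\<exists>vss. length vss = r \<and> (\<forall>vs\<in>set vss. length vs = k) \<and> T = sum_list (map (wedge scale k) vss)"
  then obtain vss where vss: "length vss = r" "\<forall>vs\<in>set vss. length vs = k"
    "T = sum_list (map (wedge scale k) vss)" by blast
  have "T = (\<Sum>i<r. wedge scale k (vss ! i))"
    unfolding vss(3) using vss(1) by (simp add: sum_list_sum_nth atLeast0LessThan)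
  moreover have "\<forall>i<r. wedge scale k (vss ! i) \<in> decomposable k"
    using vss(1,2) unfolding decomposable_def by auto
  ultimately show "T \<in> wedge_sums k r" unfolding wedge_sums_def by blast
qed

lemma wedge_rank_wedge_sums:
  assumes "T \<in> wedge_sums k s"
  shows "T \<in> wedge_sums k (wedge_rank scale k T)" "wedge_rank scale k T \<le> s"
proof -
  have eq: "wedge_rank scale k T = (LEAST r. T \<in> wedge_sums k r)"
    unfolding wedge_rank_def wedge_sums_list ..
  show "T \<in> wedge_sums k (wedge_rank scale k T)" unfolding eq using assms by (rule LeastI)
  show "wedge_rank scale k T \<le> s" unfolding eq using assms by (rule Least_le)
qed

lemma ex_based_space:
  assumes "dim (UNIV :: 'v set) = m" "0 < m"
  shows "\<exists>e cd. based_space scale e cd m"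
proof -
  obtain B where B: "independent B" "UNIV \<subseteq> span B" "card B = m"
    using basis_exists[of UNIV] assms(1) by metis
  have finB: "finite B" using B(3) assms(2) card_ge_0_finite by blast
  obtain e where e: "bij_betw e {..<m} B"
    using ex_bij_betw_nat_finite[OF finB] B(3) unfolding lessThan_atLeast0[symmetric] by blast
  have eB: "e i \<in> B" if "i < m" for i using e that by (auto simp: bij_betw_def)
  have "\<exists>c. Vector_Spaces.linear scale (*) c \<and> (\<forall>b\<in>B. c b = (if b = e i then 1 else 0 :: 'a))" for i
    using form.linear_independent_extend[OF B(1), of "\<lambda>b. if b = e i then 1 else 0"] by blast
  then obtain cd where cd: "\<And>i. Vector_Spaces.linear scale (*) (cd i)"
    "\<And>i b. b \<in> B \<Longrightarrow> cd i b = (if b = e i then 1 else 0 :: 'a)" by metis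
  have cd_e: "cd i (e j) = (if i = j then 1 else 0)" if "i < m" "j < m" for i j
    using cd(2)[OF eB[OF that(2)]] e that by (auto simp: bij_betw_def inj_on_def)
  have "v = (\<Sum>i<m. scale (cd i v) (e i))" for v
  proof -
    obtain q where "v = (\<Sum>b\<in>B. scale (q b) b)" using B(2) span_finite[OF finB] by auto
    also have "\<dots> = (\<Sum>i<m. scale (q (e i)) (e i))" by (rule sum.reindex_bij_betw[OF e, symmetric])
    finally have v: "v = (\<Sum>i<m. scale (q (e i)) (e i))" .
    have "cd i v = q (e i)" if i: "i < m" for i
    proof -
      have "cd i v = (\<Sum>j<m. q (e j) * cd i (e j))"
        unfolding v form.linear_sum[OF cd(1)] form.linear_scale[OF cd(1)] ..
      also have "\<dots> = (\<Sum>j<m. if j = i then q (e j) else 0)"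
        by (intro sum.cong refl) (use i in \<open>auto simp: cd_e\<close>)
      finally show ?thesis using i by simp
    qed
    then have "(\<Sum>i<m. scale (cd i v) (e i)) = (\<Sum>i<m. scale (q (e i)) (e i))" by (intro sum.cong) auto
    then show ?thesis using v by (rule trans[OF _ sym, rotated])
  qed
  then show ?thesis using cd(1) cd_e
    by (intro exI[of _ e] exI[of _ cd] based_space.intro char0_space_axioms based_space_axioms.intro) blast+
qed

end

context based_space
begin

text \<open>
  The points of disjoint blocks of basis vectors.
\<close>

lemma coordinate_points:
  assumes "k * s \<le> m" "1 \<le> k"
  shows "\<exists>Q. Q \<subseteq> proj_space fscale (decomposable k) \<and> finite Q \<and> card Q = s"
proof -
  let ?w = "\<lambda>b. wedge scale k (map e (block k b))"
  have c: "coord (block k b') (?w b) = (if b = b' then 1 else 0)" if "b < s" "b' < s" for b b'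
    using coord_block_block[OF assms that] .
  have "inj_on (\<lambda>b. fun_space.span {?w b}) {..<s}"
  proof (rule inj_onI)
    fix b b' assume b: "b \<in> {..<s}" "b' \<in> {..<s}" and eq: "fun_space.span {?w b} = fun_space.span {?w b'}"
    have "?w b \<in> fun_space.span {?w b'}" using eq fun_space.span_base[of "?w b" "{?w b}"] by simp
    then obtain r where "?w b = fscale r (?w b')" by (auto simp: fun_space.span_singleton)
    then have "coord (block k b) (?w b) = r * coord (block k b) (?w b')"
      by (simp only: functional_scale[OF linear_eval_form])
    then show "b = b'" using c b by (auto split: if_splits)
  qed
  then have "card ((\<lambda>b. fun_space.span {?w b}) ` {..<s}) = s" by (simp add: card_image)
  moreover have "fun_space.span {?w b} \<in> proj_space fscale (decomposable k)" if "b < s" for b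
  proof -
    have "?w b \<noteq> 0" using c[OF that that] by (auto simp: eval_form_def)
    moreover have "?w b \<in> decomposable k" unfolding decomposable_def by auto
    ultimately show ?thesis unfolding proj_space_def by blast
  qed
  ultimately show ?thesis by (intro exI[of _ "(\<lambda>b. fun_space.span {?w b}) ` {..<s}"]) auto
qed

lemma secant_variety_eq:
  assumes "k * s \<le> m" "1 \<le> k"
  shows "secant_variety fscale (exterior_power scale k) (plucker scale k ` grassmannian scale k) s
    = proj_zariski fscale (exterior_power scale k) closure_of proj_space fscale (wedge_sums k s)"
proof -
  obtain Q where "Q \<subseteq> proj_space fscale (decomposable k)" "finite Q" "card Q = s"
    using coordinate_points[OF assms] by blast
  then show ?thesis
    unfolding secant_variety_def plucker_grassmannian[OF assms(2)]
    by (simp only: secant_points[OF assms(2)])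
qed

lemma dimension_of_secant:
  fixes \<phi> :: "('i \<Rightarrow> 'a) \<Rightarrow> ('v list \<Rightarrow> 'a) \<Rightarrow> 'a"
  assumes "k * s \<le> m" "1 \<le> k" "finite I" "polynomial_map I \<delta> \<phi>" "local_parameters I \<phi>"
    "range \<phi> \<subseteq> wedge_sums k s" "dominates (range \<phi>) (wedge_sums k s)"
  shows "secant_dim fscale (exterior_power scale k) (plucker scale k ` grassmannian scale k) s = enat (card I)"
proof -
  have "proj_space fscale (wedge_sums k s) \<subseteq> topspace (proj_zariski fscale (exterior_power scale k))"
    unfolding topspace_proj_zariski proj_space_def using wedge_sums_in_exterior_power by blast
  then show ?thesis
    unfolding secant_dim_def secant_variety_eq[OF assms(1,2)]
    by (intro variety_dim_of_chart[OF assms(3-7)] closure_of_subset order_refl)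
qed

lemma dimension_of_grassmannian:
  fixes \<phi> :: "('i \<Rightarrow> 'a) \<Rightarrow> ('v list \<Rightarrow> 'a) \<Rightarrow> 'a"
  assumes "1 \<le> k" "finite I" "polynomial_map I \<delta> \<phi>" "local_parameters I \<phi>"
    "range \<phi> \<subseteq> wedge_sums k 1" "dominates (range \<phi>) (wedge_sums k 1)"
  shows "variety_dim fscale (exterior_power scale k) (plucker scale k ` grassmannian scale k) = enat (card I)"
proof -
  have "proj_space fscale (wedge_sums k 1) \<subseteq> topspace (proj_zariski fscale (exterior_power scale k))"
    unfolding topspace_proj_zariski proj_space_def using wedge_sums_in_exterior_power by blast
  then show ?thesis
    unfolding plucker_grassmannian[OF assms(1)] wedge_sums_1[symmetric]
    by (intro variety_dim_of_chart[OF assms(2-6)] closure_of_subset order_refl)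
qed

lemma span_basis: "span (e ` {..<m}) = UNIV"
proof -
  have "v \<in> span (e ` {..<m})" for v
    by (subst expand[of v]) (intro span_sum span_scale span_base imageI)
  then show ?thesis by blast
qed

lemma dim_exterior_power_ge:
  fixes \<phi> :: "('i \<Rightarrow> 'a) \<Rightarrow> ('v list \<Rightarrow> 'a) \<Rightarrow> 'a"
  assumes "finite I" "local_parameters I \<phi>" "range \<phi> \<subseteq> wedge_sums k s"
  shows "card I + 1 \<le> fun_space.dim (exterior_power scale k)"
proof -
  obtain B where "finite B" "exterior_power scale k \<subseteq> fun_space.span B"
    using exterior_power_finite_span[OF _ span_basis] by blast
  then show ?thesis
    using local_parameters_dim[OF assms(1,2), of "exterior_power scale k" B] assms(3)
      wedge_sums_in_exterior_power by blast
qed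

lemma exterior_square_eq:
  "exterior_power scale 2 = wedge_sums 2 (m div 2)"
proof -
  have "card (e ` {..<m}) div 2 \<le> m div 2"
    using card_image_le[of "{..<m}" e] by (intro div_le_mono) simp
  then show ?thesis
    using exterior_square_wedge_sums[OF _ span_basis] wedge_sums_in_exterior_power[of 2 "m div 2"]
      wedge_sums_mono[of 2 "card (e ` {..<m}) div 2" "m div 2"] by auto
qed

text \<open>
  With fewer than \<open>m div 2\<close> summands the chart has fewer parameters than the one for \<open>m div 2\<close>
  summands.  So some form vanishes on all these sums but not on all bivectors, and the sums are
  not dense.
\<close>

lemma typical_rank_two:
  assumes "4 \<le> m"
  shows "typical_rank scale 2 = m div 2"
  unfolding typical_rank_def
proof (rule Least_equality)
  let ?W = "exterior_power scale 2"
  let ?X = "affine_zariski fscale ?W"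
  have top: "topspace ?X = ?W" by (rule closed_zero_locus_affine(2)[OF poly_fun.const])
  show "\<exists>D\<subseteq>?W. ?X closure_of D = ?W \<and> (\<forall>T\<in>D. wedge_rank scale 2 T \<le> m div 2)"
  proof (intro exI conjI ballI)
    show "?X closure_of ?W = ?W" using closure_of_topspace[of ?X] unfolding top .
    show "wedge_rank scale 2 T \<le> m div 2" if "T \<in> ?W" for T
      using that wedge_rank_wedge_sums(2) unfolding exterior_square_eq by blast
  qed simp
  fix r assume "\<exists>D\<subseteq>?W. ?X closure_of D = ?W \<and> (\<forall>T\<in>D. wedge_rank scale 2 T \<le> r)"
  then obtain D where D: "D \<subseteq> ?W" "?X closure_of D = ?W" "\<And>T. T \<in> D \<Longrightarrow> wedge_rank scale 2 T \<le> r"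
    by blast
  show "m div 2 \<le> r"
  proof (rule ccontr)
    assume r: "\<not> m div 2 \<le> r"
    define s where "s = m div 2 - 1"
    have s: "1 \<le> s" "r \<le> s" "2 * s + 2 \<le> m" using r assms unfolding s_def by linarith+
    obtain q where q: "m = 2 * s + 2 + q" using s(3) le_Suc_ex by blast
    have "s * (2 * m - 2 * s - 1) - 1 < (s + 1) * (2 * m - 2 * (s + 1) - 1) - 1"
      using s(1) unfolding q by (simp add: algebra_simps)
    then have "\<not> dominates (range (bivector_chart s)) (range (bivector_chart (s + 1)))"
      using s by (intro not_dominates_of_fewer_parameters[OF card_bivector_index(1) bivector_chart_polynomial
          card_bivector_index(1) bivector_chart_local_parameters]) (simp_all add: card_bivector_index(2))
    then obtain d p t where p: "homogeneous fscale d p" "\<forall>w\<in>range (bivector_chart s). p w = 0"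
        "p (bivector_chart (s + 1) t) \<noteq> 0"
      unfolding dominates_def by blast
    have "dominates (range (bivector_chart s)) (wedge_sums 2 s)"
      by (rule bivector_chart_dominates) (use s in auto)
    then have "p T = 0" if "T \<in> wedge_sums 2 s" for T
      using p(1,2) that unfolding dominates_def by blast
    moreover have "D \<subseteq> wedge_sums 2 s"
    proof
      fix T assume T: "T \<in> D"
      then have "T \<in> wedge_sums 2 (wedge_rank scale 2 T)"
        using wedge_rank_wedge_sums(1) D(1) unfolding exterior_square_eq by blast
      then show "T \<in> wedge_sums 2 s"
        using wedge_sums_mono[of 2 "wedge_rank scale 2 T" s] D(3)[OF T] s(2) by auto
    qed
    ultimately have "D \<subseteq> {w \<in> ?W. p w = 0}" using D(1) by blast
    moreover have "closedin ?X {w \<in> ?W. p w = 0}"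
      using p(1) by (intro closed_zero_locus_affine(1)) (simp add: homogeneous_def)
    ultimately have "?W \<subseteq> {w \<in> ?W. p w = 0}" using closure_of_minimal[of D _ ?X] D(2) by simp
    moreover have "bivector_chart (s + 1) t \<in> ?W"
      using bivector_chart_in_wedge_sums wedge_sums_in_exterior_power by blast
    ultimately show False using p(3) by blast
  qed
qed

lemma bivector_secant_dim:
  assumes "1 \<le> s" "2 * s \<le> m"
  shows "secant_dim fscale (exterior_power scale 2) (plucker scale 2 ` grassmannian scale 2) s
      = enat (s * (2 * m - 2 * s - 1) - 1)"
    and "s * (2 * m - 2 * s - 1) \<le> fun_space.dim (exterior_power scale 2)"
proof -
  note I = card_bivector_index[OF assms]
  have range: "range (bivector_chart s) \<subseteq> wedge_sums 2 s" using bivector_chart_in_wedge_sums by blast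
  show "secant_dim fscale (exterior_power scale 2) (plucker scale 2 ` grassmannian scale 2) s
      = enat (s * (2 * m - 2 * s - 1) - 1)"
    using dimension_of_secant[OF assms(2) _ I(1) bivector_chart_polynomial[OF assms(2)]
        bivector_chart_local_parameters[OF assms] range bivector_chart_dominates[OF assms(2,1)]] I(2)
    by simp
  show "s * (2 * m - 2 * s - 1) \<le> fun_space.dim (exterior_power scale 2)"
    using dim_exterior_power_ge[OF I(1) bivector_chart_local_parameters[OF assms] range] I(2) by linarith
qed

lemma bivector_grassmannian_dim:
  assumes "2 \<le> m"
  shows "variety_dim fscale (exterior_power scale 2) (plucker scale 2 ` grassmannian scale 2)
      = enat (2 * m - 4)"
proof -
  have m: "2 * 1 \<le> m" using assms by simp
  have range: "range (bivector_chart 1) \<subseteq> wedge_sums 2 1" using bivector_chart_in_wedge_sums by blast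
  have "card (bivector_index 1) = 2 * m - 4" using card_bivector_index(2)[OF _ m] by simp
  then show ?thesis
    using dimension_of_grassmannian[OF _ card_bivector_index(1)[OF _ m] bivector_chart_polynomial[OF m]
        bivector_chart_local_parameters[OF _ m] range bivector_chart_dominates[OF m]] by simp
qed

lemma block_secant_dim:
  assumes "1 \<le> s" "3 \<le> k" "k * s \<le> m"
  shows "secant_dim fscale (exterior_power scale k) (plucker scale k ` grassmannian scale k) s
      = enat (s * (k * (m - k)) + (s - 1))"
    and "s * (k * (m - k)) + (s - 1) + 1 \<le> fun_space.dim (exterior_power scale k)"
proof -
  note I = card_secant_index[OF assms(3,1)]
  have k: "1 \<le> k" using assms(2) by simp
  have range: "range (secant_chart k s) \<subseteq> wedge_sums k s" using secant_chart_in_wedge_sums[OF k] by blast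
  show "secant_dim fscale (exterior_power scale k) (plucker scale k ` grassmannian scale k) s
      = enat (s * (k * (m - k)) + (s - 1))"
    using dimension_of_secant[OF assms(3) k I(1) secant_chart_polynomial
        secant_chart_local_parameters[OF assms(3,2,1)] range secant_chart_dominates[OF assms(3,1)]] I(2)
    by simp
  show "s * (k * (m - k)) + (s - 1) + 1 \<le> fun_space.dim (exterior_power scale k)"
    using dim_exterior_power_ge[OF I(1) secant_chart_local_parameters[OF assms(3,2,1)] range] I(2) by simp
qed

lemma block_grassmannian_dim:
  assumes "3 \<le> k" "k \<le> m"
  shows "variety_dim fscale (exterior_power scale k) (plucker scale k ` grassmannian scale k)
      = enat (k * (m - k))"
proof -
  have m: "k * 1 \<le> m" and k: "1 \<le> k" using assms by auto
  have range: "range (secant_chart k 1) \<subseteq> wedge_sums k 1" using secant_chart_in_wedge_sums[OF k] by blast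
  note I = card_secant_index[OF m order_refl]
  show ?thesis
    using dimension_of_grassmannian[OF k I(1) secant_chart_polynomial
        secant_chart_local_parameters[OF m assms(1) order_refl] range secant_chart_dominates[OF m order_refl]] I(2)
    by simp
qed

end

theorem theorem2p1:
  fixes scale :: "'a::{alg_closed_field, field_char_0} \<Rightarrow> 'v::ab_group_add \<Rightarrow> 'v"
    and n k s :: nat
  assumes "vector_space scale"
    and "vector_space.dim scale (UNIV :: 'v set) = n + 1"
    and "1 \<le> k" and "k \<le> (n + 1) div 2"
    and "1 \<le> s"
  defines "W \<equiv> exterior_power scale k"
  defines "X \<equiv> plucker scale k ` grassmannian scale k"
  shows "(k = 2 \<longrightarrow>
            typical_rank scale 2 = (n + 1) div 2 \<and>
            (s < typical_rank scale 2 \<longrightarrow>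
               (2 \<le> s \<longrightarrow> defective fscale W X s) \<and>
               secant_dim fscale W X s + enat (2 * s * (s - 1)) = parameter_count fscale W X s \<and>
               (parameter_count fscale W X s \<le> ambient_dim fscale W \<longrightarrow>
                  defectiveness fscale W X s = enat (2 * s * (s - 1))))) \<and>
         (3 \<le> k \<and> k * s \<le> n + 1 \<longrightarrow>
            secant_dim fscale W X s = expected_secant_dim fscale W X s)"
proof -
  interpret vector_space scale by fact
  interpret char0_space scale ..
  obtain e cd where "based_space scale e cd (n + 1)" using ex_based_space[OF assms(2)] by auto
  then interpret based_space scale e cd "n + 1" .
  show ?thesis
  proof (intro conjI impI)
    assume k: "k = 2"
    have m: "4 \<le> n + 1" using assms(4) k by linarith
    show tr: "typical_rank scale 2 = (n + 1) div 2" by (rule typical_rank_two[OF m])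
    assume "s < typical_rank scale 2"
    then have "2 * s + 2 \<le> n + 1" unfolding tr by linarith
    then obtain q where q: "n + 1 = 2 * s + 2 + q" using le_Suc_ex by blast
    obtain a where a: "s = Suc a" using assms(5) by (cases s) auto
    let ?d = "s * (2 * (n + 1) - 2 * s - 1) - 1"
    have sec: "secant_dim fscale W X s = enat ?d"
      unfolding W_def X_def k by (rule bivector_secant_dim(1)) (use assms(5) q in auto)
    have par: "parameter_count fscale W X s = enat (s * (2 * (n + 1) - 4) + (s - 1))"
      unfolding parameter_count_def W_def X_def k using bivector_grassmannian_dim m by simp
    have eq: "?d + 2 * s * (s - 1) = s * (2 * (n + 1) - 4) + (s - 1)"
      unfolding q a by (simp add: algebra_simps)
    show "secant_dim fscale W X s + enat (2 * s * (s - 1)) = parameter_count fscale W X s"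
      unfolding sec par using eq by simp
    show "defective fscale W X s" if "2 \<le> s"
    proof -
      \<comment> \<open>Already the next secant variety fits into the ambient space.\<close>
      have "(s + 1) * (2 * (n + 1) - 2 * (s + 1) - 1) \<le> fun_space.dim W"
        unfolding W_def k by (rule bivector_secant_dim(2)) (use q in auto)
      moreover have "?d + 1 < (s + 1) * (2 * (n + 1) - 2 * (s + 1) - 1)"
        unfolding q a by (simp add: algebra_simps)
      ultimately have "?d < fun_space.dim W - 1" by linarith
      moreover have "0 < 2 * s * (s - 1)" using that by simp
      then have "?d < s * (2 * (n + 1) - 4) + (s - 1)" using eq by linarith
      ultimately show ?thesis
        unfolding defective_def expected_secant_dim_def ambient_dim_def sec par by simp
    qed
    show "defectiveness fscale W X s = enat (2 * s * (s - 1))"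
      if "parameter_count fscale W X s \<le> ambient_dim fscale W"
    proof -
      have "expected_secant_dim fscale W X s = parameter_count fscale W X s"
        unfolding expected_secant_dim_def using that by (rule min_absorb2)
      then show ?thesis
        unfolding defectiveness_def sec par eq[symmetric] by (simp only: idiff_enat_enat diff_add_inverse)
    qed
  next
    assume k: "3 \<le> k \<and> k * s \<le> n + 1"
    then have k': "3 \<le> k" "k * s \<le> n + 1" by auto
    have "k \<le> n + 1" using assms(4) by linarith
    then have "parameter_count fscale W X s = enat (s * (k * (n + 1 - k)) + (s - 1))"
      unfolding parameter_count_def W_def X_def block_grassmannian_dim[OF k'(1) \<open>k \<le> n + 1\<close>] by simp
    moreover have "s * (k * (n + 1 - k)) + (s - 1) \<le> fun_space.dim W - 1"
      using block_secant_dim(2)[OF assms(5) k'] unfolding W_def by linarith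
    moreover have "secant_dim fscale W X s = enat (s * (k * (n + 1 - k)) + (s - 1))"
      unfolding W_def X_def by (rule block_secant_dim(1)[OF assms(5) k'])
    ultimately show "secant_dim fscale W X s = expected_secant_dim fscale W X s"
      unfolding expected_secant_dim_def ambient_dim_def by (simp add: min_def)
  qed
qed

end
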